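(* Let $z\in\mathrm{span}\{V\}\setminus\{0\}$ be the current iterate of the PSD-id and let $z'$ be the next iterate, computed with a preconditioner $K$ that is effectively positive definite. Let $\nu<\lambda_i$ be arbitrary, and let $\varepsilon=(\beta-\alpha)/(\beta+\alpha)$ be the quality parameter of $K$ with respect to $\nu$. If $\rho(z)\in(\lambda_j,\lambda_{j+1})$ for a certain $j\ge i$, then $$\frac{\rho(z')-\lambda_j}{\lambda_{j+1}-\rho(z')}\le\left(\frac{\kappa+\varepsilon(2-\kappa)}{(2-\kappa)+\varepsilon\kappa}\right)^2\frac{\rho(z)-\lambda_j}{\lambda_{j+1}-\rho(z)}\quad\text{with}\quad \kappa=\left(\frac{\lambda_j-\nu}{\lambda_{j+1}-\nu}\right)\left(\frac{\lambda_n-\lambda_{j+1}}{\lambda_n-\lambda_j}\right).$$ Moreover, equality in this bound is attainable in the limit case $\rho(z)\to\lambda_j$ in an invariant subspace of $(H,S)$ associated with the eigenvalues $\lambda_j$, $\lambda_{j+1}$ and $\lambda_n$.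
   Context: Setting. $H,S\in\mathbb{C}^{n\times n}$ are Hermitian, $S$ is positive definite, and $\lambda_1\le\cdots\le\lambda_n$ are the (real) eigenvalues of the pair $(H,S)$, i.e. of $Hu=\lambda Su$. The Rayleigh quotient is $\rho(x)=(x^*Hx)/(x^*Sx)$ for $x\ne0$. Fix $i\in\{1,\ldots,n\}$. Let $u_1,\ldots,u_n$ be an $S$-orthonormal basis of $\mathbb{C}^n$ with $Hu_l=\lambda_lSu_l$, and set $U=[u_1,\ldots,u_{i-1}]$ (the already computed eigenvectors, assumed exact) and $V=[u_i,\ldots,u_n]$. Thus $HV=SV\Lambda$ with $\Lambda=\mathrm{diag}(\lambda_i,\ldots,\lambda_n)$, and $\mathrm{span}\{V\}$ is the $S$-orthogonal complement of $\mathrm{span}\{U\}$. Here $\mathrm{span}\{\cdot\}$ denotes the span of all columns of the listed matrices/vectors. Ritz pairs. For a subspace with basis matrix $W$, the Ritz values of $(H,S)$ in it are the eigenvalues of the pair $(W^*HW,W^*SW)$ (counted with multiplicity), and the vectors $Wg$ with $g$ a corresponding eigenvector are the associated Ritz vectors. PSD-id (preconditioned steepest descent with implicit deflation). Given $z\in\mathrm{span}\{V\}\setminus\{0\}$ and a Hermitian preconditioner $K\in\mathbb{C}^{n\times n}$, let $r=Hz-\rho(z)Sz$ and $p=Kr$. The next iterate $z'$ is an $S$-normalized Ritz vector associated with the $i$th smallest Ritz value of $(H,S)$ in $\mathrm{span}\{U,z,p\}$, where the columns of $U$ serve as Ritz vectors for the $i-1$ smallest Ritz values and $z'$ is $S$-orthogonal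 to them. Preconditioner. $K$ is called effectively positive definite if $\widetilde K=V^*SKSV$ is positive definite. For $\nu<\lambda_i$ put $\Lambda_\nu=\Lambda-\nu I_{n-i+1}$, let $\alpha$ and $\beta$ be the smallest and largest eigenvalues of $\widetilde K\Lambda_\nu$ (they satisfy $\beta\ge\alpha>0$), and define the quality parameter $\varepsilon=(\beta-\alpha)/(\beta+\alpha)\in[0,1)$. With $\omega=2/(\beta+\alpha)$ one has $\|I_{n-i+1}-\omega\widetilde K\Lambda_\nu\|_{\Lambda_\nu}\le\varepsilon<1$, where $\|\cdot\|_{\Lambda_\nu}$ is the operator norm induced by the vector norm $(x^*\Lambda_\nu x)^{1/2}$. The last sentence of the claim is a sharpness statement: for suitable iterates $z$ in such an invariant subspace and suitable preconditioners with the given $\varepsilon$, the bound is attained in the limit as $\rho(z)\to\lambda_j$.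
   Formalization: The attainability of equality is proved for j+1<n (three different eigenpairs, λ_{j+1}=λ_n allowed); for j+1=n and ε>0 it fails, since then ρ(z')≤λ_j while the bound's factor is ε²>0. *)

theory Defs
  imports "Jordan_Normal_Form.Schur_Decomposition" "Jordan_Normal_Form.VS_Connect"
begin

definition hermitian_mat :: "nat \<Rightarrow> complex mat \<Rightarrow> bool" where
  "hermitian_mat n A \<longleftrightarrow> A \<in> carrier_mat n n \<and> mat_adjoint A = A"

text \<open>For Hermitian \<open>A\<close> the form $x^*Ax$ is real, so taking \<open>Re\<close> loses nothing; the same
  remark applies to the Rayleigh quotient below.\<close>

definition pos_def_mat :: "nat \<Rightarrow> complex mat \<Rightarrow> bool" where
  "pos_def_mat n A \<longleftrightarrow> hermitian_mat n A \<and>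
     (\<forall>x\<in>carrier_vec n. x \<noteq> 0\<^sub>v n \<longrightarrow> Re (conjugate x \<bullet> (A *\<^sub>v x)) > 0)"

definition rayleigh :: "complex mat \<Rightarrow> complex mat \<Rightarrow> complex vec \<Rightarrow> real" where
  "rayleigh H S x = Re ((conjugate x \<bullet> (H *\<^sub>v x)) / (conjugate x \<bullet> (S *\<^sub>v x)))"

abbreviation cspan :: "nat \<Rightarrow> complex vec set \<Rightarrow> complex vec set" where
  "cspan n X \<equiv> LinearCombinations.module.span class_ring (module_vec TYPE(complex) n) X"

abbreviation clin_indpt :: "nat \<Rightarrow> complex vec set \<Rightarrow> bool" where
  "clin_indpt n X \<equiv> \<not> LinearCombinations.module.lin_dep class_ring (module_vec TYPE(complex) n) X"

text \<open>\<open>ts\<close> lists the eigenvalues of the pair \<open>(A, B)\<close>, i.e. of $Ag = tBg$, in nondecreasing order and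
  with multiplicity, namely as the roots of $\det(xB - A)$. For \<open>A\<close> Hermitian and \<open>B\<close> positive
  definite all roots are real, and $\det B \neq 0$ forces \<open>length ts\<close> to be the matrix size.\<close>

definition pair_eigenvalues :: "complex mat \<Rightarrow> complex mat \<Rightarrow> real list \<Rightarrow> bool" where
  "pair_eigenvalues A B ts \<longleftrightarrow> sorted ts \<and>
     det (map_mat (\<lambda>b. [:0, b:]) B - map_mat (\<lambda>a. [:a:]) A)
       = smult (det B) (\<Prod>t\<leftarrow>ts. [:- complex_of_real t, 1:])"

definition pair_eigenvector :: "complex mat \<Rightarrow> complex mat \<Rightarrow> real \<Rightarrow> complex vec \<Rightarrow> bool" where
  "pair_eigenvector A B t g \<longleftrightarrow> g \<in> carrier_vec (dim_col A) \<and> g \<noteq> 0\<^sub>v (dim_col A) \<and>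
     A *\<^sub>v g = complex_of_real t \<cdot>\<^sub>v (B *\<^sub>v g)"

definition basis_matrix :: "nat \<Rightarrow> complex vec set \<Rightarrow> complex mat \<Rightarrow> bool" where
  "basis_matrix n X W \<longleftrightarrow> dim_row W = n \<and> distinct (cols W) \<and> clin_indpt n (set (cols W)) \<and>
     cspan n (set (cols W)) = X"

definition ritz_values :: "complex mat \<Rightarrow> complex mat \<Rightarrow> complex mat \<Rightarrow> real list \<Rightarrow> bool" where
  "ritz_values H S W ts \<longleftrightarrow>
     pair_eigenvalues (mat_adjoint W * H * W) (mat_adjoint W * S * W) ts"

definition ritz_vector :: "complex mat \<Rightarrow> complex mat \<Rightarrow> complex mat \<Rightarrow> real \<Rightarrow> complex vec \<Rightarrow> bool" where
  "ritz_vector H S W t w \<longleftrightarrow>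
     (\<exists>g. pair_eigenvector (mat_adjoint W * H * W) (mat_adjoint W * S * W) t g \<and> w = W *\<^sub>v g)"

text \<open>One step of PSD-id: \<open>z'\<close> is a possible next iterate for the current iterate \<open>z\<close> and the
  preconditioner \<open>K\<close>. Lists are indexed from \<open>0\<close>, so \<open>ts ! dim_col U\<close> is the $i$th smallest Ritz value
  for $i - 1$ deflated eigenvectors. The Ritz pairs of a subspace do not depend on the basis
  matrix \<open>W\<close>.\<close>

definition psd_id_step ::
  "nat \<Rightarrow> complex mat \<Rightarrow> complex mat \<Rightarrow> complex mat \<Rightarrow> complex mat \<Rightarrow> complex mat \<Rightarrow>
    complex vec \<Rightarrow> complex vec \<Rightarrow> bool" where
  "psd_id_step n H S U V K z z' \<longleftrightarrow>
     hermitian_mat n K \<and> z \<in> cspan n (set (cols V)) \<and> z \<noteq> 0\<^sub>v n \<and>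
     (let r = H *\<^sub>v z - complex_of_real (rayleigh H S z) \<cdot>\<^sub>v (S *\<^sub>v z);
          p = K *\<^sub>v r
      in \<exists>W ts. basis_matrix n (cspan n (set (cols U) \<union> {z, p})) W \<and> ritz_values H S W ts \<and>
           (\<forall>l<dim_col U. ritz_vector H S W (ts ! l) (col U l)) \<and>
           ritz_vector H S W (ts ! dim_col U) z' \<and>
           conjugate z' \<bullet> (S *\<^sub>v z') = 1 \<and>
           (\<forall>l<dim_col U. conjugate (col U l) \<bullet> (S *\<^sub>v z') = 0))"

definition compressed_prec :: "complex mat \<Rightarrow> complex mat \<Rightarrow> complex mat \<Rightarrow> complex mat" where
  "compressed_prec S V K = mat_adjoint V * S * K * S * V"

definition effectively_pos_def :: "complex mat \<Rightarrow> complex mat \<Rightarrow> complex mat \<Rightarrow> bool" where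
  "effectively_pos_def S V K \<longleftrightarrow> pos_def_mat (dim_col V) (compressed_prec S V K)"

text \<open>In the intended use \<open>M\<close> is a product of two positive definite matrices; hence all its
  eigenvalues are real and the sets below are finite and nonempty.\<close>

definition min_eigenvalue :: "complex mat \<Rightarrow> real" where
  "min_eigenvalue M = Min {a. eigenvalue M (complex_of_real a)}"

definition max_eigenvalue :: "complex mat \<Rightarrow> real" where
  "max_eigenvalue M = Max {a. eigenvalue M (complex_of_real a)}"

definition quality :: "complex mat \<Rightarrow> complex mat \<Rightarrow> complex mat \<Rightarrow> real \<Rightarrow> complex mat \<Rightarrow> real" where
  "quality S V \<Lambda> \<nu> K =
     (let M = compressed_prec S V K * (\<Lambda> - complex_of_real \<nu> \<cdot>\<^sub>m 1\<^sub>m (dim_row \<Lambda>));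
          \<alpha> = min_eigenvalue M; \<beta> = max_eigenvalue M
      in (\<beta> - \<alpha>) / (\<beta> + \<alpha>))"

end

theory Submission
  imports Defs "Jordan_Normal_Form.Spectral_Radius"
begin

text \<open>In \<open>S\<close>-orthonormal eigencoordinates, with spectrum shifted by \<open>\<nu>\<close>, the scaled search direction \<open>p\<close> lies in
  the ball of relative radius \<open>\<epsilon>\<close>, in the norm of \<open>\<Lambda>\<^sub>\<nu>\<close>, around \<open>d = (I - (\<rho> - \<nu>) \<Lambda>\<^sub>\<nu>\<^sup>-\<^sup>1) y\<close>. Let \<open>\<theta>\<close> be the value at which
  the asserted bound is an equality. It suffices to find one vector in the span of \<open>y\<close> and \<open>p\<close> whose Rayleigh
  quotient is at most \<open>\<theta>\<close>. A step length that depends only on \<open>\<rho>\<close>, \<open>\<epsilon>\<close> and the eigenvalues works for every \<open>p\<close> in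
  the ball: with explicit Lagrange multipliers the inequality splits into one \<open>2 \<times> 2\<close> semidefiniteness condition per
  eigenvalue, and its determinant is a cubic in the eigenvalue with the required sign outside the gap
  \<open>(\<lambda>\<^sub>j, \<lambda>\<^sub>j\<^sub>+\<^sub>1)\<close> up to \<open>\<lambda>\<^sub>n\<close>. A min-max argument passes from this vector to the Ritz value of \<open>z'\<close>.

  Near \<open>\<rho> = \<lambda>\<^sub>j\<close> the step is a line search for a quadratic form whose preconditioned condition number is
  \<open>(1 + \<epsilon>) / ((1 - \<epsilon>) (1 - \<kappa>))\<close>; the Kantorovich extremal with a diagonal preconditioner attains the factor.\<close>

section \<open>The scalar inequality\<close>

text \<open>Write \<open>\<mu>\<close>, \<open>b\<close>, \<open>c\<close> for the shifted
  eigenvalues with indices \<open>j\<close>, \<open>j + 1\<close>, \<open>n\<close>. At \<rho> =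
  \<lambda>_j the form to be reduced has coefficients x - \<mu>, and exact preconditioning divides
  them by x. On [b, c] the quotients 1 - \<mu>/x run from 1 - \<mu>/b to 1 - \<mu>/c, and the ratio
  of these two ends is 1 - \<kappa>. An inexact preconditioner widens the range by at most (1 +
  \<epsilon>)/(1 - \<epsilon>), and \<sigma> is the line search factor (q - 1)/(q + 1) for the
  resulting condition number q. Away from the limit the obstacle is that the direction p and its
  best step length depend on each other. Once the step length is fixed, only two quadratic facts
  about the pair (y, p) remain: the Rayleigh quotient of y and the ball containing p. Both are
  diagonal in eigencoordinates, which is why multipliers decouple the eigenvalues. The hypothesis on
  K controls it only on the S-orthogonal complement of U. The components of p along U are arbitrary;
  they are cancelled by the columns of U, which belong to the search space.\<close>

lemma binary_form_nonneg:
  fixes \<alpha> \<beta> \<gamma> :: real and y f :: complex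
  assumes "0 \<le> \<alpha>" "0 \<le> \<gamma>" "\<beta>\<^sup>2 \<le> \<alpha> * \<gamma>"
  shows "0 \<le> \<alpha> * (cmod y)\<^sup>2 + \<gamma> * (cmod f)\<^sup>2 - 2 * \<beta> * Re (cnj y * f)"
proof -
  have "\<bar>\<beta>\<bar> \<le> sqrt \<alpha> * sqrt \<gamma>"
    using assms by (metis real_sqrt_abs real_sqrt_le_iff real_sqrt_mult)
  moreover have "\<bar>Re (cnj y * f)\<bar> \<le> cmod y * cmod f"
    by (metis abs_Re_le_cmod complex_mod_cnj norm_mult)
  ultimately have "\<bar>\<beta> * Re (cnj y * f)\<bar> \<le> (sqrt \<alpha> * sqrt \<gamma>) * (cmod y * cmod f)"
    unfolding abs_mult using assms by (intro mult_mono) auto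
  moreover have "0 \<le> (sqrt \<alpha> * cmod y - sqrt \<gamma> * cmod f)\<^sup>2" by simp
  ultimately show ?thesis
    using assms by (simp add: power2_diff power_mult_distrib) (simp add: algebra_simps)
qed

text \<open>The cubic \<open>g (Z w - \<eta> g) (Z w - \<eta> r) - r q\<^sup>2\<close> is, up to the factor \<open>\<eta> Z w\<close>, the
  determinant of the quadratic form in \<open>perturbed_step_pointwise\<close>. Homogeneous coordinates
  \<open>(a, P)\<close> on the spectrum make \<open>a = 0\<close> at \<open>\<lambda>\<^sub>j\<^sub>+\<^sub>1\<close> and \<open>P = 0\<close> at \<open>\<lambda>\<^sub>j\<close>; above \<open>\<lambda>\<^sub>j\<^sub>+\<^sub>1\<close> the ratio \<open>N = -a / P\<close>
  runs up to \<open>\<kappa>\<close>, below \<open>\<lambda>\<^sub>j\<close> the ratio \<open>M = -P / a\<close> runs up to \<open>1\<close>.\<close>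

lemma spectral_cubic_nonneg_above:
  fixes \<sigma> D \<eta> s N :: real
  assumes "0 \<le> s" "0 \<le> D" "0 \<le> \<eta>" "\<sigma> = D + \<eta>" "\<sigma> \<le> 1" "0 \<le> N" "(1 + \<sigma>) * N \<le> 2 * D"
  shows "0 \<le> D - \<sigma> * N"
    and "(1 + \<sigma>\<^sup>2 * s * N) * (1 + s) * (D - N)\<^sup>2
      \<le> (1 + s * N) * (D - \<sigma> * N) * ((1 + s) * (D - \<sigma> * N) + \<eta> * s * N * (1 - \<sigma>\<^sup>2))"
proof -
  have "0 \<le> \<sigma>" using assms by simp
  have "2 * \<sigma> * N \<le> (1 + \<sigma>) * N"
    using assms by (intro mult_right_mono) auto
  with assms show A: "0 \<le> D - \<sigma> * N" by linarith
  have s2: "\<sigma>\<^sup>2 \<le> 1" using \<open>0 \<le> \<sigma>\<close> \<open>\<sigma> \<le> 1\<close> by (simp add: power_le_one)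
  \<comment> \<open>With \<open>D = \<kappa> * (1 + \<sigma>) / 2\<close>, as in the application,
    the last factor is nonnegative exactly for N \<le> \<kappa>. This is how the largest eigenvalue
    enters the rate.\<close>
  have "(D - \<sigma> * N)\<^sup>2 - (D - N)\<^sup>2 = N * (1 - \<sigma>) * (2 * D - (1 + \<sigma>) * N)"
    by (simp add: power2_eq_square algebra_simps)
  also have "\<dots> \<ge> 0" using assms by simp
  finally have "(D - N)\<^sup>2 \<le> (D - \<sigma> * N)\<^sup>2" by simp
  moreover have "1 + \<sigma>\<^sup>2 * s * N \<le> 1 + s * N"
    using mult_right_mono[OF s2, of "s * N"] assms by (simp add: mult.assoc)
  ultimately have "(1 + \<sigma>\<^sup>2 * s * N) * (D - N)\<^sup>2 \<le> (1 + s * N) * (D - \<sigma> * N)\<^sup>2"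
    using assms by (intro mult_mono) auto
  hence "(1 + \<sigma>\<^sup>2 * s * N) * (D - N)\<^sup>2 * (1 + s) \<le> (1 + s * N) * (D - \<sigma> * N)\<^sup>2 * (1 + s)"
    using assms by (intro mult_right_mono) auto
  moreover have "0 \<le> (1 + s * N) * (D - \<sigma> * N) * (\<eta> * s * N * (1 - \<sigma>\<^sup>2))"
    using assms A s2 by simp
  ultimately show "(1 + \<sigma>\<^sup>2 * s * N) * (1 + s) * (D - N)\<^sup>2
      \<le> (1 + s * N) * (D - \<sigma> * N) * ((1 + s) * (D - \<sigma> * N) + \<eta> * s * N * (1 - \<sigma>\<^sup>2))"
    by (simp add: power2_eq_square algebra_simps)
qed

text \<open>Since \<open>\<sigma> \<le> 1\<close>, the number \<open>\<sigma> - M * D\<close> is at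
  most \<open>1 - D * M\<close> and also at most \<open>\<sigma> * (1 - D * M)\<close>. The first
  bound serves the summand with weight \<open>M\<close>, the second the summand with weight
  \<open>s\<close>; adding them produces the factor \<open>M + \<sigma>\<^sup>2 * s\<close>. The
  inequality is reversed compared with the case above the gap because \<open>g\<close> and
  \<open>r\<close> are not positive here.\<close>

lemma spectral_cubic_nonneg_below:
  fixes \<sigma> D \<eta> s M :: real
  assumes "0 \<le> s" "0 \<le> D" "0 \<le> \<eta>" "\<sigma> = D + \<eta>" "\<sigma> \<le> 1" "0 \<le> M" "M < 1"
  shows "0 \<le> \<sigma> - M * D"
    and "(M + s) * (\<sigma> - M * D) * ((1 + s) * (\<sigma> - M * D) - \<eta> * s * (1 - \<sigma>\<^sup>2))
      \<le> (M + \<sigma>\<^sup>2 * s) * (1 + s) * (1 - D * M)\<^sup>2"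
proof -
  have "0 \<le> \<sigma>" using assms by simp
  have "M * D \<le> 1 * D" using assms by (intro mult_right_mono) auto
  with assms show A: "0 \<le> \<sigma> - M * D" by linarith
  have s2: "\<sigma>\<^sup>2 \<le> 1" using \<open>0 \<le> \<sigma>\<close> \<open>\<sigma> \<le> 1\<close> by (simp add: power_le_one)
  have "(\<sigma> - M * D)\<^sup>2 \<le> (1 - D * M)\<^sup>2"
    using A assms by (intro power_mono) (auto simp: mult.commute)
  moreover have "(\<sigma> - M * D)\<^sup>2 \<le> (\<sigma> * (1 - D * M))\<^sup>2"
  proof (rule power_mono[OF _ A])
    have "\<sigma> * (D * M) \<le> 1 * (D * M)" using assms by (intro mult_right_mono) auto
    thus "\<sigma> - M * D \<le> \<sigma> * (1 - D * M)" by (simp add: algebra_simps)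
  qed
  ultimately have "M * (\<sigma> - M * D)\<^sup>2 + s * (\<sigma> - M * D)\<^sup>2
      \<le> M * (1 - D * M)\<^sup>2 + s * (\<sigma> * (1 - D * M))\<^sup>2"
    using assms by (intro add_mono mult_left_mono) auto
  hence "(M + s) * (\<sigma> - M * D)\<^sup>2 \<le> (M + \<sigma>\<^sup>2 * s) * (1 - D * M)\<^sup>2"
    unfolding power_mult_distrib by (simp add: distrib_right mult_ac)
  hence "(M + s) * (\<sigma> - M * D)\<^sup>2 * (1 + s) \<le> (M + \<sigma>\<^sup>2 * s) * (1 - D * M)\<^sup>2 * (1 + s)"
    using assms by (intro mult_right_mono) auto
  moreover have "0 \<le> (M + s) * (\<sigma> - M * D) * (\<eta> * s * (1 - \<sigma>\<^sup>2))"
    using assms A s2 by simp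
  ultimately show "(M + s) * (\<sigma> - M * D) * ((1 + s) * (\<sigma> - M * D) - \<eta> * s * (1 - \<sigma>\<^sup>2))
      \<le> (M + \<sigma>\<^sup>2 * s) * (1 + s) * (1 - D * M)\<^sup>2"
    by (simp add: power2_eq_square algebra_simps)
qed

text \<open>These are the three conditions under which the form in \<open>y\<close> and
  \<open>f\<close> of the next lemma is nonnegative: the coefficient of |f|^2, the coefficient of
  |y|^2, and the determinant condition freed of its common factor.\<close>

lemma spectral_cubic:
  fixes \<sigma> D \<eta> s a P :: real
  defines "w \<equiv> a + P" and "g \<equiv> P - s * a" and "r \<equiv> P - \<sigma>\<^sup>2 * s * a"
    and "q \<equiv> (1 + s) * (a + D * P)" and "Z \<equiv> \<sigma> + D * s"
  assumes par: "0 \<le> s" "0 \<le> D" "0 \<le> \<eta>" "\<sigma> = D + \<eta>" "\<sigma> \<le> 1"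
    and w: "0 < w"
    and cases: "P \<le> 0 \<or> (a \<le> 0 \<and> - ((1 + \<sigma>) * a) \<le> 2 * D * P)"
  shows "0 \<le> Z * w - \<eta> * r"
    and "0 \<le> Z * w * g * (Z * w - \<eta> * g) - r * q\<^sup>2"
    and "r * q\<^sup>2 \<le> g * (Z * w - \<eta> * g) * (Z * w - \<eta> * r)"
proof -
  have Z0: "0 \<le> Z" and sig0: "0 \<le> \<sigma>" using par unfolding Z_def by auto
  have s2: "\<sigma>\<^sup>2 \<le> 1" using sig0 \<open>\<sigma> \<le> 1\<close> by (simp add: power_le_one)
  have "0 \<le> Z * w - \<eta> * r \<and> 0 \<le> Z * w * g * (Z * w - \<eta> * g) - r * q\<^sup>2 \<and>
     r * q\<^sup>2 \<le> g * (Z * w - \<eta> * g) * (Z * w - \<eta> * r)"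
  proof (cases "P \<le> 0")
    case True
    define M where "M = - P / a"
    have a: "0 < a" using True w unfolding w_def by simp
    have P: "P = - M * a" using a by (simp add: M_def)
    have M: "0 \<le> M" "M < 1" using True w a unfolding w_def M_def by (auto simp: field_simps)
    note L = spectral_cubic_nonneg_below[OF par M]
    have g: "g = - (M + s) * a" and r: "r = - (M + \<sigma>\<^sup>2 * s) * a"
      and q: "q = (1 + s) * (1 - D * M) * a"
      unfolding g_def r_def q_def P by (auto simp: algebra_simps)
    have Zg: "Z * w - \<eta> * g = (1 + s) * (\<sigma> - M * D) * a"
      unfolding g Z_def w_def P \<open>\<sigma> = D + \<eta>\<close> by (simp add: algebra_simps)
    have Zr: "Z * w - \<eta> * r = ((1 + s) * (\<sigma> - M * D) - \<eta> * s * (1 - \<sigma>\<^sup>2)) * a"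
      using Zg unfolding g r by (simp add: algebra_simps)
    have rneg: "r \<le> 0"
      unfolding r using mult_nonneg_nonneg[of "M + \<sigma>\<^sup>2 * s" a] a M(1) par(1)
      by (simp only: mult_minus_left neg_le_0_iff_le) simp
    have gneg: "g \<le> 0"
      unfolding g using mult_nonneg_nonneg[of "M + s" a] a M(1) par(1)
      by (simp only: mult_minus_left neg_le_0_iff_le)
    have Zr0: "0 \<le> Z * w - \<eta> * r"
      using mult_nonneg_nonpos[OF par(3) rneg] mult_nonneg_nonneg[OF Z0 less_imp_le[OF w]] by linarith
    have Zg0: "0 \<le> Z * w - \<eta> * g"
      using mult_nonneg_nonpos[OF par(3) gneg] mult_nonneg_nonneg[OF Z0 less_imp_le[OF w]] by linarith
    \<comment> \<open>The cubic is homogeneous of degree 3 in \<open>(a, P)\<close>, so the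
      inequality in the single ratio \<open>M\<close> only has to be scaled by the cube of
      \<open>a\<close>; the remaining factor \<open>1 + s\<close> comes from
      \<open>q\<^sup>2\<close>.\<close>
    have "((M + s) * (\<sigma> - M * D) * ((1 + s) * (\<sigma> - M * D) - \<eta> * s * (1 - \<sigma>\<^sup>2))) * ((1 + s) * a ^ 3)
      \<le> ((M + \<sigma>\<^sup>2 * s) * (1 + s) * (1 - D * M)\<^sup>2) * ((1 + s) * a ^ 3)"
      using L(2) a par by (intro mult_right_mono) auto
    hence C: "r * q\<^sup>2 \<le> g * (Z * w - \<eta> * g) * (Z * w - \<eta> * r)"
      unfolding Zr Zg unfolding g r q
      by (simp add: power2_eq_square power3_eq_cube algebra_simps)
    \<comment> \<open>The second claim is a consequence of the third: \<open>g\<close> and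
      \<open>r\<close> have the same sign, so replacing \<open>Z * w - \<eta> * r\<close> by
      \<open>Z * w\<close> can only increase the right-hand side of the cubic inequality.\<close>
    have "Z * w \<le> Z * w - \<eta> * r" using rneg par by (simp add: mult_nonneg_nonpos)
    hence "(g * (Z * w - \<eta> * g)) * (Z * w - \<eta> * r) \<le> (g * (Z * w - \<eta> * g)) * (Z * w)"
      using gneg Zg0 by (intro mult_left_mono_neg) (auto simp: mult_nonpos_nonneg)
    with C Zr0 show ?thesis by (simp add: mult_ac)
  next
    case False
    define N where "N = - a / P"
    have P: "0 < P" using False by simp
    have a: "a = - N * P" using P by (simp add: N_def)
    have N: "0 \<le> N" "(1 + \<sigma>) * N \<le> 2 * D"
      using False cases P unfolding N_def by (auto simp: field_simps)
    note L = spectral_cubic_nonneg_above[OF par N]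
    have g: "g = (1 + s * N) * P" and r: "r = (1 + \<sigma>\<^sup>2 * s * N) * P"
      and q: "q = (1 + s) * (D - N) * P"
      unfolding g_def r_def q_def a by (auto simp: algebra_simps)
    have Zg: "Z * w - \<eta> * g = (1 + s) * (D - \<sigma> * N) * P"
      unfolding g Z_def w_def a \<open>\<sigma> = D + \<eta>\<close> by (simp add: algebra_simps)
    have Zr: "Z * w - \<eta> * r = ((1 + s) * (D - \<sigma> * N) + \<eta> * s * N * (1 - \<sigma>\<^sup>2)) * P"
      using Zg unfolding g r by (simp add: algebra_simps)
    have rpos: "0 \<le> r" unfolding r using P N par by simp
    have gpos: "0 \<le> g" unfolding g using P N par by simp
    have Zg0: "0 \<le> Z * w - \<eta> * g" unfolding Zg using L(1) P par by simp
    have Zr0: "0 \<le> Z * w - \<eta> * r" unfolding Zr using L(1) P par N s2 by simp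
    have "((1 + \<sigma>\<^sup>2 * s * N) * (1 + s) * (D - N)\<^sup>2) * ((1 + s) * P ^ 3)
      \<le> ((1 + s * N) * (D - \<sigma> * N) * ((1 + s) * (D - \<sigma> * N) + \<eta> * s * N * (1 - \<sigma>\<^sup>2)))
          * ((1 + s) * P ^ 3)"
      using L(2) P par by (intro mult_right_mono) auto
    hence C: "r * q\<^sup>2 \<le> g * (Z * w - \<eta> * g) * (Z * w - \<eta> * r)"
      unfolding Zr Zg unfolding g r q
      by (simp add: power2_eq_square power3_eq_cube algebra_simps)
    have "Z * w - \<eta> * r \<le> Z * w" using rpos par by simp
    hence "(g * (Z * w - \<eta> * g)) * (Z * w - \<eta> * r) \<le> (g * (Z * w - \<eta> * g)) * (Z * w)"
      using gpos Zg0 by (intro mult_left_mono) auto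
    with C Zr0 show ?thesis by (simp add: mult_ac)
  qed
  thus "0 \<le> Z * w - \<eta> * r"
    and "0 \<le> Z * w * g * (Z * w - \<eta> * g) - r * q\<^sup>2"
    and "r * q\<^sup>2 \<le> g * (Z * w - \<eta> * g) * (Z * w - \<eta> * r)" by auto
qed

text \<open>One term of the Lagrangian inequality, multiplied by \<open>w\<^sup>2\<close> to clear
  denominators: \<open>f\<close> is \<open>w\<close> times the scaled error of the direction, and
  \<open>q * y + \<eta> * f\<close> is \<open>w\<close> times the new coordinate. On the right stand
  the cone term with multiplier \<open>Z * \<eta>\<close> and the Rayleigh quotient term with
  multiplier \<open>Z\<^sup>2\<close>.\<close>

lemma perturbed_step_pointwise:
  fixes \<sigma> D \<eta> s a P :: real and y f :: complex
  defines "w \<equiv> a + P" and "g \<equiv> P - s * a" and "r \<equiv> P - \<sigma>\<^sup>2 * s * a"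
    and "q \<equiv> (1 + s) * (a + D * P)" and "Z \<equiv> \<sigma> + D * s"
  assumes par: "0 \<le> s" "0 \<le> D" "0 \<le> \<eta>" "\<sigma> = D + \<eta>" "\<sigma> \<le> 1"
    and w: "0 < w"
    and cases: "P \<le> 0 \<or> (a \<le> 0 \<and> - ((1 + \<sigma>) * a) \<le> 2 * D * P)"
  shows "r * (cmod (of_real q * y + of_real \<eta> * f))\<^sup>2
    \<le> w * (Z * \<eta> * (cmod f)\<^sup>2) + Z * g * (Z * w - \<eta> * g) * w * (cmod y)\<^sup>2"
proof -
  note C = spectral_cubic[OF par w[unfolded w_def] cases, folded w_def g_def r_def q_def Z_def]
  have Zw: "0 \<le> Z * w"
    using par w unfolding Z_def by (intro mult_nonneg_nonneg add_nonneg_nonneg) auto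
  \<comment> \<open>In the determinant the terms with the square of \<open>r * q * \<eta>\<close>
    cancel; what is left is \<open>\<eta> * Z * w\<close> times the difference of the two sides of
    the cubic inequality.\<close>
  have "r * q\<^sup>2 * (r * \<eta>) * \<eta> \<le> (Z * w * g * (Z * w - \<eta> * g) - r * q\<^sup>2) * (\<eta> * (Z * w - \<eta> * r))"
  proof -
    have "0 \<le> (\<eta> * (Z * w)) * (g * (Z * w - \<eta> * g) * (Z * w - \<eta> * r) - r * q\<^sup>2)"
      using C(3) by (intro mult_nonneg_nonneg[OF mult_nonneg_nonneg[OF par(3) Zw]]) simp
    thus ?thesis by (simp add: power2_eq_square algebra_simps)
  qed
  hence "(r * q * \<eta>)\<^sup>2 \<le> (Z * w * g * (Z * w - \<eta> * g) - r * q\<^sup>2) * (\<eta> * (Z * w - \<eta> * r))"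
    by (simp add: power2_eq_square mult_ac)
  from binary_form_nonneg[OF C(2) _ this, of y f] C(1) par
  have "0 \<le> (Z * w * g * (Z * w - \<eta> * g) - r * q\<^sup>2) * (cmod y)\<^sup>2 +
      \<eta> * (Z * w - \<eta> * r) * (cmod f)\<^sup>2 - 2 * (r * q * \<eta>) * Re (cnj y * f)" by simp
  moreover have "(cmod (of_real q * y + of_real \<eta> * f))\<^sup>2
      = q\<^sup>2 * (cmod y)\<^sup>2 + \<eta>\<^sup>2 * (cmod f)\<^sup>2 + 2 * q * \<eta> * Re (cnj y * f)"
    by (simp add: cmod_power2) (simp add: power2_eq_square algebra_simps)
  ultimately show ?thesis
    by (simp add: power2_eq_square algebra_simps)
qed

text \<open>The quotient defining \<open>\<sigma>\<close> is the solution of the linear equation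
  \<open>\<sigma> = D + \<epsilon> * (1 - D)\<close> in which \<open>D\<close> itself contains
  \<open>\<sigma>\<close>. The scalar estimates use this splitting into a spectral part
  \<open>D\<close> and an error part \<open>\<epsilon> * (1 - D)\<close> instead of the explicit
  quotient.\<close>

lemma kappa_sigma_range:
  fixes \<kappa> \<epsilon> :: real
  assumes "0 \<le> \<kappa>" "\<kappa> < 1" "0 \<le> \<epsilon>" "\<epsilon> < 1"
  defines "\<sigma> \<equiv> (\<kappa> + \<epsilon> * (2 - \<kappa>)) / ((2 - \<kappa>) + \<epsilon> * \<kappa>)"
  defines "D \<equiv> \<kappa> * (1 + \<sigma>) / 2"
  shows "0 \<le> \<sigma>" "\<sigma> < 1" "0 \<le> D" "D < 1" "\<sigma> = D + \<epsilon> * (1 - D)"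
proof -
  have den: "0 < (2 - \<kappa>) + \<epsilon> * \<kappa>" using assms by (simp add: add_pos_nonneg)
  have "0 \<le> \<kappa> + \<epsilon> * (2 - \<kappa>)" using assms by (intro add_nonneg_nonneg mult_nonneg_nonneg) auto
  with den show s0: "0 \<le> \<sigma>" unfolding \<sigma>_def by simp
  have "0 < 2 * (1 - \<epsilon>) * (1 - \<kappa>)" using assms by simp
  hence "\<kappa> + \<epsilon> * (2 - \<kappa>) < (2 - \<kappa>) + \<epsilon> * \<kappa>" by (simp add: algebra_simps)
  with den show s1: "\<sigma> < 1" unfolding \<sigma>_def by simp
  show "0 \<le> D" using s0 assms unfolding D_def by simp
  have "\<kappa> * (1 + \<sigma>) \<le> 1 * (1 + \<sigma>)" using s0 \<open>\<kappa> < 1\<close> by (intro mult_right_mono) auto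
  with s1 show "D < 1" unfolding D_def by simp
  have "\<sigma> * ((2 - \<kappa>) + \<epsilon> * \<kappa>) = \<kappa> + \<epsilon> * (2 - \<kappa>)" unfolding \<sigma>_def using den by simp
  thus "\<sigma> = D + \<epsilon> * (1 - D)" unfolding D_def by (simp add: field_simps)
qed

text \<open>The step \<open>A y + C p\<close> does not depend on the error \<open>d - p\<close>. With the multiplier \<open>Z \<eta>\<close> for the cone
  condition and \<open>Z\<^sup>2\<close> for the Rayleigh quotient condition the claim holds termwise.\<close>

lemma fixed_step_decrease:
  fixes x :: "'a \<Rightarrow> real" and y p d :: "'a \<Rightarrow> complex" and \<mu> b c \<rho> \<epsilon> :: real
  assumes fin: "finite I" and par: "0 < \<mu>" "\<mu> < \<rho>" "\<rho> < b" "b \<le> c" "0 \<le> \<epsilon>" "\<epsilon> < 1"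
    and x_pos: "\<And>l. l \<in> I \<Longrightarrow> 0 < x l"
    and x_gap: "\<And>l. l \<in> I \<Longrightarrow> x l \<le> \<mu> \<or> b \<le> x l \<and> x l \<le> c"
    and rho: "(\<Sum>l\<in>I. (x l - \<rho>) * (cmod (y l))\<^sup>2) = 0"
    and d: "\<And>l. l \<in> I \<Longrightarrow> d l = of_real ((x l - \<rho>) / x l) * y l"
    and cone: "(\<Sum>l\<in>I. x l * (cmod (d l - p l))\<^sup>2) \<le> \<epsilon>\<^sup>2 * (\<Sum>l\<in>I. x l * (cmod (d l))\<^sup>2)"
  defines "\<kappa> \<equiv> \<mu> / b * ((c - b) / (c - \<mu>))"
  defines "\<sigma> \<equiv> (\<kappa> + \<epsilon> * (2 - \<kappa>)) / ((2 - \<kappa>) + \<epsilon> * \<kappa>)"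
  defines "\<psi> \<equiv> (\<rho> - \<mu>) / (b - \<rho>)"
  shows "\<exists>A C. 0 < A \<and> (\<Sum>l\<in>I. ((x l - \<mu>) - \<sigma>\<^sup>2 * \<psi> * (b - x l))
            * (cmod (of_real A * y l + of_real C * p l))\<^sup>2) \<le> 0"
proof -
  define D where "D = \<kappa> * (1 + \<sigma>) / 2"
  define \<eta> where "\<eta> = \<epsilon> * (1 - D)"
  \<comment> \<open>This value makes \<open>P l - s * a l\<close> vanish at
    \<open>x l = \<rho>\<close>, so that it is a multiple of \<open>x l - \<rho>\<close> and its
    weighted sum is zero by the Rayleigh quotient condition.\<close>
  define s where "s = \<psi> * b / \<mu>"
  define Z where "Z = \<sigma> + D * s"
  define \<gamma> where "\<gamma> = b / (b - \<rho>)"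
  \<comment> \<open>Scaling the error by \<open>\<gamma> / \<epsilon>\<close> turns the cone
    condition into one without \<open>\<epsilon>\<close>. For \<open>\<epsilon> = 0\<close> division
    by zero gives \<open>\<phi> l = 0\<close>; the cone condition then forces
    \<open>p l = d l\<close>, so \<open>eps_phi\<close> holds in this case too.\<close>
  define \<phi> where "\<phi> l = of_real (\<gamma> / \<epsilon>) * (d l - p l)" for l
  define a where "a l = \<mu> * (b - x l)" for l
  define P where "P l = b * (x l - \<mu>)" for l
  define w where "w l = (b - \<mu>) * x l" for l
  define g where "g l = b * (1 + \<psi>) * (x l - \<rho>)" for l
  define r where "r l = b * ((x l - \<mu>) - \<sigma>\<^sup>2 * \<psi> * (b - x l))" for l
  \<comment> \<open>\<open>A\<close> and \<open>C\<close> are chosen so that an error-free direction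
    p = d multiplies \<open>y l\<close> by \<open>(1 + s) * (a l + D * P l) / w l\<close>. Relative
    to its value 1 + s at \<mu>, this multiplier is D at b. For \<epsilon> = 0 one has D = \<sigma>,
    and the value at c is -\<sigma>: the equioscillation of an optimal line search.\<close>
  define A where "A = 1 + s * D"
  define C where "C = - (1 - D) * \<gamma>"
  define X where "X l = of_real A * y l + of_real C * p l" for l
  have b0: "0 < b" using par by simp
  have "0 \<le> \<kappa>" unfolding \<kappa>_def using par by simp
  moreover have "\<kappa> < 1"
  proof -
    have "\<mu> / b * ((c - b) / (c - \<mu>)) \<le> \<mu> / b * 1"
      using par by (intro mult_left_mono) auto
    also have "\<dots> < 1" using par by simp
    finally show ?thesis unfolding \<kappa>_def by simp
  qed
  ultimately have sD: "0 \<le> \<sigma>" "\<sigma> < 1" "0 \<le> D" "D < 1" "\<sigma> = D + \<eta>"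
    using kappa_sigma_range[of \<kappa> \<epsilon>] par unfolding \<sigma>_def D_def \<eta>_def by auto
  have \<eta>0: "0 \<le> \<eta>" unfolding \<eta>_def using sD par by simp
  have \<psi>0: "0 < \<psi>" unfolding \<psi>_def using par by simp
  have s0: "0 < s" unfolding s_def using \<psi>0 par b0 by simp
  have Z0: "0 \<le> Z" unfolding Z_def using sD s0 by simp
  have \<mu>s: "\<mu> * s = \<psi> * b" unfolding s_def using par by simp
  have \<psi>\<rho>: "\<psi> * (b - \<rho>) = \<rho> - \<mu>" unfolding \<psi>_def using par by simp
  have b\<psi>: "(1 + \<psi>) * (b - \<rho>) = b - \<mu>" using \<psi>\<rho> by (simp add: algebra_simps)
  have w_eq: "w l = a l + P l" for l unfolding w_def a_def P_def by (simp add: algebra_simps)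
  have g_eq: "g l = P l - s * a l" for l
  proof -
    have "s * a l = (\<mu> * s) * (b - x l)" unfolding a_def by simp
    also have "\<dots> = b * (\<psi> * (b - x l))" unfolding \<mu>s by simp
    also have "\<psi> * (b - x l) = \<psi> * (b - \<rho>) - \<psi> * (x l - \<rho>)" by (simp add: algebra_simps)
    finally show ?thesis unfolding \<psi>\<rho> g_def P_def by (simp add: algebra_simps)
  qed
  have r_eq: "r l = P l - \<sigma>\<^sup>2 * s * a l" for l
  proof -
    have "s * a l = (\<mu> * s) * (b - x l)" unfolding a_def by simp
    hence "\<sigma>\<^sup>2 * s * a l = \<sigma>\<^sup>2 * (\<psi> * b * (b - x l))" unfolding \<mu>s by (simp only: mult.assoc)
    thus ?thesis unfolding r_def P_def by (simp add: algebra_simps)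
  qed
  have w0: "0 < w l" if "l \<in> I" for l unfolding w_def using x_pos[OF that] par by simp
  have gw: "g l / w l = \<gamma> * ((x l - \<rho>) / x l)" if "l \<in> I" for l
  proof -
    have "b * (1 + \<psi>) / (b - \<mu>) = \<gamma>"
      unfolding b\<psi>[symmetric] \<gamma>_def using \<psi>0 par by simp
    thus ?thesis unfolding g_def w_def by (metis times_divide_times_eq)
  qed
  have gwd: "of_real (g l / w l) * y l = of_real \<gamma> * d l" if "l \<in> I" for l
    unfolding gw[OF that] d[OF that] by simp
  have eps_phi: "of_real \<epsilon> * \<phi> l = of_real \<gamma> * (d l - p l)" if l: "l \<in> I" for l
  proof (cases "\<epsilon> = 0")
    case True
    have "(\<Sum>l\<in>I. x l * (cmod (d l - p l))\<^sup>2) \<le> 0" using cone True by simp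
    moreover have "0 \<le> x l * (cmod (d l - p l))\<^sup>2" if "l \<in> I" for l using x_pos[OF that] by simp
    ultimately have "x l * (cmod (d l - p l))\<^sup>2 = 0"
      using sum_nonneg_eq_0_iff[OF fin] l by (metis (no_types, lifting) antisym sum_nonneg)
    thus ?thesis using x_pos[OF l] True by simp
  qed (simp add: \<phi>_def)
  have qw: "(1 + s) * (a l + D * P l) / w l = A - (1 - D) * (g l / w l)" if "l \<in> I" for l
  proof -
    have "(1 + s) * (a l + D * P l) = A * w l - (1 - D) * g l"
      unfolding A_def w_eq g_eq by (simp add: algebra_simps)
    thus ?thesis using w0[OF that] by (simp add: diff_divide_distrib)
  qed
  have X_eq: "X l = of_real ((1 + s) * (a l + D * P l) / w l) * y l + of_real \<eta> * \<phi> l" if l: "l \<in> I" for l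
  proof -
    have "of_real \<eta> * \<phi> l = of_real (1 - D) * (of_real \<epsilon> * \<phi> l)" unfolding \<eta>_def by simp
    also have "\<dots> = of_real (1 - D) * (of_real \<gamma> * d l) - of_real (1 - D) * of_real \<gamma> * p l"
      unfolding eps_phi[OF l] by (simp add: algebra_simps)
    finally show ?thesis
      unfolding qw[OF l] X_def C_def gwd[OF l, symmetric] by (simp add: algebra_simps)
  qed
  have point: "r l * (cmod (X l))\<^sup>2
      \<le> Z * \<eta> * (w l * (cmod (\<phi> l))\<^sup>2) + Z\<^sup>2 * (g l * (cmod (y l))\<^sup>2)
        - Z * \<eta> * ((g l)\<^sup>2 / w l * (cmod (y l))\<^sup>2)" if l: "l \<in> I" for l
  proof -
    have cases: "P l \<le> 0 \<or> (a l \<le> 0 \<and> - ((1 + \<sigma>) * a l) \<le> 2 * D * P l)"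
    proof (cases "x l \<le> \<mu>")
      case True
      thus ?thesis unfolding P_def using b0 by (simp add: mult_nonneg_nonpos)
    next
      case False
      hence xl: "b \<le> x l" "x l \<le> c" using x_gap[OF l] by auto
      hence "0 \<le> (c - x l) * (b - \<mu>)" using par by simp
      hence "(x l - b) * (c - \<mu>) \<le> (c - b) * (x l - \<mu>)" by (simp add: algebra_simps)
      hence "x l - b \<le> (c - b) / (c - \<mu>) * (x l - \<mu>)" using par by (simp add: field_simps)
      hence "\<mu> * (x l - b) \<le> \<mu> * ((c - b) / (c - \<mu>) * (x l - \<mu>))"
        using par by (intro mult_left_mono) auto
      also have "\<dots> = \<kappa> * P l" unfolding \<kappa>_def P_def using b0 by simp
      finally have "(1 + \<sigma>) * (\<mu> * (x l - b)) \<le> (1 + \<sigma>) * (\<kappa> * P l)"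
        using sD by (intro mult_left_mono) auto
      moreover have "a l \<le> 0" unfolding a_def using xl par by (simp add: mult_nonneg_nonpos)
      ultimately show ?thesis unfolding a_def D_def by (simp add: algebra_simps)
    qed
    from perturbed_step_pointwise[of s D \<eta> \<sigma> "a l" "P l", OF _ _ \<eta>0 sD(5) _ _ cases, of "y l" "of_real (w l) * \<phi> l"]
    have "r l * (cmod (of_real ((1 + s) * (a l + D * P l)) * y l + of_real \<eta> * (of_real (w l) * \<phi> l)))\<^sup>2
       \<le> w l * (Z * \<eta> * (w l * cmod (\<phi> l))\<^sup>2) + Z * g l * (Z * w l - \<eta> * g l) * w l * (cmod (y l))\<^sup>2"
      using sD s0 w0[OF l] unfolding w_eq[symmetric] g_eq[symmetric] r_eq[symmetric] Z_def[symmetric]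
      by (simp add: norm_mult)
    moreover have "of_real ((1 + s) * (a l + D * P l)) * y l + of_real \<eta> * (of_real (w l) * \<phi> l) = of_real (w l) * X l"
      unfolding X_eq[OF l] using w0[OF l] by (simp add: field_simps)
    moreover have "w l * (Z * \<eta> * (w l * cmod (\<phi> l))\<^sup>2) + Z * g l * (Z * w l - \<eta> * g l) * w l * (cmod (y l))\<^sup>2
      = (w l)\<^sup>2 * (Z * \<eta> * (w l * (cmod (\<phi> l))\<^sup>2)
        + Z\<^sup>2 * (g l * (cmod (y l))\<^sup>2) - Z * \<eta> * ((g l)\<^sup>2 / w l * (cmod (y l))\<^sup>2))"
      using w0[OF l] by (simp add: power2_eq_square field_simps)
    moreover have "r l * (cmod (of_real (w l) * X l))\<^sup>2 = (w l)\<^sup>2 * (r l * (cmod (X l))\<^sup>2)"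
      by (simp add: norm_mult power_mult_distrib)
    ultimately have "(w l)\<^sup>2 * (r l * (cmod (X l))\<^sup>2) \<le> (w l)\<^sup>2 * (Z * \<eta> * (w l * (cmod (\<phi> l))\<^sup>2)
        + Z\<^sup>2 * (g l * (cmod (y l))\<^sup>2) - Z * \<eta> * ((g l)\<^sup>2 / w l * (cmod (y l))\<^sup>2))"
      by metis
    thus ?thesis using w0[OF l] by (simp del: of_real_add of_real_mult)
  qed
  have "(\<Sum>l\<in>I. w l * (cmod (\<phi> l))\<^sup>2) \<le> (\<Sum>l\<in>I. (g l)\<^sup>2 / w l * (cmod (y l))\<^sup>2)"
  proof -
    have R: "(\<Sum>l\<in>I. (g l)\<^sup>2 / w l * (cmod (y l))\<^sup>2) = \<gamma>\<^sup>2 * (b - \<mu>) * (\<Sum>l\<in>I. x l * (cmod (d l))\<^sup>2)"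
      unfolding sum_distrib_left
    proof (rule sum.cong[OF refl])
      fix l assume l: "l \<in> I"
      have "(g l)\<^sup>2 / w l * (cmod (y l))\<^sup>2 = w l * (cmod (of_real (g l / w l) * y l))\<^sup>2"
        using w0[OF l] by (simp add: norm_mult norm_divide power_mult_distrib power_divide power2_eq_square)
      thus "(g l)\<^sup>2 / w l * (cmod (y l))\<^sup>2 = \<gamma>\<^sup>2 * (b - \<mu>) * (x l * (cmod (d l))\<^sup>2)"
        unfolding gwd[OF l] by (simp add: w_def norm_mult power_mult_distrib)
    qed
    have "(\<Sum>l\<in>I. w l * (cmod (\<phi> l))\<^sup>2) = \<gamma>\<^sup>2 * (b - \<mu>) / \<epsilon>\<^sup>2 * (\<Sum>l\<in>I. x l * (cmod (d l - p l))\<^sup>2)"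
      unfolding sum_distrib_left
      by (rule sum.cong[OF refl]) (simp add: \<phi>_def w_def norm_mult norm_divide power_mult_distrib power_divide)
    also have "\<dots> \<le> \<gamma>\<^sup>2 * (b - \<mu>) / \<epsilon>\<^sup>2 * (\<epsilon>\<^sup>2 * (\<Sum>l\<in>I. x l * (cmod (d l))\<^sup>2))"
      using cone par by (intro mult_left_mono) auto
    also have "\<dots> \<le> \<gamma>\<^sup>2 * (b - \<mu>) * (\<Sum>l\<in>I. x l * (cmod (d l))\<^sup>2)"
    proof (cases "\<epsilon> = 0")
      case True
      have "0 \<le> (\<Sum>l\<in>I. x l * (cmod (d l))\<^sup>2)" using x_pos by (intro sum_nonneg) (simp add: less_imp_le)
      thus ?thesis using True par by simp
    qed simp
    finally show ?thesis unfolding R .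
  qed
  hence "Z * \<eta> * (\<Sum>l\<in>I. w l * (cmod (\<phi> l))\<^sup>2) \<le> Z * \<eta> * (\<Sum>l\<in>I. (g l)\<^sup>2 / w l * (cmod (y l))\<^sup>2)"
    using Z0 \<eta>0 by (intro mult_left_mono) auto
  moreover have "(\<Sum>l\<in>I. g l * (cmod (y l))\<^sup>2) = 0"
    using arg_cong[OF rho, of "\<lambda>t. b * (1 + \<psi>) * t"]
    by (simp add: g_def sum_distrib_left mult.assoc)
  moreover have "(\<Sum>l\<in>I. r l * (cmod (X l))\<^sup>2) \<le> Z * \<eta> * (\<Sum>l\<in>I. w l * (cmod (\<phi> l))\<^sup>2)
      + Z\<^sup>2 * (\<Sum>l\<in>I. g l * (cmod (y l))\<^sup>2) - Z * \<eta> * (\<Sum>l\<in>I. (g l)\<^sup>2 / w l * (cmod (y l))\<^sup>2)"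
    unfolding sum_distrib_left sum.distrib[symmetric] sum_subtractf[symmetric]
    by (rule sum_mono[OF point])
  ultimately have "(\<Sum>l\<in>I. r l * (cmod (X l))\<^sup>2) \<le> 0" by simp
  hence "b * (\<Sum>l\<in>I. ((x l - \<mu>) - \<sigma>\<^sup>2 * \<psi> * (b - x l)) * (cmod (X l))\<^sup>2) \<le> 0"
    by (simp add: r_def sum_distrib_left mult.assoc)
  moreover have "0 < A" unfolding A_def using s0 sD by (simp add: add_pos_nonneg)
  ultimately show ?thesis using b0 unfolding X_def by (auto simp: mult_le_0_iff)
qed

section \<open>Diagonalization of Hermitian pairs\<close>

lemma mat_adjoint_carrier [simp]: "A \<in> carrier_mat n k \<Longrightarrow> mat_adjoint A \<in> carrier_mat k n"
  unfolding mat_adjoint_def by (metis carrier_matD cols_length length_map mat_of_rows_carrier(1))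

lemma mat_adjoint_index [simp]:
  fixes A :: "complex mat"
  shows "i < dim_col A \<Longrightarrow> j < dim_row A \<Longrightarrow> mat_adjoint A $$ (i, j) = cnj (A $$ (j, i))"
  unfolding mat_adjoint_def by (simp add: mat_of_rows_def)

lemma mat_adjoint_dim [simp]: "dim_row (mat_adjoint A) = dim_col A" "dim_col (mat_adjoint A) = dim_row A"
  unfolding mat_adjoint_def by auto

lemma mat_adjoint_adjoint [simp]: "mat_adjoint (mat_adjoint A) = (A :: complex mat)"
  by (intro eq_matI) auto

lemma mat_adjoint_mult:
  fixes A B :: "complex mat"
  assumes "A \<in> carrier_mat n k" "B \<in> carrier_mat k m"
  shows "mat_adjoint (A * B) = mat_adjoint B * mat_adjoint A"
  using assms by (intro eq_matI) (auto simp: scalar_prod_def mult.commute intro!: sum.cong)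

lemma inner_mat_adjoint:
  fixes A :: "complex mat"
  assumes "A \<in> carrier_mat n k" "x \<in> carrier_vec k" "y \<in> carrier_vec n"
  shows "conjugate x \<bullet> (mat_adjoint A *\<^sub>v y) = conjugate (A *\<^sub>v x) \<bullet> y"
proof -
  have "conjugate x \<bullet> (mat_adjoint A *\<^sub>v y) = (\<Sum>i<k. \<Sum>j<n. cnj (x $ i) * (cnj (A $$ (j, i)) * y $ j))"
    using assms by (simp add: scalar_prod_def sum_distrib_left atLeast0LessThan)
  also have "\<dots> = (\<Sum>j<n. \<Sum>i<k. cnj (x $ i) * (cnj (A $$ (j, i)) * y $ j))" by (rule sum.swap)
  also have "\<dots> = conjugate (A *\<^sub>v x) \<bullet> y"
    using assms by (simp add: scalar_prod_def sum_distrib_left sum_distrib_right atLeast0LessThan mult_ac)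
  finally show ?thesis .
qed

lemma inner_congruence:
  fixes M W :: "complex mat"
  assumes "M \<in> carrier_mat n n" "W \<in> carrier_mat n k" "x \<in> carrier_vec k" "y \<in> carrier_vec k"
  shows "conjugate x \<bullet> ((mat_adjoint W * M * W) *\<^sub>v y) = conjugate (W *\<^sub>v x) \<bullet> (M *\<^sub>v (W *\<^sub>v y))"
proof -
  have "(mat_adjoint W * M * W) *\<^sub>v y = mat_adjoint W *\<^sub>v (M *\<^sub>v (W *\<^sub>v y))"
    using assms by (simp add: assoc_mult_mat_vec[of _ k n _ k] assoc_mult_mat_vec[of _ n n _ k]
        assoc_mult_mat[of _ k n])
  thus ?thesis using assms by (simp add: inner_mat_adjoint[of W n k])
qed

lemma congruence_index:
  fixes M W :: "complex mat"
  assumes "M \<in> carrier_mat n n" "W \<in> carrier_mat n k" "i < k" "j < k"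
  shows "(mat_adjoint W * M * W) $$ (i, j) = conjugate (col W i) \<bullet> (M *\<^sub>v col W j)"
proof -
  have "(mat_adjoint W * M * W) = mat_adjoint W * (M * W)"
    using assms by (simp add: assoc_mult_mat[of _ k n])
  moreover have "row (mat_adjoint W) i = conjugate (col W i)"
    using assms by (intro eq_vecI) auto
  moreover have "col (M * W) j = M *\<^sub>v col W j" using assms by (intro eq_vecI) auto
  ultimately show ?thesis using assms by simp
qed

lemma hermitian_congruence:
  assumes "hermitian_mat n M" "W \<in> carrier_mat n k"
  shows "hermitian_mat k (mat_adjoint W * M * W)"
  using assms unfolding hermitian_mat_def
  by (auto simp: mat_adjoint_mult[of _ k n _ k] mat_adjoint_mult[of _ n n _ k] assoc_mult_mat[of _ k n])

lemma inner_hermitian: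
  assumes "hermitian_mat n M" "x \<in> carrier_vec n" "y \<in> carrier_vec n"
  shows "conjugate x \<bullet> (M *\<^sub>v y) = cnj (conjugate y \<bullet> (M *\<^sub>v x))"
proof -
  have M: "M \<in> carrier_mat n n" "mat_adjoint M = M" using assms by (auto simp: hermitian_mat_def)
  have "conjugate x \<bullet> (M *\<^sub>v y) = conjugate (M *\<^sub>v x) \<bullet> y"
    using inner_mat_adjoint[OF M(1) assms(2,3)] M(2) by simp
  also have "\<dots> = y \<bullet>c (M *\<^sub>v x)"
    using assms M(1) by (intro conjugate_vec_sprod_comm[symmetric]) auto
  also have "\<dots> = conjugate (conjugate y \<bullet> (M *\<^sub>v x))"
    using assms M(1) by (intro conjugate_conjugate_sprod[symmetric]) auto
  finally show ?thesis by simp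
qed

lemma inner_hermitian_real:
  assumes "hermitian_mat n M" "x \<in> carrier_vec n"
  shows "conjugate x \<bullet> (M *\<^sub>v x) = of_real (Re (conjugate x \<bullet> (M *\<^sub>v x)))"
proof -
  have "Im (conjugate x \<bullet> (M *\<^sub>v x)) = 0"
    using arg_cong[OF inner_hermitian[OF assms(1,2,2)], of Im] by simp
  thus ?thesis by (simp add: complex_eq_iff)
qed

lemma pos_def_inner_pos:
  assumes "pos_def_mat n M" "x \<in> carrier_vec n" "x \<noteq> 0\<^sub>v n"
  shows "0 < Re (conjugate x \<bullet> (M *\<^sub>v x))"
  using assms by (auto simp: pos_def_mat_def)

lemma pos_def_congruence:
  fixes W :: "complex mat"
  assumes M: "pos_def_mat n M" and W: "W \<in> carrier_mat n k"
    and inj: "\<And>x. x \<in> carrier_vec k \<Longrightarrow> W *\<^sub>v x = 0\<^sub>v n \<Longrightarrow> x = 0\<^sub>v k"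
  shows "pos_def_mat k (mat_adjoint W * M * W)"
proof -
  have H: "hermitian_mat n M" and Mc: "M \<in> carrier_mat n n"
    using M by (auto simp: pos_def_mat_def hermitian_mat_def)
  show ?thesis
    unfolding pos_def_mat_def
  proof (intro conjI ballI impI hermitian_congruence[OF H W])
    fix x :: "complex vec"
    assume x: "x \<in> carrier_vec k" "x \<noteq> 0\<^sub>v k"
    show "0 < Re (conjugate x \<bullet> ((mat_adjoint W * M * W) *\<^sub>v x))"
      unfolding inner_congruence[OF Mc W x(1) x(1)]
      using M W x inj by (intro pos_def_inner_pos[of n]) auto
  qed
qed

lemma pos_def_det_nonzero:
  assumes "pos_def_mat n M"
  shows "det M \<noteq> 0"
proof
  have M: "M \<in> carrier_mat n n" using assms by (auto simp: pos_def_mat_def hermitian_mat_def)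
  assume "det M = 0"
  then obtain x where x: "x \<in> carrier_vec n" "x \<noteq> 0\<^sub>v n" "M *\<^sub>v x = 0\<^sub>v n"
    using det_0_iff_vec_prod_zero[OF M] by auto
  with pos_def_inner_pos[OF assms x(1,2)] show False by simp
qed

text \<open>The inverse of \<open>B\<close> times \<open>A\<close> has some complex eigenvalue. It
  is real because, for its eigenvector, it is the quotient of the values of two Hermitian forms, the
  denominator being positive; that denominator also allows the normalization.\<close>

lemma pair_eigenvector_exists:
  assumes A: "hermitian_mat (Suc n) A" and B: "pos_def_mat (Suc n) B"
  shows "\<exists>v t. v \<in> carrier_vec (Suc n) \<and> A *\<^sub>v v = complex_of_real t \<cdot>\<^sub>v (B *\<^sub>v v) \<and>
    conjugate v \<bullet> (B *\<^sub>v v) = 1"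
proof -
  let ?n = "Suc n"
  have Ac: "A \<in> carrier_mat ?n ?n" and Bc: "B \<in> carrier_mat ?n ?n" and Bh: "hermitian_mat ?n B"
    using A B by (auto simp: pos_def_mat_def hermitian_mat_def)
  obtain C where C: "C \<in> carrier_mat ?n ?n" "B * C = 1\<^sub>m ?n"
    using det_non_zero_imp_unit[OF Bc pos_def_det_nonzero[OF B]]
    by (auto simp: Units_def ring_mat_def)
  have "spectrum (C * A) \<noteq> {}" using C Ac by (intro spectrum_non_empty[of _ ?n]) auto
  then obtain e where "eigenvalue (C * A) e" by (auto simp: spectrum_def)
  then obtain v where v: "v \<in> carrier_vec ?n" "v \<noteq> 0\<^sub>v ?n" "(C * A) *\<^sub>v v = e \<cdot>\<^sub>v v"
    using C Ac by (auto simp: eigenvalue_def eigenvector_def)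
  have "A *\<^sub>v v = (B * C) *\<^sub>v (A *\<^sub>v v)" using C Ac v by simp
  also have "\<dots> = B *\<^sub>v (C *\<^sub>v (A *\<^sub>v v))"
    by (rule assoc_mult_mat_vec[OF Bc C(1)]) (use Ac v in simp)
  also have "C *\<^sub>v (A *\<^sub>v v) = e \<cdot>\<^sub>v v"
    using assoc_mult_mat_vec[OF C(1) Ac v(1)] v(3) by simp
  finally have ev: "A *\<^sub>v v = e \<cdot>\<^sub>v (B *\<^sub>v v)"
    using mult_mat_vec[OF Bc v(1)] by simp
  define \<beta> where "\<beta> = Re (conjugate v \<bullet> (B *\<^sub>v v))"
  have \<beta>: "0 < \<beta>" unfolding \<beta>_def by (rule pos_def_inner_pos[OF B v(1,2)])
  have b: "conjugate v \<bullet> (B *\<^sub>v v) = of_real \<beta>"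
    unfolding \<beta>_def by (rule inner_hermitian_real[OF Bh v(1)])
  have "e * of_real \<beta> = conjugate v \<bullet> (A *\<^sub>v v)" unfolding ev using v Bc b by simp
  also have "\<dots> = of_real (Re (conjugate v \<bullet> (A *\<^sub>v v)))" by (rule inner_hermitian_real[OF A v(1)])
  finally have e: "e = of_real (Re (conjugate v \<bullet> (A *\<^sub>v v)) / \<beta>)" using \<beta> by (simp add: field_simps)
  define s where "s = complex_of_real (1 / sqrt \<beta>)"
  have s: "cnj s * s * of_real \<beta> = 1"
    unfolding s_def using \<beta> by (simp flip: of_real_mult)
  have "A *\<^sub>v (s \<cdot>\<^sub>v v) = e \<cdot>\<^sub>v (B *\<^sub>v (s \<cdot>\<^sub>v v))"
    using v Ac Bc by (simp add: mult_mat_vec[of _ ?n ?n] ev smult_smult_assoc mult.commute)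
  moreover have "conjugate (s \<cdot>\<^sub>v v) \<bullet> (B *\<^sub>v (s \<cdot>\<^sub>v v)) = 1"
    using v Bc b s by (simp add: mult_mat_vec[of _ ?n ?n] conjugate_smult_vec mult_ac)
  moreover have "s \<cdot>\<^sub>v v \<in> carrier_vec ?n" using v by simp
  ultimately show ?thesis using e by metis
qed

text \<open>An explicit basis of the orthogonal complement of \<open>w\<close>, obtained from a
  pivot \<open>m\<close> with \<open>w $ m \<noteq> 0\<close>. The map \<open>sk\<close> enumerates
  the indices other than \<open>m\<close>, and column \<open>k\<close> is the unit vector at
  \<open>sk k\<close>, corrected in row \<open>m\<close> to be orthogonal to \<open>w\<close>.
  Reading off the rows \<open>sk k\<close> shows injectivity.\<close>

lemma annihilator_basis:
  assumes w: "w \<in> carrier_vec (Suc n)" "w \<noteq> (0\<^sub>v (Suc n) :: complex vec)"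
  shows "\<exists>R \<in> carrier_mat (Suc n) n. mat_adjoint R *\<^sub>v w = 0\<^sub>v n \<and>
    (\<forall>x\<in>carrier_vec n. R *\<^sub>v x = 0\<^sub>v (Suc n) \<longrightarrow> x = 0\<^sub>v n)"
proof -
  obtain m where m: "m < Suc n" "w $ m \<noteq> 0"
    using w by (metis carrier_vecD eq_vecI index_zero_vec)
  define sk where "sk k = (if k < m then k else Suc k)" for k
  have sk: "sk k \<noteq> m" "k < n \<Longrightarrow> sk k < Suc n" "sk k = sk l \<longleftrightarrow> k = l" for k l
    using m by (auto simp: sk_def)
  define R where "R = mat (Suc n) n (\<lambda>(r, k). if r = sk k then 1 else if r = m
     then - cnj (w $ sk k) / cnj (w $ m) else 0)"
  have R: "R \<in> carrier_mat (Suc n) n" by (simp add: R_def)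
  have Rx: "(R *\<^sub>v x) $ sk k = x $ k" if x: "x \<in> carrier_vec n" and k: "k < n" for x k
  proof -
    have "(R *\<^sub>v x) $ sk k = (\<Sum>l<n. R $$ (sk k, l) * x $ l)"
      using x k sk(2)[OF k] R by (simp add: scalar_prod_def atLeast0LessThan)
    also have "\<dots> = (\<Sum>l<n. if l = k then x $ l else 0)"
      using sk k by (intro sum.cong) (auto simp: R_def)
    finally show ?thesis using k by simp
  qed
  have "mat_adjoint R *\<^sub>v w = 0\<^sub>v n"
  proof (rule eq_vecI)
    fix k assume "k < dim_vec (0\<^sub>v n :: complex vec)"
    hence k: "k < n" by simp
    have "(mat_adjoint R *\<^sub>v w) $ k = (\<Sum>r<Suc n. cnj (R $$ (r, k)) * w $ r)"
      using w k R by (simp add: scalar_prod_def atLeast0LessThan)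
    also have "\<dots> = (\<Sum>r\<in>{sk k, m}. cnj (R $$ (r, k)) * w $ r)"
      using k m sk(2)[OF k] by (intro sum.mono_neutral_right) (auto simp: R_def)
    also have "\<dots> = w $ sk k - w $ sk k / w $ m * w $ m"
      using k m sk sk(1)[THEN not_sym] by (simp add: R_def)
    finally show "(mat_adjoint R *\<^sub>v w) $ k = 0\<^sub>v n $ k" using m k by simp
  qed (use R in auto)
  moreover have "x = 0\<^sub>v n" if x: "x \<in> carrier_vec n" "R *\<^sub>v x = 0\<^sub>v (Suc n)" for x
  proof (rule eq_vecI)
    fix k assume "k < dim_vec (0\<^sub>v n :: complex vec)"
    hence k: "k < n" by simp
    show "x $ k = 0\<^sub>v n $ k" using Rx[OF x(1) k] x(2) sk(2)[OF k] k by simp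
  qed (use x in auto)
  ultimately show ?thesis using R by blast
qed

text \<open>Induction by deflation. For an eigenvector \<open>v\<close> the columns of
  \<open>R\<close> are orthogonal to \<open>B *\<^sub>v v\<close>, hence also to
  \<open>A *\<^sub>v v\<close>, which is a multiple of it. Both forms therefore split between
  \<open>v\<close> and the range of \<open>R\<close>, and the induction hypothesis applies to the
  pair compressed by \<open>R\<close>.\<close>

lemma pair_eigenbasis:
  assumes "hermitian_mat n A" "pos_def_mat n B"
  shows "\<exists>v \<tau>. (\<forall>k<n. v k \<in> carrier_vec n) \<and> (\<forall>k<n. \<forall>l<n.
      conjugate (v k) \<bullet> (B *\<^sub>v v l) = (if k = l then 1 else 0) \<and>
      conjugate (v k) \<bullet> (A *\<^sub>v v l) = (if k = l then complex_of_real (\<tau> k) else 0))"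
  using assms
proof (induction n arbitrary: A B)
  case 0
  show ?case by simp
next
  case (Suc n)
  let ?n = "Suc n"
  have Ac: "A \<in> carrier_mat ?n ?n" and Bc: "B \<in> carrier_mat ?n ?n" and Bh: "hermitian_mat ?n B"
    using Suc.prems by (auto simp: pos_def_mat_def hermitian_mat_def)
  obtain v t where v: "v \<in> carrier_vec ?n" "A *\<^sub>v v = complex_of_real t \<cdot>\<^sub>v (B *\<^sub>v v)"
    "conjugate v \<bullet> (B *\<^sub>v v) = 1"
    using pair_eigenvector_exists[OF Suc.prems] by blast
  have "B *\<^sub>v v \<noteq> 0\<^sub>v ?n" using v by auto
  then obtain R where R: "R \<in> carrier_mat ?n n" "mat_adjoint R *\<^sub>v (B *\<^sub>v v) = 0\<^sub>v n"
    and inj: "\<And>x. x \<in> carrier_vec n \<Longrightarrow> R *\<^sub>v x = 0\<^sub>v ?n \<Longrightarrow> x = 0\<^sub>v n"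
    using annihilator_basis[of "B *\<^sub>v v" n] v Bc by auto
  have B0: "conjugate (R *\<^sub>v x) \<bullet> (B *\<^sub>v v) = 0" if "x \<in> carrier_vec n" for x
    using inner_mat_adjoint[OF R(1) that, of "B *\<^sub>v v"] R(2) that v Bc by simp
  have A0: "conjugate (R *\<^sub>v x) \<bullet> (A *\<^sub>v v) = 0" if "x \<in> carrier_vec n" for x
    unfolding v(2) using B0[OF that] that R v Bc by simp
  have B0': "conjugate v \<bullet> (B *\<^sub>v (R *\<^sub>v x)) = 0" and A0': "conjugate v \<bullet> (A *\<^sub>v (R *\<^sub>v x)) = 0"
    if "x \<in> carrier_vec n" for x
    using inner_hermitian[OF Bh v(1), of "R *\<^sub>v x"] inner_hermitian[OF Suc.prems(1) v(1), of "R *\<^sub>v x"]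
      A0[OF that] B0[OF that] R that by auto
  have Av: "conjugate v \<bullet> (A *\<^sub>v v) = of_real t" unfolding v(2) using v Bc by simp
  from Suc.IH[OF hermitian_congruence[OF Suc.prems(1) R(1)] pos_def_congruence[OF Suc.prems(2) R(1) inj]]
  obtain x \<tau> where x: "\<forall>k<n. x k \<in> carrier_vec n"
    and "\<forall>k<n. \<forall>l<n. conjugate (x k) \<bullet> ((mat_adjoint R * B * R) *\<^sub>v x l) = (if k = l then 1 else 0) \<and>
      conjugate (x k) \<bullet> ((mat_adjoint R * A * R) *\<^sub>v x l) = (if k = l then complex_of_real (\<tau> k) else 0)"
    by blast
  hence xAB: "\<forall>k<n. \<forall>l<n. conjugate (R *\<^sub>v x k) \<bullet> (B *\<^sub>v (R *\<^sub>v x l)) = (if k = l then 1 else 0) \<and>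
      conjugate (R *\<^sub>v x k) \<bullet> (A *\<^sub>v (R *\<^sub>v x l)) = (if k = l then complex_of_real (\<tau> k) else 0)"
    using inner_congruence[OF Bc R(1)] inner_congruence[OF Ac R(1)] by simp
  define y where "y k = (if k < n then R *\<^sub>v x k else v)" for k
  define \<tau>' where "\<tau>' k = (if k < n then \<tau> k else t)" for k
  have "y k \<in> carrier_vec ?n" if "k < ?n" for k
    using that x R(1) v(1) by (auto simp: y_def)
  moreover have "conjugate (y k) \<bullet> (B *\<^sub>v y l) = (if k = l then 1 else 0) \<and>
      conjugate (y k) \<bullet> (A *\<^sub>v y l) = (if k = l then complex_of_real (\<tau>' k) else 0)"
    if "k < ?n" "l < ?n" for k l
  proof (cases "k < n"; cases "l < n")
    assume "k < n" "l < n"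
    thus ?thesis using xAB by (simp add: y_def \<tau>'_def)
  next
    assume "k < n" "\<not> l < n"
    thus ?thesis using x A0 B0 by (simp add: y_def)
  next
    assume "\<not> k < n" "l < n"
    thus ?thesis using x A0' B0' by (simp add: y_def)
  next
    assume "\<not> k < n" "\<not> l < n"
    moreover from this that have "k = l" by simp
    ultimately show ?thesis using v(3) Av by (simp add: y_def \<tau>'_def)
  qed
  ultimately show ?case by blast
qed

lemma pair_diagonalization:
  assumes A: "hermitian_mat n A" and B: "pos_def_mat n B"
  obtains G \<tau> where "G \<in> carrier_mat n n" "mat_adjoint G * B * G = 1\<^sub>m n"
    "mat_adjoint G * A * G = mat_diag n (\<lambda>k. complex_of_real (\<tau> k))"
proof -
  have Ac: "A \<in> carrier_mat n n" and Bc: "B \<in> carrier_mat n n"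
    using assms by (auto simp: pos_def_mat_def hermitian_mat_def)
  from pair_eigenbasis[OF A B] obtain v \<tau> where v: "\<forall>k<n. v k \<in> carrier_vec n"
    and vAB: "\<forall>k<n. \<forall>l<n. conjugate (v k) \<bullet> (B *\<^sub>v v l) = (if k = l then 1 else 0) \<and>
      conjugate (v k) \<bullet> (A *\<^sub>v v l) = (if k = l then complex_of_real (\<tau> k) else 0)" by blast
  define G where "G = mat_of_cols n (map v [0..<n])"
  have G: "G \<in> carrier_mat n n" using mat_of_cols_carrier(1)[of n "map v [0..<n]"] by (simp add: G_def)
  have col: "col G k = v k" if "k < n" for k
    unfolding G_def using that v by (subst col_mat_of_cols) auto
  show ?thesis
  proof (rule that[OF G])
    show "mat_adjoint G * B * G = 1\<^sub>m n"
      using G by (intro eq_matI) (auto simp: congruence_index[OF Bc G] col vAB simp del: index_mult_mat(1))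
    show "mat_adjoint G * A * G = mat_diag n (\<lambda>k. complex_of_real (\<tau> k))"
      using G by (intro eq_matI) (auto simp: congruence_index[OF Ac G] col vAB mat_diag_def simp del: index_mult_mat(1))
  qed
qed

text \<open>Links a diagonalization to the polynomial in \<open>pair_eigenvalues\<close>. The
  constant matrix \<open>G\<close>, embedded in the polynomial matrices, carries the pencil xB - A
  to the diagonal matrix with entries x - \<open>\<tau> k\<close>. The determinants of
  \<open>G\<close> and its adjoint are eliminated by taking determinants in
  \<open>GB\<close>.\<close>

lemma det_pencil_of_diagonalization:
  fixes A B G :: "complex mat"
  assumes A: "A \<in> carrier_mat n n" and B: "B \<in> carrier_mat n n" and G: "G \<in> carrier_mat n n"
    and GB: "mat_adjoint G * B * G = 1\<^sub>m n"
    and GA: "mat_adjoint G * A * G = mat_diag n (\<lambda>k. complex_of_real (\<tau> k))"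
  shows "det (map_mat (\<lambda>b. [:0, b:]) B - map_mat (\<lambda>a. [:a:]) A)
       = smult (det B) (\<Prod>t\<leftarrow>map \<tau> [0..<n]. [:- complex_of_real t, 1:])"
proof -
  interpret hom: comm_ring_hom "\<lambda>a::complex. [:a:]" by unfold_locales auto
  let ?P = "map_mat (\<lambda>a::complex. [:a:])"
  let ?X = "[:0, 1::complex:]"
  let ?G' = "mat_adjoint G"
  have G': "?G' \<in> carrier_mat n n" using G by simp
  have X: "map_mat (\<lambda>b. [:0, b:]) B = ?X \<cdot>\<^sub>m ?P B" by (intro eq_matI) auto
  define L where "L = ?X \<cdot>\<^sub>m ?P B - ?P A"
  have L: "L \<in> carrier_mat n n" unfolding L_def
    by (intro carrier_matI) (simp_all add: carrier_matD[OF A] carrier_matD[OF B])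
  have PM: "?P M \<in> carrier_mat n n" if "M \<in> carrier_mat n n" for M using that by simp
  have "?P ?G' * L * ?P G = ?X \<cdot>\<^sub>m ?P (?G' * B * G) - ?P (?G' * A * G)"
  proof -
    have "?P ?G' * L = ?P ?G' * (?X \<cdot>\<^sub>m ?P B) - ?P ?G' * ?P A"
      unfolding L_def by (rule mult_minus_distrib_mat[of _ n n _ n]) (simp_all add: PM G' A B smult_carrier_mat del: map_carrier_mat)
    also have "?P ?G' * (?X \<cdot>\<^sub>m ?P B) = ?X \<cdot>\<^sub>m (?P ?G' * ?P B)"
      by (rule mult_smult_distrib[OF PM[OF G'] PM[OF B]])
    finally have "?P ?G' * L * ?P G = (?X \<cdot>\<^sub>m (?P ?G' * ?P B) - ?P ?G' * ?P A) * ?P G" by simp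
    also have "\<dots> = (?X \<cdot>\<^sub>m (?P ?G' * ?P B)) * ?P G - ?P ?G' * ?P A * ?P G"
      by (rule minus_mult_distrib_mat[OF smult_carrier_mat[OF mult_carrier_mat[OF PM[OF G'] PM[OF B]]]
            mult_carrier_mat[OF PM[OF G'] PM[OF A]] PM[OF G]])
    also have "(?X \<cdot>\<^sub>m (?P ?G' * ?P B)) * ?P G = ?X \<cdot>\<^sub>m (?P ?G' * ?P B * ?P G)"
      by (rule mult_smult_assoc_mat[OF mult_carrier_mat[OF PM[OF G'] PM[OF B]] PM[OF G]])
    finally show ?thesis
      by (simp only: hom.mat_hom_mult[OF G' A] hom.mat_hom_mult[OF G' B]
          hom.mat_hom_mult[OF mult_carrier_mat[OF G' A] G] hom.mat_hom_mult[OF mult_carrier_mat[OF G' B] G])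
  qed
  also have "\<dots> = mat_diag n (\<lambda>k. [:- complex_of_real (\<tau> k), 1:])"
    unfolding GA GB by (intro eq_matI) (auto simp: mat_diag_def one_mat_def)
  finally have E: "?P ?G' * L * ?P G = mat_diag n (\<lambda>k. [:- complex_of_real (\<tau> k), 1:])" .
  have "det (mat_diag n (\<lambda>k. [:- complex_of_real (\<tau> k), 1:])) = (\<Prod>t\<leftarrow>map \<tau> [0..<n]. [:- complex_of_real t, 1:])"
  proof -
    have "upper_triangular (mat_diag n (\<lambda>k. [:- complex_of_real (\<tau> k), 1:]))"
      by (auto simp: mat_diag_def upper_triangular_def)
    moreover have "diag_mat (mat_diag n (\<lambda>k. [:- complex_of_real (\<tau> k), 1:])) = map (\<lambda>k. [:- complex_of_real (\<tau> k), 1:]) [0..<n]"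
      by (auto simp: mat_diag_def diag_mat_def)
    ultimately show ?thesis by (simp add: det_upper_triangular[OF _ mat_diag_dim] o_def)
  qed
  moreover have "det (?P ?G' * L * ?P G) = [:det ?G':] * det L * [:det G:]"
    by (simp only: det_mult[OF mult_carrier_mat[OF PM[OF G'] L] PM[OF G]] det_mult[OF PM[OF G'] L] hom.hom_det)
  moreover have GBG: "det ?G' * det B * det G = 1"
    using arg_cong[OF GB, of det]
    by (simp only: det_mult[OF mult_carrier_mat[OF G' B] G] det_mult[OF G' B] det_one)
  ultimately have "smult (det B) (\<Prod>t\<leftarrow>map \<tau> [0..<n]. [:- complex_of_real t, 1:])
      = smult (det B) ([:det ?G':] * det L * [:det G:])" unfolding E by simp
  also have "\<dots> = smult (det ?G' * det B * det G) (det L)" by (simp add: mult_ac)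
  finally show ?thesis unfolding GBG X L_def by simp
qed

section \<open>Min-max principle and quality of the preconditioner\<close>

lemma mat_diag_mult_vec:
  fixes f :: "nat \<Rightarrow> complex"
  assumes "d \<in> carrier_vec m"
  shows "mat_diag m f *\<^sub>v d = vec m (\<lambda>k. f k * d $ k)"
proof (rule eq_vecI)
  fix q assume "q < dim_vec (vec m (\<lambda>k. f k * d $ k))"
  hence q: "q < m" by simp
  have "(mat_diag m f *\<^sub>v d) $ q = (\<Sum>r<m. (if q = r then f r else 0) * d $ r)"
    using q assms by (simp add: mat_diag_def scalar_prod_def atLeast0LessThan)
  also have "\<dots> = (\<Sum>r<m. if q = r then f r * d $ r else 0)" by (intro sum.cong) auto
  finally show "(mat_diag m f *\<^sub>v d) $ q = vec m (\<lambda>k. f k * d $ k) $ q" using q by simp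
qed (simp add: mat_diag_def)

lemma inner_mat_diag:
  assumes "e \<in> carrier_vec m"
  shows "conjugate e \<bullet> (mat_diag m (\<lambda>k. complex_of_real (f k)) *\<^sub>v e) = of_real (\<Sum>k<m. f k * (cmod (e $ k))\<^sup>2)"
  unfolding mat_diag_mult_vec[OF assms] using assms
  by (auto simp: scalar_prod_def atLeast0LessThan complex_norm_square mult_ac simp del: of_real_power intro!: sum.cong)

lemma inner_self:
  assumes "e \<in> carrier_vec m"
  shows "conjugate e \<bullet> e = of_real (\<Sum>k<m. (cmod (e $ k))\<^sup>2)"
  using inner_mat_diag[OF assms, of "\<lambda>_. 1"] assms by simp

lemma hermitian_mat_diag: "hermitian_mat m (mat_diag m (\<lambda>k. complex_of_real (f k)))"
  unfolding hermitian_mat_def by (auto intro!: eq_matI simp: mat_diag_def)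

lemma pos_def_mat_diag:
  assumes "\<And>k. k < m \<Longrightarrow> 0 < f k"
  shows "pos_def_mat m (mat_diag m (\<lambda>k. complex_of_real (f k)))"
  unfolding pos_def_mat_def
proof (intro conjI hermitian_mat_diag ballI impI)
  fix d :: "complex vec"
  assume d: "d \<in> carrier_vec m" "d \<noteq> 0\<^sub>v m"
  then obtain k where k: "k < m" "d $ k \<noteq> 0" by (metis carrier_vecD eq_vecI index_zero_vec)
  have "0 < (\<Sum>k<m. f k * (cmod (d $ k))\<^sup>2)"
    using k assms by (intro sum_pos2[of _ k]) (auto simp: less_imp_le)
  thus "0 < Re (conjugate d \<bullet> (mat_diag m (\<lambda>k. complex_of_real (f k)) *\<^sub>v d))"
    unfolding inner_mat_diag[OF d(1)] by simp
qed

lemma real_eigenvalues_mat_diag: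
  "{a. eigenvalue (mat_diag m (\<lambda>k. complex_of_real (f k))) (complex_of_real a)} = f ` {..<m}"
proof -
  let ?T = "mat_diag m (\<lambda>k. complex_of_real (f k))"
  have "upper_triangular ?T" by (auto simp: mat_diag_def upper_triangular_def)
  moreover have "diag_mat ?T = map (\<lambda>k. complex_of_real (f k)) [0..<m]"
    by (auto simp: mat_diag_def diag_mat_def)
  ultimately have "char_poly ?T = (\<Prod>a\<leftarrow>map (\<lambda>k. complex_of_real (f k)) [0..<m]. [:- a, 1:])"
    using char_poly_upper_triangular[OF mat_diag_dim] by metis
  thus ?thesis
    unfolding eigenvalue_root_char_poly[OF mat_diag_dim] by (auto simp: poly_prod_list prod_list_zero_iff)
qed

text \<open>Identifies the prescribed eigenvalue list with the diagonal found by
  \<open>pair_diagonalization\<close>, up to order. Each root of one product occurs in the other,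
  and one common factor is cancelled at a time.\<close>

lemma prod_linear_factors_mset_eq:
  fixes as bs :: "complex list"
  assumes "(\<Prod>a\<leftarrow>as. [:- a, 1:]) = (\<Prod>b\<leftarrow>bs. [:- b, 1:])"
  shows "mset as = mset bs"
  using assms
proof (induction as arbitrary: bs)
  case Nil
  have "degree (\<Prod>b\<leftarrow>bs. [:- b, 1:]) = length bs" by (rule degree_linear_factors)
  with Nil show ?case by simp
next
  case (Cons a as)
  have "poly (\<Prod>b\<leftarrow>bs. [:- b, 1:]) a = 0" unfolding Cons.prems[symmetric] by simp
  hence a: "a \<in> set bs" by (auto simp: poly_prod_list prod_list_zero_iff)
  hence perm: "mset (a # remove1 a bs) = mset bs" by simp
  have "(\<Prod>b\<leftarrow>bs. [:- b, 1:]) = (\<Prod>b\<leftarrow>a # remove1 a bs. [:- b, 1:])"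
    using arg_cong[OF perm, of "\<lambda>m. \<Prod>b\<in>#m. [:- b, 1:]"] by (simp only: mset_map prod_mset_prod_list flip: mset_map)
  hence "[:- a, 1:] * (\<Prod>a\<leftarrow>as. [:- a, 1:]) = [:- a, 1:] * (\<Prod>b\<leftarrow>remove1 a bs. [:- b, 1:])"
    using Cons.prems by simp
  hence "(\<Prod>a\<leftarrow>as. [:- a, 1:]) = (\<Prod>b\<leftarrow>remove1 a bs. [:- b, 1:])"
    by (subst (asm) mult_cancel_left) simp
  from Cons.IH[OF this] perm show ?case by simp
qed

text \<open>Padding with zero rows gives a singular square matrix. The min-max argument uses this
  dimension count twice: to bound the size of a test space, and to find a test vector with
  prescribed vanishing coordinates.\<close>

lemma wide_kernel:
  fixes E :: "complex mat"
  assumes E: "E \<in> carrier_mat m p" and mp: "m < p"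
  shows "\<exists>c\<in>carrier_vec p. c \<noteq> 0\<^sub>v p \<and> E *\<^sub>v c = 0\<^sub>v m"
proof -
  define F where "F = mat p p (\<lambda>(i, j). if i < m then E $$ (i, j) else 0)"
  have F: "F \<in> carrier_mat p p" by (simp add: F_def)
  have "F = mat\<^sub>r p p (\<lambda>i. if i = m then 0\<^sub>v p else row F i)"
    using mp E by (intro eq_matI) (auto simp: F_def)
  hence "det F = 0" using det_row_0[OF mp, of "\<lambda>i. row F i"] F by auto
  then obtain c where c: "c \<in> carrier_vec p" "c \<noteq> 0\<^sub>v p" "F *\<^sub>v c = 0\<^sub>v p"
    using det_0_iff_vec_prod_zero[OF F] by auto
  have "E *\<^sub>v c = 0\<^sub>v m"
  proof (rule eq_vecI)
    fix i assume "i < dim_vec (0\<^sub>v m :: complex vec)"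
    hence i: "i < m" by simp
    have "(E *\<^sub>v c) $ i = (F *\<^sub>v c) $ i"
      unfolding F_def using i mp E c(1) by (auto simp: scalar_prod_def intro!: sum.cong)
    thus "(E *\<^sub>v c) $ i = 0\<^sub>v m $ i" using c i mp by simp
  qed (use E in auto)
  with c show ?thesis by blast
qed

lemma sorted_count_le:
  fixes ts :: "real list"
  assumes "sorted ts" "i0 < length ts" "\<theta> < ts ! i0"
  shows "length (filter (\<lambda>t. t \<le> \<theta>) ts) \<le> i0"
proof -
  have "filter (\<lambda>t. t \<le> \<theta>) (drop i0 ts) = []"
  proof -
    have "\<theta> < t" if "t \<in> set (drop i0 ts)" for t
    proof -
      from that obtain q where "q < length (drop i0 ts)" "t = drop i0 ts ! q" by (auto simp: in_set_conv_nth)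
      hence "ts ! i0 \<le> t" using assms by (auto intro!: sorted_nth_mono)
      with assms show ?thesis by simp
    qed
    thus ?thesis by (auto simp: filter_empty_conv not_le)
  qed
  hence "filter (\<lambda>t. t \<le> \<theta>) ts = filter (\<lambda>t. t \<le> \<theta>) (take i0 ts)"
    by (metis append_Nil2 append_take_drop_id filter_append)
  hence "length (filter (\<lambda>t. t \<le> \<theta>) ts) \<le> length (take i0 ts)"
    using length_filter_le[of "\<lambda>t. t \<le> \<theta>" "take i0 ts"] by metis
  thus ?thesis using assms by simp
qed

lemma pair_minmax:
  assumes A: "hermitian_mat k A" and B: "pos_def_mat k B" and ts: "pair_eigenvalues A B ts"
    and C: "C \<in> carrier_mat k (Suc i0)"
    and inj: "\<And>c. c \<in> carrier_vec (Suc i0) \<Longrightarrow> C *\<^sub>v c = 0\<^sub>v k \<Longrightarrow> c = 0\<^sub>v (Suc i0)"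
    and form: "\<And>c. c \<in> carrier_vec (Suc i0) \<Longrightarrow> Re (conjugate (C *\<^sub>v c) \<bullet> (A *\<^sub>v (C *\<^sub>v c)))
        \<le> \<theta> * Re (conjugate (C *\<^sub>v c) \<bullet> (B *\<^sub>v (C *\<^sub>v c)))"
  shows "ts ! i0 \<le> \<theta>"
proof (rule ccontr)
  assume "\<not> ts ! i0 \<le> \<theta>"
  hence gt: "\<theta> < ts ! i0" by simp
  have Ac: "A \<in> carrier_mat k k" and Bc: "B \<in> carrier_mat k k"
    using A B by (auto simp: pos_def_mat_def hermitian_mat_def)
  have ik: "i0 < k"
  proof (rule ccontr)
    assume "\<not> i0 < k"
    with wide_kernel[OF C] inj show False by force
  qed
  obtain G \<tau> where G: "G \<in> carrier_mat k k" and GB: "mat_adjoint G * B * G = 1\<^sub>m k"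
    and GA: "mat_adjoint G * A * G = mat_diag k (\<lambda>k. complex_of_real (\<tau> k))"
    using pair_diagonalization[OF A B] by metis
  have "mset (map complex_of_real ts) = mset (map complex_of_real (map \<tau> [0..<k]))"
  proof (rule prod_linear_factors_mset_eq)
    have "smult (det B) (\<Prod>t\<leftarrow>ts. [:- complex_of_real t, 1:])
        = smult (det B) (\<Prod>t\<leftarrow>map \<tau> [0..<k]. [:- complex_of_real t, 1:])"
      using ts det_pencil_of_diagonalization[OF Ac Bc G GB GA] by (simp add: pair_eigenvalues_def)
    hence "(\<Prod>t\<leftarrow>ts. [:- complex_of_real t, 1:]) = (\<Prod>t\<leftarrow>map \<tau> [0..<k]. [:- complex_of_real t, 1:])"
      using pos_def_det_nonzero[OF B] by (simp add: smult_eq_iff)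
    thus "(\<Prod>a\<leftarrow>map complex_of_real ts. [:- a, 1:]) = (\<Prod>a\<leftarrow>map complex_of_real (map \<tau> [0..<k]). [:- a, 1:])"
      by (simp add: o_def)
  qed
  hence "mset (map Re (map complex_of_real ts)) = mset (map Re (map complex_of_real (map \<tau> [0..<k])))"
    by (simp only: mset_map)
  hence mts: "mset ts = mset (map \<tau> [0..<k])" by (simp add: o_def)
  define js where "js = filter (\<lambda>q. \<tau> q \<le> \<theta>) [0..<k]"
  have "length ts = k" using arg_cong[OF mts, of size] by simp
  with ik gt ts have "length (filter (\<lambda>t. t \<le> \<theta>) ts) \<le> i0"
    by (intro sorted_count_le) (auto simp: pair_eigenvalues_def)
  moreover have "length (filter (\<lambda>t. t \<le> \<theta>) ts) = length (filter (\<lambda>t. t \<le> \<theta>) (map \<tau> [0..<k]))"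
    using arg_cong[OF mts, of "\<lambda>M. size (filter_mset (\<lambda>t. t \<le> \<theta>) M)"] by (metis mset_filter size_mset)
  ultimately have js: "length js \<le> i0"
    by (simp add: js_def filter_map o_def)
  define L where "L = mat_adjoint G * B"
  have L: "L \<in> carrier_mat k k"
    unfolding L_def by (rule mult_carrier_mat[OF mat_adjoint_carrier[OF G] Bc])
  have "L * G = 1\<^sub>m k" using GB by (simp add: L_def)
  hence GL: "G * L = 1\<^sub>m k" by (rule mat_mult_left_right_inverse[OF L G])
  \<comment> \<open>The rows of \<open>L * C\<close> express the eigencoordinates of
    \<open>C *\<^sub>v c\<close> through \<open>c\<close>. \<open>E\<close> keeps those belonging to
    eigenvalues at most \<open>\<theta>\<close>, fewer rows than the \<open>i0 + 1\<close>
    columns.\<close>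
  define E where "E = mat (length js) (Suc i0) (\<lambda>(p, q). (L * C) $$ (js ! p, q))"
  have "E \<in> carrier_mat (length js) (Suc i0)" by (simp add: E_def)
  from wide_kernel[OF this] js obtain c where c: "c \<in> carrier_vec (Suc i0)" "c \<noteq> 0\<^sub>v (Suc i0)"
    "E *\<^sub>v c = 0\<^sub>v (length js)" by auto
  define v where "v = C *\<^sub>v c"
  define e where "e = L *\<^sub>v v"
  have v: "v \<in> carrier_vec k" using C c by (simp add: v_def)
  have e: "e \<in> carrier_vec k" using L v by (simp add: e_def)
  have Ge: "G *\<^sub>v e = v" unfolding e_def using GL assoc_mult_mat_vec[OF G L v] v by simp
  have e0: "e $ q = 0" if q: "q < k" "\<tau> q \<le> \<theta>" for q
  proof -
    have "q \<in> set js" using q by (simp add: js_def)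
    then obtain p where p: "p < length js" "js ! p = q" by (auto simp: in_set_conv_nth)
    have "e $ q = ((L * C) *\<^sub>v c) $ q" unfolding e_def v_def using assoc_mult_mat_vec[OF L C c(1)] by simp
    also have "\<dots> = (E *\<^sub>v c) $ p"
    proof -
      have "row (L * C) q = row E p"
        using p q L C by (intro eq_vecI) (auto simp: E_def)
      thus ?thesis using p q L by (simp add: E_def)
    qed
    finally show ?thesis using c p by simp
  qed
  have "conjugate v \<bullet> (B *\<^sub>v v) = conjugate e \<bullet> e"
    using inner_congruence[OF Bc G e e] e unfolding GB Ge by simp
  hence vB: "Re (conjugate v \<bullet> (B *\<^sub>v v)) = (\<Sum>q<k. (cmod (e $ q))\<^sup>2)"
    unfolding inner_self[OF e] by simp
  have "conjugate v \<bullet> (A *\<^sub>v v) = conjugate e \<bullet> (mat_diag k (\<lambda>q. complex_of_real (\<tau> q)) *\<^sub>v e)"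
    using inner_congruence[OF Ac G e e] e unfolding GA Ge by simp
  hence vA: "Re (conjugate v \<bullet> (A *\<^sub>v v)) = (\<Sum>q<k. \<tau> q * (cmod (e $ q))\<^sup>2)"
    unfolding inner_mat_diag[OF e] by simp
  have "(\<Sum>q<k. (\<tau> q - \<theta>) * (cmod (e $ q))\<^sup>2) \<le> 0"
    using form[OF c(1), folded v_def] unfolding vA vB by (simp add: algebra_simps sum_subtractf sum_distrib_left)
  moreover have nn: "0 \<le> (\<tau> q - \<theta>) * (cmod (e $ q))\<^sup>2" if "q < k" for q
    using e0[OF that] by (cases "\<tau> q \<le> \<theta>") auto
  ultimately have "\<forall>q\<in>{..<k}. (\<tau> q - \<theta>) * (cmod (e $ q))\<^sup>2 = 0"
    by (subst sum_nonneg_eq_0_iff[symmetric]) (auto intro: antisym sum_nonneg)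
  hence "e $ q = 0" if "q < k" for q using that e0[OF that] by (cases "\<tau> q \<le> \<theta>") auto
  hence "e = 0\<^sub>v k" using e by (intro eq_vecI) auto
  hence "v = 0\<^sub>v k" using Ge G by (auto intro!: eq_vecI simp: scalar_prod_def)
  with inj[OF c(1)] c(2) show False by (simp add: v_def)
qed

text \<open>\<open>M\<close> is self-adjoint for the inner product with weights \<open>x\<close>, so
  it has an eigenbasis that is orthonormal in that inner product. There the error operator is
  diagonal with entries \<open>1 - \<omega> * \<tau> k\<close>, and its norm is read off from the
  extreme eigenvalues. The scale \<open>\<omega>\<close> does not depend on
  \<open>d\<close>.\<close>

lemma preconditioner_cone:
  fixes x :: "nat \<Rightarrow> real" and K :: "complex mat"
  assumes m: "0 < m" and K: "pos_def_mat m K" and x: "\<And>k. k < m \<Longrightarrow> 0 < x k"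
  defines "M \<equiv> K * mat_diag m (\<lambda>k. complex_of_real (x k))"
  defines "\<alpha> \<equiv> min_eigenvalue M" and "\<beta> \<equiv> max_eigenvalue M"
  defines "\<epsilon> \<equiv> (\<beta> - \<alpha>) / (\<beta> + \<alpha>)"
  shows "0 \<le> \<epsilon>" "\<epsilon> < 1"
    and "\<exists>\<omega>::real. \<forall>d\<in>carrier_vec m. (\<Sum>k<m. x k * (cmod (d $ k - of_real \<omega> * (M *\<^sub>v d) $ k))\<^sup>2)
      \<le> \<epsilon>\<^sup>2 * (\<Sum>k<m. x k * (cmod (d $ k))\<^sup>2)"
proof -
  define A where "A = mat_diag m (\<lambda>k. complex_of_real (x k))"
  have Ac: "A \<in> carrier_mat m m" by (simp add: A_def)
  have Aadj: "mat_adjoint A = A" using hermitian_mat_diag[of m x] by (simp add: A_def hermitian_mat_def)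
  have A_norm: "conjugate d \<bullet> (A *\<^sub>v d) = of_real (\<Sum>k<m. x k * (cmod (d $ k))\<^sup>2)" if "d \<in> carrier_vec m" for d
    unfolding A_def by (rule inner_mat_diag[OF that])
  have Ap: "pos_def_mat m A"
    unfolding A_def using x by (rule pos_def_mat_diag)
  have Kc: "K \<in> carrier_mat m m" and Kh: "hermitian_mat m K" using K by (auto simp: pos_def_mat_def hermitian_mat_def)
  have Ainj: "d = 0\<^sub>v m" if "d \<in> carrier_vec m" "A *\<^sub>v d = 0\<^sub>v m" for d
    using pos_def_inner_pos[OF Ap that(1)] that by fastforce
  \<comment> \<open>\<open>N = A * M\<close> is Hermitian, and the pair \<open>(N, A)\<close> has
    the same eigenvalues as the non-Hermitian product \<open>M\<close>.\<close>
  define N where "N = A * K * A"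
  have Np: "pos_def_mat m N" unfolding N_def using pos_def_congruence[OF K Ac Ainj] Aadj by simp
  have Nc: "N \<in> carrier_mat m m" and Nh: "hermitian_mat m N" using Np by (auto simp: pos_def_mat_def hermitian_mat_def)
  obtain G \<tau> where G: "G \<in> carrier_mat m m" and GA: "mat_adjoint G * A * G = 1\<^sub>m m"
    and GN: "mat_adjoint G * N * G = mat_diag m (\<lambda>k. complex_of_real (\<tau> k))"
    using pair_diagonalization[OF Nh Ap] by metis
  define L where "L = mat_adjoint G * A"
  define T where "T = mat_diag m (\<lambda>k. complex_of_real (\<tau> k))"
  have G': "mat_adjoint G \<in> carrier_mat m m" using G by simp
  have L: "L \<in> carrier_mat m m" unfolding L_def by (rule mult_carrier_mat[OF G' Ac])
  have T: "T \<in> carrier_mat m m" by (simp add: T_def)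
  have LG: "L * G = 1\<^sub>m m" using GA by (simp add: L_def)
  have GL: "G * L = 1\<^sub>m m" by (rule mat_mult_left_right_inverse[OF L G LG])
  have M: "M \<in> carrier_mat m m" unfolding M_def A_def[symmetric] by (rule mult_carrier_mat[OF Kc Ac])
  have NAM: "N = A * M" unfolding N_def M_def A_def[symmetric] by (rule assoc_mult_mat[OF Ac Kc Ac])
  have T_LMG: "T = L * M * G"
    unfolding T_def GN[symmetric] NAM L_def using assoc_mult_mat[OF G' Ac M] by simp
  have MG: "M * G = G * T"
  proof -
    have "G * T = G * (L * (M * G))" unfolding T_LMG using assoc_mult_mat[OF L M G] by simp
    also have "\<dots> = (G * L) * (M * G)" by (rule assoc_mult_mat[OF G L mult_carrier_mat[OF M G], symmetric])
    finally show ?thesis using GL M G by simp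
  qed
  have "M = M * (G * L)" using GL M by simp
  also have "\<dots> = G * T * L" using assoc_mult_mat[OF M G L] MG by simp
  finally have MGTL: "M = G * T * L" .
  have "similar_mat M T"
    unfolding similar_mat_def similar_mat_wit_def using MGTL GL LG M T G L
    by (intro exI[of _ G] exI[of _ L]) (simp add: Let_def)
  hence "char_poly M = char_poly T" by (rule char_poly_similar)
  hence "{a. eigenvalue M (complex_of_real a)} = \<tau> ` {..<m}"
    unfolding eigenvalue_root_char_poly[OF M] real_eigenvalues_mat_diag[symmetric] T_def[symmetric]
      eigenvalue_root_char_poly[OF T] by simp
  hence eig: "\<alpha> = Min (\<tau> ` {..<m})" "\<beta> = Max (\<tau> ` {..<m})"
    by (simp_all add: \<alpha>_def \<beta>_def min_eigenvalue_def max_eigenvalue_def)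
  have bounds: "\<alpha> \<le> \<tau> k" "\<tau> k \<le> \<beta>" if "k < m" for k using that unfolding eig by auto
  have \<tau>pos: "0 < \<tau> k" if k: "k < m" for k
  proof -
    have "conjugate (col G k) \<bullet> (A *\<^sub>v col G k) = 1"
      using congruence_index[OF Ac G k k] GA k by simp
    hence "col G k \<noteq> 0\<^sub>v m" using Ac by auto
    hence "0 < Re (conjugate (col G k) \<bullet> (N *\<^sub>v col G k))"
      using G k by (intro pos_def_inner_pos[OF Np]) auto
    also have "\<dots> = \<tau> k"
    proof -
      have "complex_of_real (\<tau> k) = conjugate (col G k) \<bullet> (N *\<^sub>v col G k)"
        using congruence_index[OF Nc G k k] GN k by (simp add: mat_diag_def)
      thus ?thesis by (metis Re_complex_of_real)
    qed
    finally show ?thesis .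
  qed
  have "\<alpha> \<in> \<tau> ` {..<m}" unfolding eig using m by (intro Min_in) auto
  hence \<alpha>: "0 < \<alpha>" using \<tau>pos by auto
  have \<alpha>\<beta>: "\<alpha> \<le> \<beta>" using bounds[OF m] by simp
  show "0 \<le> \<epsilon>" "\<epsilon> < 1" unfolding \<epsilon>_def using \<alpha> \<alpha>\<beta> by auto
  \<comment> \<open>With this scale the map t to 1 - \<omega> t carries the interval from \<alpha>
    to \<beta> onto the one from -\<epsilon> to \<epsilon>.\<close>
  define \<omega> where "\<omega> = 2 / (\<beta> + \<alpha>)"
  have contr: "(1 - \<omega> * \<tau> k)\<^sup>2 \<le> \<epsilon>\<^sup>2" if k: "k < m" for k
  proof -
    have "\<bar>(\<beta> + \<alpha>) - 2 * \<tau> k\<bar> \<le> \<beta> - \<alpha>" using bounds[OF k] by linarith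
    moreover have "1 - \<omega> * \<tau> k = ((\<beta> + \<alpha>) - 2 * \<tau> k) / (\<beta> + \<alpha>)"
      unfolding \<omega>_def using \<alpha> \<alpha>\<beta> by (simp add: field_simps)
    ultimately have "\<bar>1 - \<omega> * \<tau> k\<bar> \<le> \<bar>\<epsilon>\<bar>"
      unfolding \<epsilon>_def using \<alpha> \<alpha>\<beta> by (simp add: abs_divide divide_right_mono)
    thus ?thesis by (simp add: abs_le_square_iff)
  qed
  have norm_G: "(\<Sum>k<m. x k * (cmod ((G *\<^sub>v c) $ k))\<^sup>2) = (\<Sum>k<m. (cmod (c $ k))\<^sup>2)" if c: "c \<in> carrier_vec m" for c
  proof -
    have "conjugate (G *\<^sub>v c) \<bullet> (A *\<^sub>v (G *\<^sub>v c)) = conjugate c \<bullet> c"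
      using inner_congruence[OF Ac G c c] c unfolding GA by simp
    also have "\<dots> = of_real (\<Sum>k<m. (cmod (c $ k))\<^sup>2)"
      by (rule inner_self[OF c])
    finally show ?thesis using A_norm[of "G *\<^sub>v c"] G c by (simp only: of_real_eq_iff mult_mat_vec_carrier)
  qed
  show "\<exists>\<omega>::real. \<forall>d\<in>carrier_vec m. (\<Sum>k<m. x k * (cmod (d $ k - of_real \<omega> * (M *\<^sub>v d) $ k))\<^sup>2)
      \<le> \<epsilon>\<^sup>2 * (\<Sum>k<m. x k * (cmod (d $ k))\<^sup>2)"
  proof (intro exI[of _ \<omega>] ballI)
    fix d :: "complex vec" assume d: "d \<in> carrier_vec m"
    define c where "c = L *\<^sub>v d"
    have c: "c \<in> carrier_vec m" using L d by (simp add: c_def)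
    have Gc: "G *\<^sub>v c = d" unfolding c_def using GL assoc_mult_mat_vec[OF G L d] d by simp
    define c' where "c' = c - of_real \<omega> \<cdot>\<^sub>v (T *\<^sub>v c)"
    have c': "c' \<in> carrier_vec m" using c T by (simp add: c'_def)
    have c'k: "c' $ k = of_real (1 - \<omega> * \<tau> k) * c $ k" if k: "k < m" for k
      using mat_diag_mult_vec[OF c, of "\<lambda>k. complex_of_real (\<tau> k)"] k c T
      by (simp add: c'_def T_def algebra_simps)
    have "M *\<^sub>v d = G *\<^sub>v (T *\<^sub>v c)"
      using assoc_mult_mat_vec[OF M G c] assoc_mult_mat_vec[OF G T c] by (simp add: Gc MG)
    hence Gc': "d - of_real \<omega> \<cdot>\<^sub>v (M *\<^sub>v d) = G *\<^sub>v c'"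
      unfolding c'_def using G c T Gc
      by (simp add: mult_minus_distrib_mat_vec[of G m m] mult_mat_vec[of G m m])
    have "(\<Sum>k<m. x k * (cmod (d $ k - of_real \<omega> * (M *\<^sub>v d) $ k))\<^sup>2)
        = (\<Sum>k<m. x k * (cmod ((G *\<^sub>v c') $ k))\<^sup>2)"
      unfolding Gc'[symmetric] using M d by (intro sum.cong) auto
    also have "\<dots> = (\<Sum>k<m. (1 - \<omega> * \<tau> k)\<^sup>2 * (cmod (c $ k))\<^sup>2)"
      unfolding norm_G[OF c'] by (intro sum.cong) (simp_all add: c'k norm_mult power_mult_distrib del: of_real_diff of_real_mult)
    also have "\<dots> \<le> (\<Sum>k<m. \<epsilon>\<^sup>2 * (cmod (c $ k))\<^sup>2)"
      by (intro sum_mono mult_right_mono contr) auto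
    also have "\<dots> = \<epsilon>\<^sup>2 * (\<Sum>k<m. x k * (cmod (d $ k))\<^sup>2)"
      using norm_G[OF c] unfolding Gc by (simp add: sum_distrib_left)
    finally show "(\<Sum>k<m. x k * (cmod (d $ k - of_real \<omega> * (M *\<^sub>v d) $ k))\<^sup>2)
      \<le> \<epsilon>\<^sup>2 * (\<Sum>k<m. x k * (cmod (d $ k))\<^sup>2)" .
  qed
qed

section \<open>Eigencoordinates\<close>

lemma cspan_list:
  assumes "set vs \<subseteq> carrier_vec n"
  shows "x \<in> cspan n (set vs) \<longleftrightarrow> (\<exists>c\<in>carrier_vec (length vs). x = mat_of_cols n vs *\<^sub>v c)"
proof -
  interpret vec_space "TYPE(complex)" n .
  have "cspan n (set vs) = col_space (mat_of_cols n vs)"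
    unfolding col_space_def using assms by simp
  also have "\<dots> = {y \<in> carrier_vec n. \<exists>c\<in>carrier_vec (length vs). mat_of_cols n vs *\<^sub>v c = y}"
    using col_space_eq[OF mat_of_cols_carrier(1)[of n vs]] by simp
  finally show ?thesis using mat_of_cols_carrier(1)[of n vs] by (auto intro: mult_mat_vec_carrier[OF mat_of_cols_carrier(1)])
qed

text \<open>Linear independence concerns a set of vectors with coefficients attached to the vectors,
  whereas \<open>c\<close> is indexed by column number. Distinctness of the columns lets
  \<open>f\<close> transport the coefficients from indices to vectors.\<close>

lemma basis_matrix_injective:
  assumes W: "basis_matrix n X W" and c: "c \<in> carrier_vec (dim_col W)" and Wc: "W *\<^sub>v c = 0\<^sub>v n"
  shows "c = 0\<^sub>v (dim_col W)"
proof -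
  interpret vec_space "TYPE(complex)" n .
  have dim: "dim_row W = n" "distinct (cols W)" and indep: "\<not> lin_dep (set (cols W))"
    using W by (auto simp: basis_matrix_def)
  have sub: "set (cols W) \<subseteq> carrier_vec n" using dim(1) by (metis cols_dim)
  have len: "length (cols W) = dim_col W" by simp
  define f where "f v = (if \<exists>k<dim_col W. v = cols W ! k then c $ (THE k. k < dim_col W \<and> v = cols W ! k) else 0)" for v
  have f: "f (cols W ! k) = c $ k" if k: "k < dim_col W" for k
  proof -
    have "(THE k'. k' < dim_col W \<and> cols W ! k = cols W ! k') = k"
      using k dim(2) len by (intro the_equality) (auto simp: nth_eq_iff_index_eq simp del: cols_nth)
    thus ?thesis using k by (auto simp: f_def)
  qed
  have "lincomb f (set (cols W)) = lincomb_list (\<lambda>k. f (cols W ! k)) (cols W)"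
    by (rule lincomb_as_lincomb_list_distinct[OF sub dim(2)])
  also have "\<dots> = mat_of_cols n (cols W) *\<^sub>v vec (length (cols W)) (\<lambda>k. f (cols W ! k))"
    using sub by (intro lincomb_list_as_mat_mult) auto
  also have "vec (length (cols W)) (\<lambda>k. f (cols W ! k)) = c"
    using c by (intro eq_vecI) (auto simp: f simp del: cols_nth)
  also have "mat_of_cols n (cols W) = W" using dim(1) by auto
  finally have z: "lincomb f (set (cols W)) = 0\<^sub>v n" using Wc by simp
  have f0: "f v = 0" if v: "v \<in> set (cols W)" for v
  proof (rule ccontr)
    assume "f v \<noteq> 0"
    hence "lin_dep (set (cols W))" unfolding lin_dep_def using z v by (intro exI[of _ "set (cols W)"] exI[of _ f] exI[of _ v]) auto
    with indep show False by simp
  qed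
  have "c $ k = 0" if "k < dim_col W" for k
    using f0[of "cols W ! k"] f[OF that] nth_mem[of k "cols W"] that len by metis
  thus ?thesis using c by (intro eq_vecI) auto
qed

section \<open>Coordinates with respect to an S-orthonormal eigenbasis\<close>

locale pencil_eigenbasis =
  fixes n :: nat and H S :: "complex mat" and lam :: "nat \<Rightarrow> real" and u :: "nat \<Rightarrow> complex vec"
  assumes H: "hermitian_mat n H" and S: "pos_def_mat n S"
    and u_carrier: "\<And>l. l \<in> {1..n} \<Longrightarrow> u l \<in> carrier_vec n"
    and u_eigen: "\<And>l. l \<in> {1..n} \<Longrightarrow> H *\<^sub>v u l = complex_of_real (lam l) \<cdot>\<^sub>v (S *\<^sub>v u l)"
    and u_orthonormal: "\<And>l m. l \<in> {1..n} \<Longrightarrow> m \<in> {1..n} \<Longrightarrow>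
          conjugate (u l) \<bullet> (S *\<^sub>v u m) = (if l = m then 1 else 0)"
begin

lemma Hc: "H \<in> carrier_mat n n" and Sc: "S \<in> carrier_mat n n" and Sh: "hermitian_mat n S"
  using H S by (auto simp: hermitian_mat_def pos_def_mat_def)

text \<open>By S-orthonormality this is the coefficient of \<open>x\<close> along
  \<open>u l\<close>.\<close>

definition coord :: "complex vec \<Rightarrow> nat \<Rightarrow> complex" where
  "coord x l = conjugate (u l) \<bullet> (S *\<^sub>v x)"

definition X :: "complex mat" where
  "X = mat_of_cols n (map u [1..<n+1])"

text \<open>Inverse of \<open>coord\<close>. Coordinates are numbered from 1 like the eigenvectors,
  vector entries from 0, hence the \<open>Suc\<close>.\<close>

definition comb :: "(nat \<Rightarrow> complex) \<Rightarrow> complex vec" where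
  "comb \<xi> = X *\<^sub>v vec n (\<lambda>k. \<xi> (Suc k))"

lemma X_carrier: "X \<in> carrier_mat n n"
  using mat_of_cols_carrier(1)[of n "map u [1..<n+1]"] by (simp add: X_def del: upt_Suc)

lemma col_X: "k < n \<Longrightarrow> col X k = u (Suc k)"
  unfolding X_def using u_carrier[of "Suc k"] by (subst col_mat_of_cols) (auto simp del: upt_Suc)

lemma XSX: "mat_adjoint X * S * X = 1\<^sub>m n"
  using X_carrier by (intro eq_matI)
    (auto simp: congruence_index[OF Sc X_carrier] col_X u_orthonormal simp del: index_mult_mat(1))

text \<open>A left inverse of a square matrix is a right inverse. This is where n S-orthonormal
  vectors are seen to be complete, so that every vector is recovered from its coordinates.\<close>

lemma X_inverse: "X * (mat_adjoint X * S) = 1\<^sub>m n"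
  by (rule mat_mult_left_right_inverse[OF mult_carrier_mat[OF mat_adjoint_carrier[OF X_carrier] Sc] X_carrier XSX])

lemma adjoint_X_vec: "x \<in> carrier_vec n \<Longrightarrow> mat_adjoint X *\<^sub>v x = vec n (\<lambda>k. conjugate (u (Suc k)) \<bullet> x)"
proof (rule eq_vecI)
  fix k assume "k < dim_vec (vec n (\<lambda>k. conjugate (u (Suc k)) \<bullet> x))"
  hence k: "k < n" by simp
  have "row (mat_adjoint X) k = conjugate (col X k)" using k X_carrier by (intro eq_vecI) auto
  thus "(mat_adjoint X *\<^sub>v x) $ k = vec n (\<lambda>k. conjugate (u (Suc k)) \<bullet> x) $ k"
    using k X_carrier by (simp add: col_X)
qed (use X_carrier in auto)

lemma coord_vec: "x \<in> carrier_vec n \<Longrightarrow> (mat_adjoint X * S) *\<^sub>v x = vec n (\<lambda>k. coord x (Suc k))"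
  using assoc_mult_mat_vec[OF mat_adjoint_carrier[OF X_carrier] Sc] adjoint_X_vec[of "S *\<^sub>v x"] Sc
  by (simp add: coord_def)

lemma comb_carrier [simp]: "comb \<xi> \<in> carrier_vec n"
  unfolding comb_def using X_carrier by simp

lemma comb_coord: "x \<in> carrier_vec n \<Longrightarrow> comb (coord x) = x"
  unfolding comb_def coord_vec[symmetric]
  using assoc_mult_mat_vec[OF X_carrier mult_carrier_mat[OF mat_adjoint_carrier[OF X_carrier] Sc], of x] X_inverse
  by simp

lemma coord_comb: assumes l: "l \<in> {1..n}" shows "coord (comb \<xi>) l = \<xi> l"
proof -
  have "vec n (\<lambda>k. coord (comb \<xi>) (Suc k)) = (mat_adjoint X * S * X) *\<^sub>v vec n (\<lambda>k. \<xi> (Suc k))"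
    unfolding coord_vec[OF comb_carrier, symmetric] unfolding comb_def
    by (rule assoc_mult_mat_vec[symmetric, OF mult_carrier_mat[OF mat_adjoint_carrier[OF X_carrier] Sc] X_carrier]) simp
  hence "vec n (\<lambda>k. coord (comb \<xi>) (Suc k)) $ (l - 1) = vec n (\<lambda>k. \<xi> (Suc k)) $ (l - 1)"
    unfolding XSX by simp
  thus ?thesis using l by auto
qed

lemma coord_eqI:
  assumes "x \<in> carrier_vec n" "y \<in> carrier_vec n" "\<And>l. l \<in> {1..n} \<Longrightarrow> coord x l = coord y l"
  shows "x = y"
proof -
  have "comb (coord x) = comb (coord y)"
    unfolding comb_def using assms(3) by (intro arg_cong[of _ _ "(*\<^sub>v) X"] eq_vecI) auto
  thus ?thesis using comb_coord assms by metis
qed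

text \<open>The counterpart of \<open>coord_eqI\<close> for vectors on the dual side, such as
  residuals: it allows \<open>H *\<^sub>v x\<close> to be compared with a vector
  \<open>S *\<^sub>v y\<close> without inverting \<open>S\<close>.\<close>

lemma inner_eqI:
  assumes x: "x \<in> carrier_vec n" and y: "y \<in> carrier_vec n"
    and eq: "\<And>l. l \<in> {1..n} \<Longrightarrow> conjugate (u l) \<bullet> x = conjugate (u l) \<bullet> y"
  shows "x = y"
proof -
  have "mat_adjoint X *\<^sub>v x = mat_adjoint X *\<^sub>v y"
    unfolding adjoint_X_vec[OF x] adjoint_X_vec[OF y] using eq by (intro eq_vecI) auto
  moreover have "mat_adjoint (mat_adjoint X * S) * mat_adjoint X = 1\<^sub>m n"
  proof -
    have "mat_adjoint (1\<^sub>m n) = (1\<^sub>m n :: complex mat)" by (intro eq_matI) auto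
    thus ?thesis
      using mat_adjoint_mult[OF X_carrier mult_carrier_mat[OF mat_adjoint_carrier[OF X_carrier] Sc]] X_inverse by simp
  qed
  ultimately show ?thesis
    using assoc_mult_mat_vec[OF mat_adjoint_carrier[OF mult_carrier_mat[OF mat_adjoint_carrier[OF X_carrier] Sc]]
        mat_adjoint_carrier[OF X_carrier] x]
      assoc_mult_mat_vec[OF mat_adjoint_carrier[OF mult_carrier_mat[OF mat_adjoint_carrier[OF X_carrier] Sc]]
        mat_adjoint_carrier[OF X_carrier] y] x y by simp
qed

lemma coord_u: "l \<in> {1..n} \<Longrightarrow> m \<in> {1..n} \<Longrightarrow> coord (u m) l = (if l = m then 1 else 0)"
  unfolding coord_def by (rule u_orthonormal)

lemma coord_add: "x \<in> carrier_vec n \<Longrightarrow> y \<in> carrier_vec n \<Longrightarrow> l \<in> {1..n} \<Longrightarrow>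
    coord (x + y) l = coord x l + coord y l"
  unfolding coord_def using Sc u_carrier[of l]
  by (simp add: mult_add_distrib_mat_vec[of _ n n] scalar_prod_add_distrib[of _ n])

lemma coord_smult: "x \<in> carrier_vec n \<Longrightarrow> l \<in> {1..n} \<Longrightarrow> coord (a \<cdot>\<^sub>v x) l = a * coord x l"
  unfolding coord_def using Sc u_carrier[of l] by (simp add: mult_mat_vec[of _ n n])

lemma coord_mat_vec:
  assumes W: "W \<in> carrier_mat n k" and c: "c \<in> carrier_vec k" and l: "l \<in> {1..n}"
  shows "coord (W *\<^sub>v c) l = (\<Sum>q<k. c $ q * coord (col W q) l)"
proof -
  have "coord (W *\<^sub>v c) l = row (mat_adjoint X * S * W) (l - 1) \<bullet> c"
  proof -
    have "(mat_adjoint X * S * W) *\<^sub>v c = (mat_adjoint X * S) *\<^sub>v (W *\<^sub>v c)"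
      by (rule assoc_mult_mat_vec[OF mult_carrier_mat[OF mat_adjoint_carrier[OF X_carrier] Sc] W c])
    hence "((mat_adjoint X * S * W) *\<^sub>v c) $ (l - 1) = vec n (\<lambda>k. coord (W *\<^sub>v c) (Suc k)) $ (l - 1)"
      using coord_vec[of "W *\<^sub>v c"] W c by simp
    also have "\<dots> = coord (W *\<^sub>v c) l" using l by auto
    finally show ?thesis using X_carrier l by auto
  qed
  also have "\<dots> = (\<Sum>q<k. (mat_adjoint X * S * W) $$ (l - 1, q) * c $ q)"
    using W c l X_carrier by (auto simp: scalar_prod_def atLeast0LessThan simp del: index_mult_mat(1) intro!: sum.cong)
  also have "\<dots> = (\<Sum>q<k. c $ q * coord (col W q) l)"
  proof (rule sum.cong[OF refl])
    fix q assume "q \<in> {..<k}"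
    hence q: "q < k" by simp
    have "(mat_adjoint X * S * W) $$ (l - 1, q) = ((mat_adjoint X * S) *\<^sub>v col W q) $ (l - 1)"
      using W q l X_carrier by auto
    also have "\<dots> = coord (col W q) l" using coord_vec[of "col W q"] W q l by auto
    finally show "(mat_adjoint X * S * W) $$ (l - 1, q) * c $ q = c $ q * coord (col W q) l" by simp
  qed
  finally show ?thesis .
qed

lemma inner_coord:
  assumes x: "x \<in> carrier_vec n" and y: "y \<in> carrier_vec n"
  shows "conjugate x \<bullet> (S *\<^sub>v y) = (\<Sum>l=1..n. cnj (coord x l) * coord y l)"
proof -
  let ?x = "vec n (\<lambda>k. coord x (Suc k))" and ?y = "vec n (\<lambda>k. coord y (Suc k))"
  have "conjugate (X *\<^sub>v ?x) \<bullet> (S *\<^sub>v (X *\<^sub>v ?y)) = conjugate ?x \<bullet> ?y"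
    using inner_congruence[OF Sc X_carrier, of ?x ?y] unfolding XSX by simp
  thus ?thesis using comb_coord[OF x] comb_coord[OF y] unfolding comb_def
    by (simp add: scalar_prod_def atLeast0LessThan sum.atLeast1_atMost_eq)
qed

lemma inner_u_H:
  assumes l: "l \<in> {1..n}" and x: "x \<in> carrier_vec n"
  shows "conjugate (u l) \<bullet> (H *\<^sub>v x) = of_real (lam l) * coord x l"
proof -
  have "conjugate (u l) \<bullet> (H *\<^sub>v x) = cnj (of_real (lam l) * (conjugate x \<bullet> (S *\<^sub>v u l)))"
    using inner_hermitian[OF H u_carrier[OF l] x] u_eigen[OF l] x Sc u_carrier[OF l] by simp
  also have "\<dots> = of_real (lam l) * coord x l"
    unfolding coord_def inner_hermitian[OF Sh u_carrier[OF l] x] by simp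
  finally show ?thesis .
qed

lemma H_eq_S_comb:
  assumes x: "x \<in> carrier_vec n"
  shows "H *\<^sub>v x = S *\<^sub>v comb (\<lambda>l. of_real (lam l) * coord x l)"
proof (rule inner_eqI)
  fix l assume l: "l \<in> {1..n}"
  show "conjugate (u l) \<bullet> (H *\<^sub>v x) = conjugate (u l) \<bullet> (S *\<^sub>v comb (\<lambda>l. of_real (lam l) * coord x l))"
    using inner_u_H[OF l x] coord_comb[OF l, of "\<lambda>l. of_real (lam l) * coord x l"] by (simp add: coord_def)
qed (use Hc Sc x in auto)

lemma inner_H_coord:
  assumes x: "x \<in> carrier_vec n" and y: "y \<in> carrier_vec n"
  shows "conjugate x \<bullet> (H *\<^sub>v y) = (\<Sum>l=1..n. of_real (lam l) * (cnj (coord x l) * coord y l))"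
  unfolding H_eq_S_comb[OF y] inner_coord[OF x comb_carrier]
  by (intro sum.cong) (simp_all add: coord_comb)

lemma S_norm: "x \<in> carrier_vec n \<Longrightarrow> conjugate x \<bullet> (S *\<^sub>v x) = of_real (\<Sum>l=1..n. (cmod (coord x l))\<^sup>2)"
  unfolding inner_coord by (simp add: complex_norm_square mult.commute del: of_real_power)

lemma H_norm: "x \<in> carrier_vec n \<Longrightarrow> conjugate x \<bullet> (H *\<^sub>v x) = of_real (\<Sum>l=1..n. lam l * (cmod (coord x l))\<^sup>2)"
  unfolding inner_H_coord by (simp add: complex_norm_square mult.commute del: of_real_power)

lemma coord_sum_pos:
  assumes "x \<in> carrier_vec n" "x \<noteq> 0\<^sub>v n"
  shows "0 < (\<Sum>l=1..n. (cmod (coord x l))\<^sup>2)"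
  using pos_def_inner_pos[OF S assms] unfolding S_norm[OF assms(1)] by simp

lemma rayleigh_coord:
  assumes "x \<in> carrier_vec n"
  shows "rayleigh H S x = (\<Sum>l=1..n. lam l * (cmod (coord x l))\<^sup>2) / (\<Sum>l=1..n. (cmod (coord x l))\<^sup>2)"
  unfolding rayleigh_def S_norm[OF assms] H_norm[OF assms] by (simp flip: of_real_divide)

text \<open>Comparing the Rayleigh quotient with \<open>\<theta>\<close> becomes the sign of a
  quadratic form that is diagonal in the coordinates; all later estimates are made in this
  division-free form.\<close>

lemma shifted_sum:
  assumes "x \<in> carrier_vec n" "x \<noteq> 0\<^sub>v n"
  shows "(\<Sum>l=1..n. (lam l - \<theta>) * (cmod (coord x l))\<^sup>2)
    = (rayleigh H S x - \<theta>) * (\<Sum>l=1..n. (cmod (coord x l))\<^sup>2)"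
proof -
  have "(\<Sum>l=1..n. lam l * (cmod (coord x l))\<^sup>2) = rayleigh H S x * (\<Sum>l=1..n. (cmod (coord x l))\<^sup>2)"
    using coord_sum_pos[OF assms] unfolding rayleigh_coord[OF assms(1)] by simp
  thus ?thesis by (simp add: left_diff_distrib sum_subtractf flip: sum_distrib_left)
qed

lemma cspan_u:
  assumes ls: "distinct ls" "set ls \<subseteq> {1..n}"
  shows "x \<in> cspan n (u ` set ls) \<longleftrightarrow> x \<in> carrier_vec n \<and> (\<forall>l\<in>{1..n} - set ls. coord x l = 0)"
proof -
  let ?W = "mat_of_cols n (map u ls)"
  have sub: "set (map u ls) \<subseteq> carrier_vec n" using ls u_carrier by auto
  have W: "?W \<in> carrier_mat n (length ls)" using mat_of_cols_carrier(1)[of n "map u ls"] by simp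
  have col: "col ?W q = u (ls ! q)" if "q < length ls" for q
    using that sub by (subst col_mat_of_cols) auto
  have cW: "coord (?W *\<^sub>v c) l = (\<Sum>q<length ls. c $ q * (if l = ls ! q then 1 else 0))"
    if "c \<in> carrier_vec (length ls)" "l \<in> {1..n}" for c l
    unfolding coord_mat_vec[OF W that] using that(2) ls nth_mem
    by (intro sum.cong) (auto simp: col coord_u subset_iff)
  have iff: "x \<in> cspan n (u ` set ls) \<longleftrightarrow> (\<exists>c\<in>carrier_vec (length ls). x = ?W *\<^sub>v c)"
    using cspan_list[OF sub] by simp
  show ?thesis
    unfolding iff
  proof safe
    fix c :: "complex vec"
    assume c: "c \<in> carrier_vec (length ls)"
    show "?W *\<^sub>v c \<in> carrier_vec n" using W c by simp
    fix l assume l: "l \<in> {1..n}" "l \<notin> set ls"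
    show "coord (?W *\<^sub>v c) l = 0"
      unfolding cW[OF c l(1)] using l(2) by (intro sum.neutral) auto
  next
    assume x: "x \<in> carrier_vec n" and z: "\<forall>l\<in>{1..n} - set ls. coord x l = 0"
    define c where "c = vec (length ls) (\<lambda>q. coord x (ls ! q))"
    have c: "c \<in> carrier_vec (length ls)" by (simp add: c_def)
    have "x = ?W *\<^sub>v c"
    proof (rule coord_eqI[OF x])
      show "?W *\<^sub>v c \<in> carrier_vec n" using W c by simp
      fix l assume l: "l \<in> {1..n}"
      have "coord (?W *\<^sub>v c) l = (\<Sum>q<length ls. if l = ls ! q then coord x l else 0)"
        unfolding cW[OF c l] by (intro sum.cong) (auto simp: c_def)
      also have "\<dots> = coord x l"
      proof (cases "l \<in> set ls")
        case True
        then obtain q where q: "q < length ls" "l = ls ! q" by (auto simp: in_set_conv_nth)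
        have "(\<Sum>q'<length ls. if l = ls ! q' then coord x l else 0) = (\<Sum>q'<length ls. if q = q' then coord x l else 0)"
          using q ls(1) by (intro sum.cong) (auto simp: nth_eq_iff_index_eq)
        thus ?thesis using q by simp
      next
        case False
        with z l have "coord x l = 0" by simp
        moreover have "(\<Sum>q<length ls. if l = ls ! q then coord x l else 0) = 0"
          unfolding \<open>coord x l = 0\<close> by simp
        ultimately show ?thesis by simp
      qed
      finally show "coord x l = coord (?W *\<^sub>v c) l" by simp
    qed
    thus "\<exists>c\<in>carrier_vec (length ls). x = ?W *\<^sub>v c" using c by blast
  qed
qed

end

section \<open>The convergence bound\<close>

context pencil_eigenbasis
begin

lemma smult_zero_vec: "a \<cdot>\<^sub>v 0\<^sub>v n = (0\<^sub>v n :: complex vec)"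
  by (intro eq_vecI) auto

lemma coord_zero: "l \<in> {1..n} \<Longrightarrow> coord (0\<^sub>v n) l = 0"
  using coord_smult[of "0\<^sub>v n" l 0] smult_zero_vec[of 0] by simp

text \<open>Min-max for the compressed pair, with the test space spanned by the deflated
  eigenvectors and \<open>x\<close>. As \<open>x\<close> has no coordinates below \<open>i\<close>,
  the two parts do not interact in the shifted form: the deflated part is nonpositive because
  \<open>lam l \<le> \<theta>\<close>, and the other part is a nonnegative multiple of the form at
  \<open>x\<close>.\<close>

lemma ritz_value_le:
  assumes W: "basis_matrix n Y W" and ts: "ritz_values H S W ts"
    and i: "1 \<le> i" "i \<le> n"
    and uY: "\<And>l. 1 \<le> l \<Longrightarrow> l < i \<Longrightarrow> u l \<in> Y"
    and x: "x \<in> Y" "x \<in> carrier_vec n" "x \<noteq> 0\<^sub>v n"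
    and x0: "\<And>l. 1 \<le> l \<Longrightarrow> l < i \<Longrightarrow> coord x l = 0"
    and lam: "\<And>l. 1 \<le> l \<Longrightarrow> l < i \<Longrightarrow> lam l \<le> \<theta>"
    and le: "(\<Sum>l=1..n. (lam l - \<theta>) * (cmod (coord x l))\<^sup>2) \<le> 0"
  shows "ts ! (i - 1) \<le> \<theta>"
proof -
  define k where "k = dim_col W"
  obtain i0 where i0: "i = Suc i0" using i by (cases i) auto
  have Wc: "W \<in> carrier_mat n k" using W by (auto simp: basis_matrix_def k_def)
  have Winj: "\<And>c. c \<in> carrier_vec k \<Longrightarrow> W *\<^sub>v c = 0\<^sub>v n \<Longrightarrow> c = 0\<^sub>v k"
    unfolding k_def by (rule basis_matrix_injective[OF W])
  have inY: "\<exists>c\<in>carrier_vec k. y = W *\<^sub>v c" if "y \<in> Y" for y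
  proof -
    have "set (cols W) \<subseteq> carrier_vec n" using Wc by (metis cols_dim carrier_matD(1))
    moreover have "mat_of_cols n (cols W) = W" using Wc by (metis mat_of_cols_cols carrier_matD(1))
    moreover have "y \<in> cspan n (set (cols W))" using that W by (simp add: basis_matrix_def)
    ultimately show ?thesis using cspan_list[of "cols W" n y] by (simp add: k_def)
  qed
  \<comment> \<open>These \<open>i\<close> vectors span the test space. The min-max principle acts
    on coefficient vectors with respect to \<open>W\<close>, so their preimages under
    \<open>W\<close> become the columns of \<open>C\<close>.\<close>
  define w where "w q = (if q < i0 then u (Suc q) else x)" for q
  have "\<exists>c\<in>carrier_vec k. w q = W *\<^sub>v c" for q
    using inY uY[of "Suc q"] x(1) by (auto simp: w_def i0)
  then obtain f where f: "\<And>q. f q \<in> carrier_vec k" "\<And>q. w q = W *\<^sub>v f q" by metis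
  define C where "C = mat_of_cols k (map f [0..<i])"
  have C: "C \<in> carrier_mat k (Suc i0)"
    using mat_of_cols_carrier(1)[of k "map f [0..<i]"] by (simp add: C_def i0 del: upt_Suc)
  have colC: "col C q = f q" if "q < Suc i0" for q
    unfolding C_def using that f by (subst col_mat_of_cols) (auto simp: i0 simp del: upt_Suc)
  have WC: "W * C \<in> carrier_mat n (Suc i0)" by (rule mult_carrier_mat[OF Wc C])
  have colWC: "col (W * C) q = w q" if "q < Suc i0" for q
    unfolding col_mult2[OF Wc C that] colC[OF that] by (rule f(2)[symmetric])
  have coordWC: "coord (W *\<^sub>v (C *\<^sub>v c)) l = (if l < i then c $ (l - 1) else c $ i0 * coord x l)"
    if c: "c \<in> carrier_vec (Suc i0)" and l: "l \<in> {1..n}" for c l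
  proof -
    have "W *\<^sub>v (C *\<^sub>v c) = (W * C) *\<^sub>v c" by (rule assoc_mult_mat_vec[OF Wc C c, symmetric])
    hence "coord (W *\<^sub>v (C *\<^sub>v c)) l = (\<Sum>q<Suc i0. c $ q * coord (col (W * C) q) l)"
      using coord_mat_vec[OF WC c l] by simp
    also have "\<dots> = (\<Sum>q<i0. c $ q * coord (u (Suc q)) l) + c $ i0 * coord x l"
      by (simp add: colWC w_def)
    also have "(\<Sum>q<i0. c $ q * coord (u (Suc q)) l) = (\<Sum>q<i0. if l - 1 = q then c $ q else 0)"
      using l i by (intro sum.cong refl) (subst coord_u, auto simp: i0)
    finally show ?thesis using l x0[of l] by (auto simp: i0)
  qed
  have Ap: "hermitian_mat k (mat_adjoint W * H * W)" by (rule hermitian_congruence[OF H Wc])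
  have Bp: "pos_def_mat k (mat_adjoint W * S * W)" by (rule pos_def_congruence[OF S Wc Winj])
  have "ts ! i0 \<le> \<theta>"
  proof (rule pair_minmax[OF Ap Bp _ C])
    show "pair_eigenvalues (mat_adjoint W * H * W) (mat_adjoint W * S * W) ts"
      using ts by (simp add: ritz_values_def)
  next
    fix c :: "complex vec"
    assume c: "c \<in> carrier_vec (Suc i0)" and z: "C *\<^sub>v c = 0\<^sub>v k"
    have "W *\<^sub>v (C *\<^sub>v c) = 0\<^sub>v n" unfolding z using Wc by (auto intro!: eq_vecI simp: scalar_prod_def)
    hence z0: "coord (W *\<^sub>v (C *\<^sub>v c)) l = 0" if "l \<in> {1..n}" for l
      using that by (simp add: coord_zero)
    have "c $ q = 0" if q: "q < Suc i0" for q
    proof (cases "q < i0")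
      case True
      thus ?thesis using z0[of "Suc q"] coordWC[OF c, of "Suc q"] i by (simp add: i0)
    next
      case False
      hence [simp]: "q = i0" using q by simp
      obtain l where l: "l \<in> {1..n}" "coord x l \<noteq> 0"
        using coord_sum_pos[OF x(2,3)] by (metis (no_types, lifting) norm_zero sum.neutral less_irrefl zero_power2)
      hence "\<not> l < i" using x0[of l] by auto
      thus ?thesis using z0[OF l(1)] coordWC[OF c l(1)] l(2) by simp
    qed
    thus "c = 0\<^sub>v (Suc i0)" using c by (intro eq_vecI) auto
  next
    fix c :: "complex vec"
    assume c: "c \<in> carrier_vec (Suc i0)"
    define v where "v = W *\<^sub>v (C *\<^sub>v c)"
    have Cc: "C *\<^sub>v c \<in> carrier_vec k" using C c by simp
    have v: "v \<in> carrier_vec n" using Wc Cc by (simp add: v_def)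
    have "(\<Sum>l=1..n. (lam l - \<theta>) * (cmod (coord v l))\<^sup>2)
      \<le> (\<Sum>l=1..n. (cmod (c $ i0))\<^sup>2 * ((lam l - \<theta>) * (cmod (coord x l))\<^sup>2))"
    proof (rule sum_mono)
      fix l assume l: "l \<in> {1..n}"
      show "(lam l - \<theta>) * (cmod (coord v l))\<^sup>2 \<le> (cmod (c $ i0))\<^sup>2 * ((lam l - \<theta>) * (cmod (coord x l))\<^sup>2)"
        unfolding v_def coordWC[OF c l] using l lam[of l] x0[of l]
        by (auto simp: norm_mult power_mult_distrib mult_nonpos_nonneg)
    qed
    also have "\<dots> = (cmod (c $ i0))\<^sup>2 * (\<Sum>l=1..n. (lam l - \<theta>) * (cmod (coord x l))\<^sup>2)"
      by (rule sum_distrib_left[symmetric])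
    also have "\<dots> \<le> 0" using le by (simp add: mult_nonneg_nonpos)
    finally have "(\<Sum>l=1..n. lam l * (cmod (coord v l))\<^sup>2) \<le> \<theta> * (\<Sum>l=1..n. (cmod (coord v l))\<^sup>2)"
      by (simp add: left_diff_distrib sum_subtractf sum_distrib_left)
    thus "Re (conjugate (C *\<^sub>v c) \<bullet> ((mat_adjoint W * H * W) *\<^sub>v (C *\<^sub>v c)))
      \<le> \<theta> * Re (conjugate (C *\<^sub>v c) \<bullet> ((mat_adjoint W * S * W) *\<^sub>v (C *\<^sub>v c)))"
      unfolding inner_congruence[OF Hc Wc Cc Cc] inner_congruence[OF Sc Wc Cc Cc] v_def[symmetric]
        S_norm[OF v] H_norm[OF v] by simp
  qed
  thus ?thesis by (simp add: i0)
qed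

lemma ritz_vector_rayleigh:
  assumes W: "dim_row W = n" and t: "ritz_vector H S W t z" and norm: "conjugate z \<bullet> (S *\<^sub>v z) = 1"
  shows "rayleigh H S z = t"
proof -
  have Wc: "W \<in> carrier_mat n (dim_col W)" using W by auto
  from t obtain g where g: "g \<in> carrier_vec (dim_col W)" "z = W *\<^sub>v g"
    and eq: "(mat_adjoint W * H * W) *\<^sub>v g = complex_of_real t \<cdot>\<^sub>v ((mat_adjoint W * S * W) *\<^sub>v g)"
    by (auto simp: ritz_vector_def pair_eigenvector_def)
  have "(mat_adjoint W * S * W) *\<^sub>v g \<in> carrier_vec (dim_col W)"
    using hermitian_congruence[OF Sh Wc] g by (auto simp: hermitian_mat_def)
  hence "conjugate z \<bullet> (H *\<^sub>v z) = complex_of_real t * (conjugate z \<bullet> (S *\<^sub>v z))"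
    unfolding g(2) inner_congruence[OF Hc Wc g(1) g(1), symmetric] inner_congruence[OF Sc Wc g(1) g(1), symmetric] eq
    using g by simp
  thus ?thesis unfolding rayleigh_def norm by simp
qed

text \<open>The residual is written as \<open>S\<close> applied to a vector because a compressed
  preconditioner sees \<open>K\<close> only between two factors \<open>S\<close>.\<close>

lemma coord_residual:
  assumes z: "z \<in> carrier_vec n"
  shows "H *\<^sub>v z - complex_of_real \<rho> \<cdot>\<^sub>v (S *\<^sub>v z) = S *\<^sub>v comb (\<lambda>l. of_real (lam l - \<rho>) * coord z l)"
proof (rule inner_eqI)
  fix l assume l: "l \<in> {1..n}"
  have "conjugate (u l) \<bullet> (H *\<^sub>v z - complex_of_real \<rho> \<cdot>\<^sub>v (S *\<^sub>v z))
      = conjugate (u l) \<bullet> (H *\<^sub>v z) - of_real \<rho> * coord z l"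
    unfolding coord_def using z Hc Sc u_carrier[OF l] by (simp add: scalar_prod_minus_distrib[of _ n])
  also have "\<dots> = coord (comb (\<lambda>l. of_real (lam l - \<rho>) * coord z l)) l"
    unfolding inner_u_H[OF l z] coord_comb[OF l] by (simp add: left_diff_distrib)
  finally show "conjugate (u l) \<bullet> (H *\<^sub>v z - complex_of_real \<rho> \<cdot>\<^sub>v (S *\<^sub>v z))
      = conjugate (u l) \<bullet> (S *\<^sub>v comb (\<lambda>l. of_real (lam l - \<rho>) * coord z l))"
    unfolding coord_def .
qed (use z Hc Sc in auto)

text \<open>For \<open>q = V *\<^sub>v c\<close> the compressed preconditioner describes how
  \<open>K * S\<close> acts on eigencoordinates from \<open>i\<close> on. Coordinates of the result
  below \<open>i\<close> are not determined by it.\<close>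

lemma coord_preconditioned:
  assumes K: "K \<in> carrier_mat n n" and i: "1 \<le> i" "i \<le> n"
    and V: "V = mat_of_cols n (map u [i..<n+1])" and c: "c \<in> carrier_vec (n - i + 1)"
    and q: "q \<in> carrier_vec n"
    and q0: "\<And>l. l \<in> {1..n} \<Longrightarrow> coord q l = (if l < i then 0 else c $ (l - i))"
    and a: "a < n - i + 1"
  shows "coord (K *\<^sub>v (S *\<^sub>v q)) (i + a) = (compressed_prec S V K *\<^sub>v c) $ a"
proof -
  let ?m = "n - i + 1"
  have len: "length (map u [i..<n+1]) = ?m" using i by simp
  have Vc: "V \<in> carrier_mat n ?m" unfolding V using mat_of_cols_carrier(1)[of n "map u [i..<n+1]"] len by metis
  have colV: "col V b = u (i + b)" if "b < ?m" for b
    unfolding V using that i u_carrier[of "i + b"] by (subst col_mat_of_cols) (auto simp del: upt_Suc)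
  have Vq: "V *\<^sub>v c = q"
  proof (rule coord_eqI[OF _ q])
    show "V *\<^sub>v c \<in> carrier_vec n" using Vc c by simp
    fix l assume l: "l \<in> {1..n}"
    have "coord (V *\<^sub>v c) l = (\<Sum>b<?m. c $ b * coord (u (i + b)) l)"
      unfolding coord_mat_vec[OF Vc c l] by (simp add: colV)
    also have "\<dots> = (\<Sum>b<?m. if l = i + b then c $ b else 0)"
      using i l by (intro sum.cong refl) (subst coord_u, auto)
    also have "\<dots> = coord q l"
    proof (cases "l < i")
      case False
      have "(\<Sum>b<?m. if l = i + b then c $ b else 0) = (\<Sum>b<?m. if l - i = b then c $ b else 0)"
        using False by (intro sum.cong) auto
      also have "\<dots> = c $ (l - i)" using l False by auto
      finally show ?thesis using q0[OF l] False by simp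
    qed (use q0[OF l] in simp)
    finally show "coord (V *\<^sub>v c) l = coord q l" .
  qed
  have V': "mat_adjoint V \<in> carrier_mat ?m n" by (rule mat_adjoint_carrier[OF Vc])
  have "compressed_prec S V K *\<^sub>v c = mat_adjoint V *\<^sub>v (S *\<^sub>v (K *\<^sub>v (S *\<^sub>v (V *\<^sub>v c))))"
  proof -
    have 1: "mat_adjoint V * S \<in> carrier_mat ?m n" by (rule mult_carrier_mat[OF V' Sc])
    have 2: "mat_adjoint V * S * K \<in> carrier_mat ?m n" by (rule mult_carrier_mat[OF 1 K])
    have 3: "mat_adjoint V * S * K * S \<in> carrier_mat ?m n" by (rule mult_carrier_mat[OF 2 Sc])
    show ?thesis
      unfolding compressed_prec_def using Sc K q
      by (simp add: assoc_mult_mat_vec[OF 3 Vc c] Vq assoc_mult_mat_vec[OF 2 Sc] assoc_mult_mat_vec[OF 1 K]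
          assoc_mult_mat_vec[OF V' Sc])
  qed
  also have "\<dots> $ a = row (mat_adjoint V) a \<bullet> (S *\<^sub>v (K *\<^sub>v (S *\<^sub>v q)))"
    unfolding Vq using Vc a by simp
  also have "row (mat_adjoint V) a = conjugate (u (i + a))"
    unfolding colV[OF a, symmetric] using Vc a by (intro eq_vecI) auto
  finally show ?thesis by (simp add: coord_def)
qed

text \<open>The eigenvalue indices from \<open>i\<close> to \<open>n\<close> correspond to
  \<open>i + a\<close> with \<open>a < m\<close>. Sums over all indices reduce to this range since
  \<open>z\<close> is S-orthogonal to the columns of \<open>U\<close>, so that the ball condition of
  \<open>preconditioner_cone\<close> and the scalar lemma can be combined there.\<close>

lemma psd_id_contraction:
  assumes mono: "\<And>l m. 1 \<le> l \<Longrightarrow> l \<le> m \<Longrightarrow> m \<le> n \<Longrightarrow> lam l \<le> lam m"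
    and i: "1 \<le> i" "i \<le> n"
    and U: "U = mat_of_cols n (map u [1..<i])"
    and V: "V = mat_of_cols n (map u [i..<n+1])"
    and \<Lambda>: "\<Lambda> = mat_diag (n - i + 1) (\<lambda>l. complex_of_real (lam (i + l)))"
    and \<nu>: "\<nu> < lam i"
    and j: "i \<le> j" "j < n"
    and \<kappa>: "\<kappa> = (lam j - \<nu>) / (lam (j+1) - \<nu>) * ((lam n - lam (j+1)) / (lam n - lam j))"
    and K: "effectively_pos_def S V K" and step: "psd_id_step n H S U V K z z'"
    and \<rho>: "lam j < rayleigh H S z" "rayleigh H S z < lam (j+1)"
  defines "\<epsilon> \<equiv> quality S V \<Lambda> \<nu> K"
  defines "\<sigma> \<equiv> (\<kappa> + \<epsilon> * (2 - \<kappa>)) / ((2 - \<kappa>) + \<epsilon> * \<kappa>)"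
  shows "(rayleigh H S z' - lam j) / (lam (j+1) - rayleigh H S z')
    \<le> \<sigma>\<^sup>2 * ((rayleigh H S z - lam j) / (lam (j+1) - rayleigh H S z))"
proof -
  define m where "m = n - i + 1"
  define \<rho> where "\<rho> = rayleigh H S z"
  define x where "x l = lam l - \<nu>" for l
  define \<mu> b c where "\<mu> = x j" and "b = x (j+1)" and "c = x n"
  define \<psi> where "\<psi> = (\<rho> - lam j) / (lam (j+1) - \<rho>)"
  have \<rho>': "lam j < \<rho>" "\<rho> < lam (j+1)" using \<rho> by (simp_all add: \<rho>_def)
  have lam_i: "lam i \<le> lam l" if "l \<in> {i..n}" for l using mono[of i l] that i by simp
  have x_pos: "0 < x l" if "l \<in> {i..n}" for l using lam_i[OF that] \<nu> by (simp add: x_def)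
  have idx: "i + a \<in> {i..n}" if "a < m" for a
    using that i by (simp add: m_def less_Suc_eq_le le_diff_conv2 add.commute)
  have lenV: "length (map u [i..<n+1]) = m" using i by (simp add: m_def)
  have lenU: "length (map u [1..<i]) = i - 1" by simp
  have dimV: "dim_col V = m" unfolding V by (simp only: mat_of_cols_carrier lenV)
  have dimU: "dim_col U = i - 1" unfolding U by (simp only: mat_of_cols_carrier lenU)
  have colsV: "set (cols V) = u ` set [i..<n+1]"
  proof -
    have "set (map u [i..<n+1]) \<subseteq> carrier_vec n" using u_carrier i by (auto simp del: upt_Suc)
    thus ?thesis unfolding V by (simp del: upt_Suc)
  qed
  have colsU: "set (cols U) = u ` set [1..<i]"
  proof -
    have "set (map u [1..<i]) \<subseteq> carrier_vec n" using u_carrier i by (auto simp del: upt_Suc)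
    thus ?thesis unfolding U by (simp del: upt_Suc)
  qed
  define r where "r = H *\<^sub>v z - complex_of_real \<rho> \<cdot>\<^sub>v (S *\<^sub>v z)"
  define p where "p = K *\<^sub>v r"
  from step obtain W ts where Kh: "hermitian_mat n K" and zV: "z \<in> cspan n (set (cols V))" and z0: "z \<noteq> 0\<^sub>v n"
    and W: "basis_matrix n (cspan n (set (cols U) \<union> {z, p})) W" and ts: "ritz_values H S W ts"
    and z': "ritz_vector H S W (ts ! dim_col U) z'" "conjugate z' \<bullet> (S *\<^sub>v z') = 1"
    unfolding psd_id_step_def Let_def \<rho>_def[symmetric] r_def[symmetric] p_def[symmetric] by blast
  have Kc: "K \<in> carrier_mat n n" using Kh by (simp add: hermitian_mat_def)
  have zy: "z \<in> carrier_vec n \<and> (\<forall>l\<in>{1..n} - set [i..<n+1]. coord z l = 0)"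
  proof -
    have "set [i..<n+1] \<subseteq> {1..n}" using i by auto
    from cspan_u[OF distinct_upt this] zV show ?thesis unfolding colsV by blast
  qed
  hence zc: "z \<in> carrier_vec n" by simp
  define y where "y l = coord z l" for l
  have y0: "y l = 0" if "l \<in> {1..n}" "l < i" for l using zy that by (auto simp: y_def)
  define q where "q = comb (\<lambda>l. of_real (lam l - \<rho>) * y l)"
  have rq: "r = S *\<^sub>v q" unfolding r_def q_def y_def by (rule coord_residual[OF zc])
  have qc: "q \<in> carrier_vec n" by (simp add: q_def)
  have pc: "p \<in> carrier_vec n" unfolding p_def rq using Kc Sc qc by simp
  \<comment> \<open>The numerator equals \<open>lam l - \<rho>\<close>, so \<open>d\<close> is the
    residual divided by the shifted eigenvalues: the direction that the exact inverse would give as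
    preconditioner. Applying \<open>M\<close> to it yields the coordinates of
    \<open>p\<close>.\<close>
  define d where "d l = of_real ((x l - (\<rho> - \<nu>)) / x l) * y l" for l
  define cv where "cv = vec m (\<lambda>a. of_real (lam (i + a) - \<rho>) * y (i + a))"
  define dv where "dv = vec m (\<lambda>a. d (i + a))"
  define Kt where "Kt = compressed_prec S V K"
  define M where "M = Kt * mat_diag m (\<lambda>a. complex_of_real (x (i + a)))"
  have cvc: "cv \<in> carrier_vec m" and dvc: "dv \<in> carrier_vec m" by (simp_all add: cv_def dv_def)
  have Ktp: "pos_def_mat m Kt" using K by (simp add: effectively_pos_def_def dimV Kt_def)
  have Ktc: "Kt \<in> carrier_mat m m" using Ktp by (auto simp: pos_def_mat_def hermitian_mat_def)
  have coord_p: "coord p (i + a) = (Kt *\<^sub>v cv) $ a" if a: "a < m" for a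
    unfolding p_def rq Kt_def
  proof (rule coord_preconditioned[OF Kc i V _ qc])
    show "cv \<in> carrier_vec (n - i + 1)" using cvc by (simp add: m_def)
    fix l assume l: "l \<in> {1..n}"
    show "coord q l = (if l < i then 0 else cv $ (l - i))"
      unfolding q_def coord_comb[OF l] using y0[OF l] l i by (auto simp: cv_def m_def)
  qed (use a in \<open>simp add: m_def\<close>)
  have diag_d: "mat_diag m (\<lambda>a. complex_of_real (x (i + a))) *\<^sub>v dv = cv"
    unfolding mat_diag_mult_vec[OF dvc]
  proof (rule eq_vecI)
    fix a assume "a < dim_vec cv"
    hence a: "a < m" by (simp add: cv_def)
    have "x (i + a) \<noteq> 0" using x_pos[OF idx[OF a]] by simp
    thus "vec m (\<lambda>k. complex_of_real (x (i + k)) * dv $ k) $ a = cv $ a"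
      using a by (simp add: cv_def dv_def d_def x_def)
  qed (simp add: cv_def)
  have Mdv: "M *\<^sub>v dv = Kt *\<^sub>v cv"
    unfolding M_def using assoc_mult_mat_vec[OF Ktc mat_diag_dim dvc] by (simp add: diag_d)
  have M_eq: "compressed_prec S V K * (\<Lambda> - complex_of_real \<nu> \<cdot>\<^sub>m 1\<^sub>m (dim_row \<Lambda>)) = M"
  proof -
    have "\<Lambda> - complex_of_real \<nu> \<cdot>\<^sub>m 1\<^sub>m (dim_row \<Lambda>) = mat_diag m (\<lambda>a. complex_of_real (x (i + a)))"
      unfolding \<Lambda> m_def[symmetric] by (intro eq_matI) (auto simp: mat_diag_def x_def)
    thus ?thesis by (simp add: M_def Kt_def)
  qed
  have m0: "0 < m" by (simp add: m_def)
  have xa: "0 < x (i + a)" if "a < m" for a by (rule x_pos[OF idx[OF that]])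
  have \<epsilon>_eq: "\<epsilon> = (max_eigenvalue M - min_eigenvalue M) / (max_eigenvalue M + min_eigenvalue M)"
    unfolding \<epsilon>_def quality_def Let_def M_eq ..
  note cone = preconditioner_cone[where x = "\<lambda>a. x (i + a)", OF m0 Ktp xa, folded M_def, folded \<epsilon>_eq]
  have \<epsilon>: "0 \<le> \<epsilon>" "\<epsilon> < 1" using cone(1,2) by auto
  from cone(3) dvc obtain \<omega> :: real where cone': "(\<Sum>a<m. x (i + a) * (cmod (dv $ a - of_real \<omega> * (M *\<^sub>v dv) $ a))\<^sup>2)
      \<le> \<epsilon>\<^sup>2 * (\<Sum>a<m. x (i + a) * (cmod (dv $ a))\<^sup>2)" by blast
  \<comment> \<open>Multiplying \<open>p\<close> by the scale \<open>\<omega>\<close> leaves the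
    search space unchanged up to the coefficient of \<open>p\<close>, so the ball condition may be
    stated for the scaled direction.\<close>
  define p' where "p' l = of_real \<omega> * coord p l" for l
  have shift: "(\<Sum>a<m. f (i + a)) = (\<Sum>l\<in>{i..n}. f l)" for f :: "nat \<Rightarrow> 'a :: comm_monoid_add"
    using i by (intro sum.reindex_bij_witness[of _ "\<lambda>l. l - i" "\<lambda>a. i + a"]) (auto simp: m_def)
  have cone_sum: "(\<Sum>l\<in>{i..n}. x l * (cmod (d l - p' l))\<^sup>2) \<le> \<epsilon>\<^sup>2 * (\<Sum>l\<in>{i..n}. x l * (cmod (d l))\<^sup>2)"
    unfolding shift[symmetric] using cone'[unfolded Mdv] coord_p by (simp add: dv_def p'_def)
  have tail: "(\<Sum>l=1..n. f l) = (\<Sum>l\<in>{i..n}. f l)" if "\<And>l. l \<in> {1..n} \<Longrightarrow> l < i \<Longrightarrow> f l = 0" for f :: "nat \<Rightarrow> real"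
    using i that by (intro sum.mono_neutral_right) auto
  have rho_sum: "(\<Sum>l\<in>{i..n}. (x l - (\<rho> - \<nu>)) * (cmod (y l))\<^sup>2) = 0"
    using shifted_sum[OF zc z0, of \<rho>] tail[of "\<lambda>l. (lam l - \<rho>) * (cmod (coord z l))\<^sup>2"] y0
    by (simp add: \<rho>_def[symmetric] y_def x_def)
  have lam_bc: "lam (j+1) \<le> lam n" using mono[of "j+1" n] j by simp
  have \<mu>0: "0 < \<mu>" unfolding \<mu>_def using x_pos[of j] j by simp
  have "\<exists>A C. 0 < A \<and> (\<Sum>l\<in>{i..n}. ((x l - \<mu>) - \<sigma>\<^sup>2 * ((\<rho> - \<nu> - \<mu>) / (b - (\<rho> - \<nu>))) * (b - x l))
            * (cmod (of_real A * y l + of_real C * p' l))\<^sup>2) \<le> 0"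
  proof -
    have \<kappa>': "\<mu> / b * ((c - b) / (c - \<mu>)) = \<kappa>" unfolding \<kappa> \<mu>_def b_def c_def x_def by simp
    show ?thesis
      unfolding \<sigma>_def \<kappa>'[symmetric]
    proof (rule fixed_step_decrease[where d = d])
      show "0 < \<mu>" by (rule \<mu>0)
      show "\<mu> < \<rho> - \<nu>" "\<rho> - \<nu> < b" "b \<le> c" using \<rho>' lam_bc by (simp_all add: \<mu>_def b_def c_def x_def)
      show "x l \<le> \<mu> \<or> b \<le> x l \<and> x l \<le> c" if "l \<in> {i..n}" for l
        using mono[of l j] mono[of "j+1" l] mono[of l n] that i j
        by (cases "l \<le> j") (auto simp: \<mu>_def b_def c_def x_def)
    qed (use \<epsilon> x_pos rho_sum cone_sum in \<open>auto simp: d_def\<close>)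
  qed
  then obtain A C where A: "0 < A" and dec: "(\<Sum>l\<in>{i..n}. ((lam l - lam j) - \<sigma>\<^sup>2 * \<psi> * (lam (j+1) - lam l))
            * (cmod (of_real A * y l + of_real C * p' l))\<^sup>2) \<le> 0"
    by (auto simp: x_def \<mu>_def b_def \<psi>_def)
  \<comment> \<open>The solution of (\<theta> - \<lambda>_j)/(\<lambda>_{j+1} - \<theta>) =
    \<sigma>^2 \<psi>. It is at least \<lambda>_j, hence bounds the deflated eigenvalues, as the
    min-max argument requires.\<close>
  define \<theta> where "\<theta> = (lam j + \<sigma>\<^sup>2 * \<psi> * lam (j+1)) / (1 + \<sigma>\<^sup>2 * \<psi>)"
  \<comment> \<open>The coordinates below \<open>i\<close> are set to zero: \<open>p\<close> may
    have components along \<open>U\<close>, and subtracting them does not leave the search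
    space.\<close>
  define \<xi> where "\<xi> l = (if l < i then 0 else of_real A * y l + of_real (C * \<omega>) * coord p l)" for l
  define x' where "x' = comb \<xi>"
  have \<psi>0: "0 < \<psi>" unfolding \<psi>_def using \<rho>' by simp
  have den: "0 < 1 + \<sigma>\<^sup>2 * \<psi>" using \<psi>0 by (simp add: add_pos_nonneg)
  have x'c: "x' \<in> carrier_vec n" by (simp add: x'_def)
  have cx': "coord x' l = \<xi> l" if "l \<in> {1..n}" for l unfolding x'_def by (rule coord_comb[OF that])
  have le: "(\<Sum>l=1..n. (lam l - \<theta>) * (cmod (coord x' l))\<^sup>2) \<le> 0"
  proof -
    have "(\<Sum>l=1..n. (lam l - \<theta>) * (cmod (coord x' l))\<^sup>2) = (\<Sum>l\<in>{i..n}. (lam l - \<theta>) * (cmod (coord x' l))\<^sup>2)"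
      by (rule tail) (simp add: cx' \<xi>_def)
    hence "(1 + \<sigma>\<^sup>2 * \<psi>) * (\<Sum>l=1..n. (lam l - \<theta>) * (cmod (coord x' l))\<^sup>2)
       = (\<Sum>l\<in>{i..n}. ((1 + \<sigma>\<^sup>2 * \<psi>) * (lam l - \<theta>)) * (cmod (coord x' l))\<^sup>2)"
      by (simp add: sum_distrib_left mult.assoc)
    also have "\<dots> = (\<Sum>l\<in>{i..n}. ((lam l - lam j) - \<sigma>\<^sup>2 * \<psi> * (lam (j+1) - lam l))
            * (cmod (of_real A * y l + of_real C * p' l))\<^sup>2)"
    proof (rule sum.cong[OF refl])
      fix l assume l: "l \<in> {i..n}"
      have "(1 + \<sigma>\<^sup>2 * \<psi>) * \<theta> = lam j + \<sigma>\<^sup>2 * \<psi> * lam (j+1)" unfolding \<theta>_def using den by simp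
      hence "(1 + \<sigma>\<^sup>2 * \<psi>) * (lam l - \<theta>) = (lam l - lam j) - \<sigma>\<^sup>2 * \<psi> * (lam (j+1) - lam l)"
        by (simp add: algebra_simps)
      moreover have "coord x' l = of_real A * y l + of_real C * p' l"
        using cx'[of l] l i by (simp add: \<xi>_def p'_def)
      ultimately show "((1 + \<sigma>\<^sup>2 * \<psi>) * (lam l - \<theta>)) * (cmod (coord x' l))\<^sup>2
        = ((lam l - lam j) - \<sigma>\<^sup>2 * \<psi> * (lam (j+1) - lam l)) * (cmod (of_real A * y l + of_real C * p' l))\<^sup>2" by simp
    qed
    also note dec
    finally show ?thesis using den by (simp add: mult_le_0_iff)
  qed
  \<comment> \<open>If \<open>x'\<close> vanished, the compressed preconditioner would send the
    residual \<open>cv\<close>, up to the factor \<open>C * \<omega>\<close>, to \<open>- A\<close>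
    times \<open>y\<close>. Pairing with \<open>cv\<close> gives a multiple of the shifted Rayleigh
    sum, which is zero, so definiteness of \<open>Kt\<close> forces \<open>C * \<omega> = 0\<close>
    and then \<open>y = 0\<close>. The residual itself is nonzero because \<rho> lies strictly
    inside a gap of the spectrum.\<close>
  have x'0: "x' \<noteq> 0\<^sub>v n"
  proof
    assume "x' = 0\<^sub>v n"
    hence z: "of_real A * y (i + a) + of_real (C * \<omega>) * (Kt *\<^sub>v cv) $ a = 0" if "a < m" for a
      using cx'[of "i + a"] coord_zero[of "i + a"] coord_p[OF that] idx[OF that] i by (auto simp: \<xi>_def)
    have cv0: "cv \<noteq> 0\<^sub>v m"
    proof
      assume cv: "cv = 0\<^sub>v m"
      have "y l = 0" if l: "l \<in> {1..n}" for l
      proof (cases "l < i")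
        case False
        hence "cv $ (l - i) = 0" unfolding cv using l i by (auto simp: m_def)
        moreover have "cv $ (l - i) = of_real (lam l - \<rho>) * y l" using False l i by (auto simp: cv_def m_def)
        moreover have "lam l \<noteq> \<rho>"
          using mono[of l j] mono[of "j+1" l] \<rho>' l j by (cases "l \<le> j") auto
        ultimately show ?thesis by simp
      qed (use y0[OF l] in simp)
      hence "(\<Sum>l=1..n. (cmod (coord z l))\<^sup>2) = 0" by (simp add: y_def)
      thus False using coord_sum_pos[OF zc z0] by simp
    qed
    have "of_real (C * \<omega>) * (conjugate cv \<bullet> (Kt *\<^sub>v cv)) = (\<Sum>a<m. cnj (cv $ a) * (of_real (C * \<omega>) * (Kt *\<^sub>v cv) $ a))"
      using Ktc cvc by (simp add: scalar_prod_def atLeast0LessThan sum_distrib_left mult_ac del: index_mult_mat_vec)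
    also have "\<dots> = (\<Sum>a<m. - of_real (A * ((lam (i + a) - \<rho>) * (cmod (y (i + a)))\<^sup>2)))"
    proof (rule sum.cong[OF refl])
      fix a assume "a \<in> {..<m}"
      hence a: "a < m" by simp
      have "of_real (C * \<omega>) * (Kt *\<^sub>v cv) $ a = - (of_real A * y (i + a))"
        using z[OF a] by (simp add: add_eq_0_iff)
      thus "cnj (cv $ a) * (of_real (C * \<omega>) * (Kt *\<^sub>v cv) $ a) = - of_real (A * ((lam (i + a) - \<rho>) * (cmod (y (i + a)))\<^sup>2))"
        using a by (simp add: cv_def complex_norm_square mult_ac del: of_real_power)
    qed
    also have "\<dots> = - of_real (A * (\<Sum>l\<in>{i..n}. (x l - (\<rho> - \<nu>)) * (cmod (y l))\<^sup>2))"
      unfolding shift[symmetric] by (simp add: sum_negf sum_distrib_left x_def)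
    finally have "of_real (C * \<omega>) * (conjugate cv \<bullet> (Kt *\<^sub>v cv)) = 0" unfolding rho_sum by simp
    moreover have "conjugate cv \<bullet> (Kt *\<^sub>v cv) \<noteq> 0"
      using pos_def_inner_pos[OF Ktp cvc cv0] by auto
    ultimately have C\<omega>: "complex_of_real (C * \<omega>) = 0" by simp
    have "y (i + a) = 0" if "a < m" for a using z[OF that, unfolded C\<omega>] A by simp
    hence "cv = 0\<^sub>v m" by (intro eq_vecI) (auto simp: cv_def)
    with cv0 show False by simp
  qed
  let ?vs = "map u [1..<i] @ [z, p]"
  have vs: "set ?vs \<subseteq> carrier_vec n" using u_carrier zc pc i by auto
  have set_vs: "set (cols U) \<union> {z, p} = set ?vs" unfolding colsU by auto
  have x'Y: "x' \<in> cspan n (set (cols U) \<union> {z, p})"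
    unfolding set_vs cspan_list[OF vs]
  proof
    \<comment> \<open>Coefficients with respect to the columns of \<open>U\<close>, then
      \<open>z\<close>, then \<open>p\<close>; the first \<open>i - 1\<close> cancel the components
      of \<open>p\<close> along \<open>U\<close>.\<close>
    define e where "e = vec (i + 1) (\<lambda>k. if k < i - 1 then - of_real (C * \<omega>) * coord p (Suc k)
      else if k = i - 1 then of_real A else of_real (C * \<omega>))"
    have len: "length ?vs = i + 1" using i by simp
    have Wc: "mat_of_cols n ?vs \<in> carrier_mat n (i + 1)" using mat_of_cols_carrier(1)[of n ?vs] len by metis
    have ec: "e \<in> carrier_vec (i + 1)" by (simp add: e_def)
    show "e \<in> carrier_vec (length ?vs)" unfolding len by (rule ec)
    show "x' = mat_of_cols n ?vs *\<^sub>v e"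
    proof (rule coord_eqI[OF x'c])
      show "mat_of_cols n ?vs *\<^sub>v e \<in> carrier_vec n" by (rule mult_mat_vec_carrier[OF Wc ec])
      fix l assume l: "l \<in> {1..n}"
      obtain i0 where i0: "i = Suc i0" using i by (cases i) auto
      have col: "col (mat_of_cols n ?vs) k = ?vs ! k" if "k < i + 1" for k
        using that unfolding len[symmetric] by (intro col_mat_of_cols subsetD[OF vs] nth_mem)
      have "coord (mat_of_cols n ?vs *\<^sub>v e) l = (\<Sum>k<i0 + 2. e $ k * coord (?vs ! k) l)"
        unfolding coord_mat_vec[OF Wc ec l] using i0 col by (intro sum.cong) auto
      also have "\<dots> = (\<Sum>k<i0. e $ k * coord (?vs ! k) l) + e $ i0 * coord z l + e $ Suc i0 * coord p l"
        by (simp add: nth_append i0 del: upt_Suc)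
      also have "(\<Sum>k<i0. e $ k * coord (?vs ! k) l) = (\<Sum>k<i0. if l - 1 = k then - of_real (C * \<omega>) * coord p l else 0)"
      proof (rule sum.cong[OF refl])
        fix k assume "k \<in> {..<i0}"
        hence k: "k < i0" by simp
        have "?vs ! k = u (Suc k)" using k by (simp add: nth_append i0 del: upt_Suc)
        thus "e $ k * coord (?vs ! k) l = (if l - 1 = k then - of_real (C * \<omega>) * coord p l else 0)"
          using k l i by (auto simp: e_def i0 coord_u)
      qed
      also have "\<dots> = (if l < i then - of_real (C * \<omega>) * coord p l else 0)"
        using l by (auto simp: i0)
      finally show "coord x' l = coord (mat_of_cols n ?vs *\<^sub>v e) l"
        unfolding cx'[OF l] using y0[OF l] by (auto simp: \<xi>_def e_def i0 y_def)
    qed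
  qed
  have \<theta>j: "lam j \<le> \<theta>" and \<theta>b: "\<theta> < lam (j+1)"
  proof -
    have "lam j * (1 + \<sigma>\<^sup>2 * \<psi>) \<le> lam j + \<sigma>\<^sup>2 * \<psi> * lam (j+1)"
      using \<rho>' \<psi>0 mult_left_mono[of "lam j" "lam (j+1)" "\<sigma>\<^sup>2 * \<psi>"] by (simp add: algebra_simps)
    thus "lam j \<le> \<theta>" unfolding \<theta>_def using den by (simp add: pos_le_divide_eq)
    have "lam j + \<sigma>\<^sup>2 * \<psi> * lam (j+1) < lam (j+1) * (1 + \<sigma>\<^sup>2 * \<psi>)"
      using \<rho>' by (simp add: algebra_simps)
    thus "\<theta> < lam (j+1)" unfolding \<theta>_def using den by (simp add: pos_divide_less_eq)
  qed
  have "ts ! (i - 1) \<le> \<theta>"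
  proof (rule ritz_value_le[OF W ts i _ x'Y x'c x'0 _ _ le])
    fix l assume l: "1 \<le> l" "l < i"
    show "u l \<in> cspan n (set (cols U) \<union> {z, p})"
    proof -
      interpret vec_space "TYPE(complex)" n .
      show ?thesis unfolding set_vs by (rule subsetD[OF in_own_span[OF vs]]) (use l in auto)
    qed
    show "coord x' l = 0" using cx'[of l] l i by (simp add: \<xi>_def)
    show "lam l \<le> \<theta>" using mono[of l j] l i j \<theta>j by simp
  qed
  moreover have "rayleigh H S z' = ts ! (i - 1)"
    using ritz_vector_rayleigh[OF _ z'] W by (simp add: dimU basis_matrix_def)
  ultimately have t: "rayleigh H S z' \<le> \<theta>" by simp
  \<comment> \<open>The map t to (t - \<lambda>_j)/(\<lambda>_{j+1} - t) increases on all t below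
    \<lambda>_{j+1}, so the argument also covers a new Rayleigh quotient below \<lambda>_j.\<close>
  have "(rayleigh H S z' - lam j) / (lam (j+1) - rayleigh H S z') \<le> (\<theta> - lam j) / (lam (j+1) - \<theta>)"
  proof -
    have "0 \<le> (lam (j+1) - lam j) * (\<theta> - rayleigh H S z')" using t \<rho>' by simp
    hence "(rayleigh H S z' - lam j) * (lam (j+1) - \<theta>) \<le> (\<theta> - lam j) * (lam (j+1) - rayleigh H S z')"
      by (simp add: algebra_simps)
    thus ?thesis using t \<theta>b by (simp add: divide_le_eq le_divide_eq)
  qed
  also have "\<dots> = \<sigma>\<^sup>2 * \<psi>"
  proof -
    have "\<theta> * (1 + \<sigma>\<^sup>2 * \<psi>) = lam j + \<sigma>\<^sup>2 * \<psi> * lam (j+1)" unfolding \<theta>_def using den by simp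
    hence "\<theta> - lam j = \<sigma>\<^sup>2 * \<psi> * (lam (j+1) - \<theta>)" by (simp add: algebra_simps)
    thus ?thesis using \<theta>b by simp
  qed
  finally show ?thesis by (simp add: \<psi>_def \<rho>_def)
qed

end

section \<open>Existence of PSD-id steps\<close>

text \<open>\<open>pair_diagonalization\<close> promises no order of the eigenvalues, but a list of
  Ritz values must be sorted. In size 2 exchanging the columns suffices.\<close>

lemma sorted_pair_eigenvectors_2:
  assumes A: "hermitian_mat 2 A" and B: "pos_def_mat 2 B"
  obtains G f where "G \<in> carrier_mat 2 2" "mat_adjoint G * B * G = 1\<^sub>m 2"
    "mat_adjoint G * A * G = mat_diag 2 (\<lambda>k. complex_of_real (f k))" "f 0 \<le> f 1"
proof -
  obtain G f where G: "G \<in> carrier_mat 2 2" and GB: "mat_adjoint G * B * G = 1\<^sub>m 2"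
    and GA: "mat_adjoint G * A * G = mat_diag 2 (\<lambda>k. complex_of_real (f k))"
    using pair_diagonalization[OF A B] by metis
  have Ac: "A \<in> carrier_mat 2 2" and Bc: "B \<in> carrier_mat 2 2"
    using A B by (auto simp: pos_def_mat_def hermitian_mat_def)
  show ?thesis
  proof (cases "f 0 \<le> f 1")
    case True
    with G GB GA show ?thesis by (rule that)
  next
    case False
    define G' where "G' = mat 2 2 (\<lambda>(i, j). G $$ (i, 1 - j))"
    have G': "G' \<in> carrier_mat 2 2" by (simp add: G'_def)
    have col: "col G' j = col G (1 - j)" if "j < 2" for j
      using that G by (intro eq_vecI) (auto simp: G'_def)
    have idx: "(mat_adjoint G' * M * G') $$ (i, j) = (mat_adjoint G * M * G) $$ (1 - i, 1 - j)"
      if "M \<in> carrier_mat 2 2" "i < 2" "j < 2" for M i j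
      using that congruence_index[OF that(1) G'] congruence_index[OF that(1) G] by (simp add: col)
    show ?thesis
    proof (rule that[OF G'])
      show "mat_adjoint G' * B * G' = 1\<^sub>m 2"
        using G' idx[OF Bc] unfolding GB by (intro eq_matI) (auto simp: less_2_cases_iff simp del: index_mult_mat(1))
      show "mat_adjoint G' * A * G' = mat_diag 2 (\<lambda>k. complex_of_real (f (1 - k)))"
        using G' idx[OF Ac] unfolding GA
        by (intro eq_matI) (auto simp: less_2_cases_iff mat_diag_def simp del: index_mult_mat(1))
      show "f (1 - 0) \<le> f (1 - 1)" using False by simp
    qed
  qed
qed

lemma cspan_cols_mult_invertible:
  assumes Y: "Y \<in> carrier_mat n k" and G: "G \<in> carrier_mat k k" and L: "L \<in> carrier_mat k k" "G * L = 1\<^sub>m k"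
  shows "cspan n (set (cols (Y * G))) = cspan n (set (cols Y))"
proof -
  have span: "x \<in> cspan n (set (cols W)) \<longleftrightarrow> (\<exists>c\<in>carrier_vec k. x = W *\<^sub>v c)" if W: "W \<in> carrier_mat n k" for W x
  proof -
    have "set (cols W) \<subseteq> carrier_vec n" using W by (metis cols_dim carrier_matD(1))
    moreover have "mat_of_cols n (cols W) = W" using W by (metis mat_of_cols_cols carrier_matD(1))
    ultimately show ?thesis using cspan_list[of "cols W" n x] W by simp
  qed
  have YG: "Y * G \<in> carrier_mat n k" by (rule mult_carrier_mat[OF Y G])
  have "(\<exists>c\<in>carrier_vec k. x = (Y * G) *\<^sub>v c) \<longleftrightarrow> (\<exists>c\<in>carrier_vec k. x = Y *\<^sub>v c)" for x
  proof
    assume "\<exists>c\<in>carrier_vec k. x = (Y * G) *\<^sub>v c"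
    then obtain c where c: "c \<in> carrier_vec k" "x = (Y * G) *\<^sub>v c" by blast
    have "x = Y *\<^sub>v (G *\<^sub>v c)" unfolding c(2) by (rule assoc_mult_mat_vec[OF Y G c(1)])
    moreover have "G *\<^sub>v c \<in> carrier_vec k" using G c by simp
    ultimately show "\<exists>c\<in>carrier_vec k. x = Y *\<^sub>v c" by blast
  next
    assume "\<exists>c\<in>carrier_vec k. x = Y *\<^sub>v c"
    then obtain c where c: "c \<in> carrier_vec k" "x = Y *\<^sub>v c" by blast
    have Lc: "L *\<^sub>v c \<in> carrier_vec k" using L c by simp
    have "(Y * G) *\<^sub>v (L *\<^sub>v c) = Y *\<^sub>v (G *\<^sub>v (L *\<^sub>v c))" by (rule assoc_mult_mat_vec[OF Y G Lc])
    also have "G *\<^sub>v (L *\<^sub>v c) = c" using assoc_mult_mat_vec[OF G L(1) c(1)] L(2) c(1) by simp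
    finally show "\<exists>c\<in>carrier_vec k. x = (Y * G) *\<^sub>v c" using Lc c(2) by metis
  qed
  thus ?thesis using span[OF Y] span[OF YG] by blast
qed

lemma cspan_Un_cong:
  assumes "A \<subseteq> carrier_vec n" "B \<subseteq> carrier_vec n" "C \<subseteq> carrier_vec n" "cspan n A = cspan n B"
  shows "cspan n (C \<union> A) = cspan n (C \<union> B)"
proof -
  interpret vec_space "TYPE(complex)" n .
  have "span (C \<union> A) \<subseteq> span (C \<union> B)" if "A \<subseteq> carrier_vec n" "B \<subseteq> carrier_vec n" "span A = span B" for A B
  proof (rule span_subsetI)
    show "C \<union> B \<subseteq> carrier_vec n" using that assms by auto
    have "A \<subseteq> span (C \<union> B)"
      using in_own_span[OF that(1)] span_is_monotone[of B "C \<union> B"] that(3) by auto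
    moreover have "C \<union> B \<subseteq> span (C \<union> B)" using that assms by (intro in_own_span) auto
    ultimately show "C \<union> A \<subseteq> span (C \<union> B)" by auto
  qed
  with assms show ?thesis by (metis subset_antisym)
qed

text \<open>Pairing a vanishing combination with \<open>S\<close> times one of its vectors isolates
  the coefficient of that vector.\<close>

lemma orthonormal_basis_matrix:
  assumes Sh: "hermitian_mat n S" and W: "W \<in> carrier_mat n k" and WS: "mat_adjoint W * S * W = 1\<^sub>m k"
  shows "basis_matrix n (cspan n (set (cols W))) W"
proof -
  have Sc: "S \<in> carrier_mat n n" using Sh by (simp add: hermitian_mat_def)
  have ip: "conjugate (col W p) \<bullet> (S *\<^sub>v col W q) = (if p = q then 1 else 0)" if "p < k" "q < k" for p q
    using congruence_index[OF Sc W that] that unfolding WS by simp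
  interpret vec_space "TYPE(complex)" n .
  have len: "length (cols W) = k" and nth: "\<And>q. q < k \<Longrightarrow> cols W ! q = col W q" using W by auto
  have dist: "distinct (cols W)"
    unfolding distinct_conv_nth len
  proof (intro allI impI)
    fix p q assume pq: "p < k" "q < k" "p \<noteq> q"
    thus "cols W ! p \<noteq> cols W ! q" using ip[of p p] ip[of p q] by (auto simp: nth simp del: cols_nth)
  qed
  have "\<not> lin_dep (set (cols W))"
  proof
    assume "lin_dep (set (cols W))"
    then obtain A f v where A: "finite A" "A \<subseteq> set (cols W)" and z: "lincomb f A = 0\<^sub>v n"
      and v: "v \<in> A" "f v \<noteq> 0" unfolding lin_dep_def by auto
    have Ac: "A \<subseteq> carrier_vec n" using A W by (metis cols_dim carrier_matD(1) subset_trans)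
    define w where "w = conjugate (S *\<^sub>v v)"
    have vc: "v \<in> carrier_vec n" using v Ac by auto
    have wc: "w \<in> carrier_vec n" using Sc vc by (simp add: w_def)
    have colA: "\<exists>p<k. a = col W p" if "a \<in> A" for a
    proof -
      have "a \<in> set (cols W)" using A(2) that by blast
      then obtain p where "p < length (cols W)" "cols W ! p = a" unfolding in_set_conv_nth by blast
      thus ?thesis unfolding len using nth by blast
    qed
    have aw: "a \<bullet> w = (if a = v then 1 else 0)" if aA: "a \<in> A" for a
    proof -
      have ac: "a \<in> carrier_vec n" using aA Ac by auto
      obtain p where p: "p < k" "a = col W p" using colA[OF aA] by blast
      obtain q where q: "q < k" "v = col W q" using colA[OF v(1)] by blast
      have "a \<bullet> w = conjugate (S *\<^sub>v v) \<bullet> a"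
        unfolding w_def using ac vc Sc by (intro comm_scalar_prod[of _ n]) auto
      also have "\<dots> = conjugate v \<bullet> (S *\<^sub>v a)"
        using inner_mat_adjoint[OF Sc vc ac] Sh by (simp add: hermitian_mat_def)
      also have "\<dots> = (if q = p then 1 else 0)" unfolding p(2) q(2) by (rule ip[OF q(1) p(1)])
      also have "\<dots> = (if a = v then 1 else 0)"
        unfolding p(2) q(2) using nth_eq_iff_index_eq[OF dist, of p q, unfolded len, OF p(1) q(1)]
          nth[OF p(1)] nth[OF q(1)] by auto
      finally show ?thesis .
    qed
    have "lincomb f A \<bullet> w = (\<Sum>a\<in>A. (f a \<cdot>\<^sub>v a) \<bullet> w)"
      unfolding lincomb_def using Ac wc by (intro finsum_scalar_prod_sum) auto
    also have "\<dots> = (\<Sum>a\<in>A. if a = v then f a else 0)"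
    proof (rule sum.cong[OF refl])
      fix a assume a: "a \<in> A"
      hence "a \<in> carrier_vec n" using Ac by auto
      thus "(f a \<cdot>\<^sub>v a) \<bullet> w = (if a = v then f a else 0)" using aw[OF a] wc by simp
    qed
    also have "\<dots> = f v" using A v by simp
    finally show False using v wc unfolding z by simp
  qed
  thus ?thesis using W dist by (simp add: basis_matrix_def)
qed

context pencil_eigenbasis
begin

lemma orthonormal_ritz_vector:
  assumes W: "W \<in> carrier_mat n k" and WS: "mat_adjoint W * S * W = 1\<^sub>m k"
    and WH: "mat_adjoint W * H * W = mat_diag k (\<lambda>q. complex_of_real (f q))" and q: "q < k"
  shows "ritz_vector H S W (f q) (col W q)"
  unfolding ritz_vector_def
proof (intro exI conjI)
  show "col W q = W *\<^sub>v unit_vec k q" using W q by (intro eq_vecI) (auto simp: scalar_prod_right_unit)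
  show "pair_eigenvector (mat_adjoint W * H * W) (mat_adjoint W * S * W) (f q) (unit_vec k q)"
    unfolding pair_eigenvector_def WS WH mat_diag_mult_vec[OF unit_vec_carrier]
  proof (intro conjI)
    have "unit_vec k q $ q \<noteq> (0 :: complex)" using q by simp
    thus "unit_vec k q \<noteq> (0\<^sub>v (dim_col (mat_diag k (\<lambda>q. complex_of_real (f q)))) :: complex vec)"
      using q by (metis carrier_matD(2) index_zero_vec(1) mat_diag_dim)
    show "vec k (\<lambda>p. complex_of_real (f p) * unit_vec k q $ p) = complex_of_real (f q) \<cdot>\<^sub>v (1\<^sub>m k *\<^sub>v unit_vec k q)"
      using q by (intro eq_vecI) auto
  qed (simp add: mat_diag_def)
qed

lemma orthonormal_ritz_values:
  assumes W: "W \<in> carrier_mat n k" and WS: "mat_adjoint W * S * W = 1\<^sub>m k"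
    and WH: "mat_adjoint W * H * W = mat_diag k (\<lambda>q. complex_of_real (f q))"
    and sorted: "sorted (map f [0..<k])"
  shows "ritz_values H S W (map f [0..<k])"
  unfolding ritz_values_def pair_eigenvalues_def WS WH
proof
  have one: "mat_adjoint (1\<^sub>m k) = (1\<^sub>m k :: complex mat)" by (intro eq_matI) auto
  show "det (map_mat (\<lambda>b. [:0, b:]) (1\<^sub>m k) - map_mat (\<lambda>a. [:a:]) (mat_diag k (\<lambda>q. complex_of_real (f q)))) =
    smult (det (1\<^sub>m k)) (\<Prod>t\<leftarrow>map f [0..<k]. [:- complex_of_real t, 1:])"
    by (rule det_pencil_of_diagonalization[OF mat_diag_dim one_carrier_mat one_carrier_mat])
      (simp_all add: one left_mult_one_mat[OF mat_diag_dim] right_mult_one_mat[OF mat_diag_dim])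
qed (rule sorted)

text \<open>Sharpness needs an actual step. Rayleigh-Ritz in the plane of \<open>z\<close> and
  \<open>p\<close> gives \<open>w 0\<close> and \<open>w 1\<close>; together with the deflated
  eigenvectors they form an S-orthonormal basis of the search space in which \<open>H\<close> is
  diagonal. The Rayleigh quotient is kept in the conclusion to ensure that the new one stays below
  the upper end of the gap.\<close>

lemma psd_id_step_exists:
  assumes mono: "\<And>l m. 1 \<le> l \<Longrightarrow> l \<le> m \<Longrightarrow> m \<le> n \<Longrightarrow> lam l \<le> lam m"
    and i: "1 \<le> i" "i \<le> n"
    and U: "U = mat_of_cols n (map u [1..<i])" and V: "V = mat_of_cols n (map u [i..<n+1])"
    and K: "hermitian_mat n K" and z: "z \<in> carrier_vec n"
    and p: "p = K *\<^sub>v (H *\<^sub>v z - complex_of_real (rayleigh H S z) \<cdot>\<^sub>v (S *\<^sub>v z))"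
    and z0: "\<And>l. 1 \<le> l \<Longrightarrow> l < i \<Longrightarrow> coord z l = 0" and p0: "\<And>l. 1 \<le> l \<Longrightarrow> l < i \<Longrightarrow> coord p l = 0"
    and indep: "\<And>a b. a \<cdot>\<^sub>v z + b \<cdot>\<^sub>v p = 0\<^sub>v n \<Longrightarrow> a = 0 \<and> b = 0"
  shows "\<exists>a b. psd_id_step n H S U V K z (a \<cdot>\<^sub>v z + b \<cdot>\<^sub>v p) \<and> a \<cdot>\<^sub>v z + b \<cdot>\<^sub>v p \<noteq> 0\<^sub>v n \<and>
    rayleigh H S (a \<cdot>\<^sub>v z + b \<cdot>\<^sub>v p) \<le> rayleigh H S z"
proof -
  define \<rho> where "\<rho> = rayleigh H S z"
  obtain i0 where i0: "i = Suc i0" using i by (cases i) auto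
  have pc: "p \<in> carrier_vec n" unfolding p using K Hc Sc z by (auto simp: hermitian_mat_def)
  define Y where "Y = mat_of_cols n [z, p]"
  have Y: "Y \<in> carrier_mat n 2" using mat_of_cols_carrier(1)[of n "[z, p]"] by (simp add: Y_def numeral_2_eq_2)
  have Yc: "Y *\<^sub>v c = c $ 0 \<cdot>\<^sub>v z + c $ 1 \<cdot>\<^sub>v p" if "c \<in> carrier_vec 2" for c
    using that z pc by (intro eq_vecI) (auto simp: Y_def scalar_prod_def mat_of_cols_def numeral_2_eq_2 mult.commute)
  have Yinj: "c = 0\<^sub>v 2" if c: "c \<in> carrier_vec 2" and "Y *\<^sub>v c = 0\<^sub>v n" for c
    using that indep[of "c $ 0" "c $ 1"] unfolding Yc[OF c] by (intro eq_vecI) (auto simp: less_2_cases_iff)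
  obtain G f where G: "G \<in> carrier_mat 2 2"
    and GB: "mat_adjoint G * (mat_adjoint Y * S * Y) * G = 1\<^sub>m 2"
    and GA: "mat_adjoint G * (mat_adjoint Y * H * Y) * G = mat_diag 2 (\<lambda>k. complex_of_real (f k))"
    and f01: "f 0 \<le> f 1"
    using sorted_pair_eigenvectors_2[OF hermitian_congruence[OF H Y] pos_def_congruence[OF S Y Yinj]] by metis
  have YG: "Y * G \<in> carrier_mat n 2" by (rule mult_carrier_mat[OF Y G])
  have HYc: "mat_adjoint Y * H * Y \<in> carrier_mat 2 2" and SYc: "mat_adjoint Y * S * Y \<in> carrier_mat 2 2"
    using hermitian_congruence[OF H Y] hermitian_congruence[OF Sh Y] by (auto simp: hermitian_mat_def)
  define w where "w q = Y *\<^sub>v col G q" for q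
  have wc: "w q \<in> carrier_vec n" if "q < 2" for q using that Y G by (simp add: w_def)
  have wS: "conjugate (w q) \<bullet> (S *\<^sub>v w q') = (if q = q' then 1 else 0)"
    and wH: "conjugate (w q) \<bullet> (H *\<^sub>v w q') = (if q = q' then of_real (f q) else 0)" if "q < 2" "q' < 2" for q q'
  proof -
    have c: "col G q \<in> carrier_vec 2" "col G q' \<in> carrier_vec 2" using G that by auto
    show "conjugate (w q) \<bullet> (S *\<^sub>v w q') = (if q = q' then 1 else 0)"
      unfolding w_def inner_congruence[OF Sc Y c, symmetric] congruence_index[OF SYc G that, symmetric] GB
      using that by simp
    show "conjugate (w q) \<bullet> (H *\<^sub>v w q') = (if q = q' then of_real (f q) else 0)"
      unfolding w_def inner_congruence[OF Hc Y c, symmetric] congruence_index[OF HYc G that, symmetric] GA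
      using that by (simp add: mat_diag_def)
  qed
  have w_lin: "w q = (G $$ (0, q)) \<cdot>\<^sub>v z + (G $$ (1, q)) \<cdot>\<^sub>v p" if "q < 2" for q
    unfolding w_def using that G by (subst Yc) auto
  have cw: "coord (w q) l = G $$ (0, q) * coord z l + G $$ (1, q) * coord p l" if "q < 2" "l \<in> {1..n}" for q l
    unfolding w_lin[OF that(1)] using z pc that by (simp add: coord_add coord_smult)
  have w_lo: "coord (w q) l = 0" if "q < 2" "1 \<le> l" "l < i" for q l
    using cw[of q l] z0[of l] p0[of l] that i by simp
  have wne: "w q \<noteq> 0\<^sub>v n" if "q < 2" for q
    using wS[OF that that] Sc by auto
  have ray: "rayleigh H S (w q) = f q" if "q < 2" for q
    using wS[OF that that] wH[OF that that] by (simp add: rayleigh_def)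
  \<comment> \<open>Vectors without coordinates below \<open>i\<close> have Rayleigh quotient at
    least \<open>lam i\<close>. Hence in the sorted list of Ritz values the deflated ones may come
    first, and \<open>w 0\<close> belongs to position \<open>i - 1\<close> counted from 0.\<close>
  have f_ge: "lam i \<le> f q" if "q < 2" for q
  proof -
    have "0 \<le> (\<Sum>l=1..n. (lam l - lam i) * (cmod (coord (w q) l))\<^sup>2)"
    proof (rule sum_nonneg)
      fix l assume l: "l \<in> {1..n}"
      show "0 \<le> (lam l - lam i) * (cmod (coord (w q) l))\<^sup>2"
        using w_lo[OF that, of l] mono[of i l] l i by (cases "l < i") auto
    qed
    thus ?thesis
      using shifted_sum[OF wc[OF that] wne[OF that], of "lam i"] coord_sum_pos[OF wc[OF that] wne[OF that]]
      unfolding ray[OF that] by (simp add: zero_le_mult_iff)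
  qed
  let ?ws = "map u [1..<i] @ [w 0, w 1]"
  define W where "W = mat_of_cols n ?ws"
  define k where "k = i0 + 2"
  have len: "length ?ws = k" by (simp add: k_def i0)
  have W: "W \<in> carrier_mat n k" unfolding W_def using mat_of_cols_carrier(1)[of n ?ws] len by metis
  have ws: "set ?ws \<subseteq> carrier_vec n" using u_carrier wc i by auto
  define wk where "wk q = (if q < i0 then u (Suc q) else w (q - i0))" for q
  define fk where "fk q = (if q < i0 then lam (Suc q) else f (q - i0))" for q
  have colW: "col W q = wk q" if q: "q < k" for q
  proof -
    have "col W q = ?ws ! q" unfolding W_def
      using q unfolding len[symmetric] by (intro col_mat_of_cols subsetD[OF ws] nth_mem)
    moreover have "?ws ! q = wk q"
    proof (cases "q < i0")
      case True
      thus ?thesis by (simp add: wk_def nth_append i0 del: upt_Suc)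
    next
      case False
      hence "q = i0 \<or> q = Suc i0" using q by (auto simp: k_def)
      thus ?thesis by (auto simp: wk_def nth_append i0 simp del: upt_Suc)
    qed
    ultimately show ?thesis by simp
  qed
  have wkS: "conjugate (wk q) \<bullet> (S *\<^sub>v wk q') = (if q = q' then 1 else 0)"
    and wkH: "conjugate (wk q) \<bullet> (H *\<^sub>v wk q') = (if q = q' then of_real (fk q) else 0)"
    if q: "q < k" and q': "q' < k" for q q'
  proof -
    have lo: "coord (w (q - i0)) (Suc p) = 0" if "\<not> q < i0" "q < k" "p < i0" for q p
      using w_lo[of "q - i0" "Suc p"] that by (simp add: k_def i0)
    have uw: "conjugate (u (Suc p)) \<bullet> (S *\<^sub>v w (q - i0)) = 0" "conjugate (u (Suc p)) \<bullet> (H *\<^sub>v w (q - i0)) = 0"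
      if "\<not> q < i0" "q < k" "p < i0" for q p
      using lo[OF that] inner_u_H[of "Suc p" "w (q - i0)"] wc[of "q - i0"] that i
      by (auto simp: coord_def k_def i0)
    have wu: "conjugate (w (q - i0)) \<bullet> (S *\<^sub>v u (Suc p)) = 0" "conjugate (w (q - i0)) \<bullet> (H *\<^sub>v u (Suc p)) = 0"
      if "\<not> q < i0" "q < k" "p < i0" for q p
      using uw[OF that] inner_hermitian[OF Sh wc u_carrier, of "q - i0" "Suc p"]
        inner_hermitian[OF H wc u_carrier, of "q - i0" "Suc p"] that i by (auto simp: k_def i0)
    have uu: "conjugate (u (Suc p)) \<bullet> (H *\<^sub>v u (Suc q)) = (if p = q then of_real (lam (Suc p)) else 0)"
      if "p < i0" "q < i0" for p q
      using inner_u_H[of "Suc p" "u (Suc q)"] coord_u[of "Suc p" "Suc q"] u_carrier[of "Suc q"] that i by (simp add: i0)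
    show "conjugate (wk q) \<bullet> (S *\<^sub>v wk q') = (if q = q' then 1 else 0)"
      using q q' i uw[of q' q] wu[of q q'] wS[of "q - i0" "q' - i0"] u_orthonormal[of "Suc q" "Suc q'"]
      by (cases "q < i0"; cases "q' < i0") (auto simp: wk_def k_def i0)
    show "conjugate (wk q) \<bullet> (H *\<^sub>v wk q') = (if q = q' then of_real (fk q) else 0)"
      using q q' i uw[of q' q] wu[of q q'] wH[of "q - i0" "q' - i0"] uu[of q q']
      by (cases "q < i0"; cases "q' < i0") (auto simp: wk_def fk_def k_def i0)
  qed
  have WS: "mat_adjoint W * S * W = 1\<^sub>m k"
    using W by (intro eq_matI) (auto simp: congruence_index[OF Sc W] colW wkS simp del: index_mult_mat(1))
  have WH: "mat_adjoint W * H * W = mat_diag k (\<lambda>q. complex_of_real (fk q))"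
    using W by (intro eq_matI) (auto simp: congruence_index[OF Hc W] colW wkH mat_diag_def simp del: index_mult_mat(1))
  have srt: "sorted (map fk [0..<k])"
    unfolding sorted_iff_nth_mono
  proof (intro allI impI)
    fix q q' assume "q \<le> q'" "q' < length (map fk [0..<k])"
    hence qq: "q \<le> q'" "q' < k" by auto
    have "fk q \<le> fk q'"
    proof (cases "q' < i0")
      case True
      thus ?thesis using qq mono[of "Suc q" "Suc q'"] i by (simp add: fk_def i0)
    next
      case False
      hence q': "fk q' = f (q' - i0)" "q' - i0 < 2" using qq by (auto simp: fk_def k_def)
      show ?thesis
      proof (cases "q < i0")
        case True
        hence "fk q = lam (Suc q)" by (simp add: fk_def)
        also have "\<dots> \<le> lam i" using mono[of "Suc q" i] True i by (simp add: i0)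
        finally show ?thesis using f_ge[OF q'(2)] q' by simp
      next
        case False
        hence "q' - i0 = q - i0 \<or> (q - i0 = 0 \<and> q' - i0 = 1)" using q'(2) qq by auto
        thus ?thesis using False q' f01 by (auto simp: fk_def)
      qed
    qed
    thus "map fk [0..<k] ! q \<le> map fk [0..<k] ! q'" using qq by simp
  qed
  have lenU: "length (map u [1..<i]) = i - 1" by simp
  have dimU: "dim_col U = i - 1" unfolding U by (simp only: mat_of_cols_carrier lenU)
  have usub: "set (map u [1..<i]) \<subseteq> carrier_vec n" using u_carrier i by (auto simp del: upt_Suc)
  have colU: "col U l = wk l" if "l < dim_col U" for l
  proof -
    have l: "l < i - 1" using that unfolding dimU .
    have "col U l = map u [1..<i] ! l" unfolding U
      using l unfolding lenU[symmetric] by (intro col_mat_of_cols subsetD[OF usub] nth_mem)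
    thus ?thesis using l by (simp add: wk_def i0 del: upt_Suc)
  qed
  have colsU: "set (cols U) = set (map u [1..<i])" unfolding U using usub by (simp del: upt_Suc)
  have colsW: "set (cols W) = set (cols U) \<union> {w 0, w 1}"
    unfolding W_def colsU using ws by (simp del: upt_Suc)
  have spanW: "cspan n (set (cols W)) = cspan n (set (cols U) \<union> {z, p})"
    unfolding colsW
  proof (rule cspan_Un_cong)
    have L: "mat_adjoint G * (mat_adjoint Y * S * Y) \<in> carrier_mat 2 2"
      by (rule mult_carrier_mat[OF mat_adjoint_carrier[OF G] SYc])
    have "cspan n (set (cols (Y * G))) = cspan n (set (cols Y))"
      by (rule cspan_cols_mult_invertible[OF Y G L mat_mult_left_right_inverse[OF L G GB]])
    moreover have "set (cols Y) = {z, p}" unfolding Y_def using z pc by simp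
    moreover have "set (cols (Y * G)) = {w 0, w 1}"
    proof -
      have "cols (Y * G) = map w [0..<2]"
        using YG G Y by (intro nth_equalityI) (auto simp: w_def col_mult2[OF Y G])
      thus ?thesis by (simp add: numeral_2_eq_2)
    qed
    ultimately show "cspan n {w 0, w 1} = cspan n {z, p}" by simp
  qed (use wc z pc usub colsU in auto)
  have zV: "z \<in> cspan n (set (cols V))"
  proof -
    have sub: "set [i..<n+1] \<subseteq> {1..n}" using i by auto
    have "set (map u [i..<n+1]) \<subseteq> carrier_vec n" using u_carrier sub by (auto simp del: upt_Suc)
    hence "set (cols V) = u ` set [i..<n+1]" unfolding V by (simp del: upt_Suc)
    thus ?thesis using cspan_u[OF distinct_upt sub, of z] z z0 by auto
  qed
  have zne: "z \<noteq> 0\<^sub>v n"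
  proof
    assume "z = 0\<^sub>v n"
    hence "1 \<cdot>\<^sub>v z + 0 \<cdot>\<^sub>v p = 0\<^sub>v n" using pc by auto
    from indep[OF this] show False by simp
  qed
  have step: "psd_id_step n H S U V K z (w 0)"
    unfolding psd_id_step_def Let_def p[symmetric]
  proof (intro conjI K zV zne exI allI impI)
    show "basis_matrix n (cspan n (set (cols U) \<union> {z, p})) W"
      using orthonormal_basis_matrix[OF Sh W WS] unfolding spanW .
    show "ritz_values H S W (map fk [0..<k])" by (rule orthonormal_ritz_values[OF W WS WH srt])
    show "ritz_vector H S W (map fk [0..<k] ! dim_col U) (w 0)"
      using orthonormal_ritz_vector[OF W WS WH, of i0] colW[of i0]
      by (simp add: dimU i0 k_def wk_def del: upt_Suc)
    show "conjugate (w 0) \<bullet> (S *\<^sub>v w 0) = 1" using wS[of 0 0] by simp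
    fix l assume l: "l < dim_col U"
    hence lk: "l < i0" "l < k" by (auto simp: dimU i0 k_def)
    show "ritz_vector H S W (map fk [0..<k] ! l) (col U l)"
      using orthonormal_ritz_vector[OF W WS WH lk(2)] colW[OF lk(2)] lk by (simp add: colU[OF l])
    show "conjugate (col U l) \<bullet> (S *\<^sub>v w 0) = 0"
      using wkS[of l i0] lk by (simp add: colU[OF l] wk_def k_def)
  qed
  \<comment> \<open>\<open>f 0\<close> is the minimum of the Rayleigh quotient over a plane that
    contains \<open>z\<close>; the vector \<open>e\<close> holds the coordinates of \<open>z\<close>
    in the Ritz basis of this plane.\<close>
  have "f 0 \<le> \<rho>"
  proof -
    define L where "L = mat_adjoint G * (mat_adjoint Y * S * Y)"
    have L: "L \<in> carrier_mat 2 2" unfolding L_def by (rule mult_carrier_mat[OF mat_adjoint_carrier[OF G] SYc])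
    have GL: "G * L = 1\<^sub>m 2" using mat_mult_left_right_inverse[OF L G] GB by (simp add: L_def)
    define e where "e = L *\<^sub>v unit_vec 2 0"
    have e: "e \<in> carrier_vec 2" using L by (simp add: e_def)
    have Ge: "G *\<^sub>v e = unit_vec 2 0"
      unfolding e_def using assoc_mult_mat_vec[OF G L unit_vec_carrier, of 0] GL by simp
    have zGe: "z = Y *\<^sub>v (G *\<^sub>v e)" unfolding Ge using Yc[of "unit_vec 2 0"] z pc by auto
    have Gec: "G *\<^sub>v e \<in> carrier_vec 2" using G e by simp
    have "conjugate z \<bullet> (S *\<^sub>v z) = conjugate e \<bullet> e"
      unfolding zGe inner_congruence[OF Sc Y Gec Gec, symmetric] inner_congruence[OF SYc G e e, symmetric] GB
      using e by simp
    hence zS: "conjugate z \<bullet> (S *\<^sub>v z) = of_real (\<Sum>k<2. (cmod (e $ k))\<^sup>2)" unfolding inner_self[OF e] .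
    have "conjugate z \<bullet> (H *\<^sub>v z) = conjugate e \<bullet> (mat_diag 2 (\<lambda>k. complex_of_real (f k)) *\<^sub>v e)"
      unfolding zGe inner_congruence[OF Hc Y Gec Gec, symmetric] inner_congruence[OF HYc G e e, symmetric] GA ..
    hence zH: "conjugate z \<bullet> (H *\<^sub>v z) = of_real (\<Sum>k<2. f k * (cmod (e $ k))\<^sup>2)" unfolding inner_mat_diag[OF e] .
    have "0 < Re (conjugate z \<bullet> (S *\<^sub>v z))" by (rule pos_def_inner_pos[OF S z zne])
    hence pos: "0 < (\<Sum>k<2. (cmod (e $ k))\<^sup>2)" unfolding zS by simp
    have "f 0 * (\<Sum>k<2. (cmod (e $ k))\<^sup>2) \<le> (\<Sum>k<2. f k * (cmod (e $ k))\<^sup>2)"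
      unfolding sum_distrib_left using f01 by (intro sum_mono mult_right_mono) (auto simp: less_2_cases_iff)
    thus ?thesis unfolding \<rho>_def rayleigh_def zS zH using pos by (simp add: pos_le_divide_eq flip: of_real_divide)
  qed
  hence "rayleigh H S (w 0) \<le> rayleigh H S z" using ray[of 0] by (simp add: \<rho>_def)
  moreover have "w 0 \<noteq> 0\<^sub>v n" by (rule wne) simp
  moreover have "w 0 = (G $$ (0, 0)) \<cdot>\<^sub>v z + (G $$ (1, 0)) \<cdot>\<^sub>v p" by (rule w_lin) simp
  ultimately show ?thesis using step by metis
qed

end

section \<open>Sharpness\<close>

text \<open>The extremal case of the Kantorovich inequality with two eigenvalues \<open>h1\<close>,
  \<open>h2\<close> and weights 1/h1, 1/h2. The right side minus the left side is |2a + C(h1 +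
  h2)|^2/(h1 + h2), so the best step is C = -2a/(h1 + h2).\<close>

lemma line_search_lower_bound:
  fixes a C :: complex and h1 h2 :: real
  assumes "0 < h1" "0 < h2"
  shows "((h2 - h1) / (h2 + h1))\<^sup>2 * (cmod a)\<^sup>2 * (1 / h1 + 1 / h2)
    \<le> (cmod (a + C * of_real h1))\<^sup>2 / h1 + (cmod (a + C * of_real h2))\<^sup>2 / h2"
proof -
  define R where "R = Re (cnj a * C)"
  have exp: "(cmod (a + C * of_real h))\<^sup>2 = (cmod a)\<^sup>2 + 2 * h * R + h\<^sup>2 * (cmod C)\<^sup>2" for h
    by (simp add: R_def cmod_power2) (simp add: power2_eq_square algebra_simps)
  have "(cmod (a * of_real 2 + C * of_real (h2 + h1)))\<^sup>2 = 4 * (cmod a)\<^sup>2 + 4 * (h2 + h1) * R + (h2 + h1)\<^sup>2 * (cmod C)\<^sup>2"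
    by (simp add: R_def cmod_power2) (simp add: power2_eq_square algebra_simps)
  hence "0 \<le> (4 * (cmod a)\<^sup>2 + 4 * (h2 + h1) * R + (h2 + h1)\<^sup>2 * (cmod C)\<^sup>2) / (h2 + h1)"
    using assms by (metis add_pos_pos divide_nonneg_pos zero_le_power2)
  also have "\<dots> = (cmod a)\<^sup>2 * (4 / (h2 + h1)) + 4 * R + (h2 + h1) * (cmod C)\<^sup>2"
    using assms by (simp add: field_simps power2_eq_square)
  also have "4 / (h2 + h1) = (1 - ((h2 - h1) / (h2 + h1))\<^sup>2) * (1 / h1 + 1 / h2)"
  proof -
    have "1 - ((h2 - h1) / (h2 + h1))\<^sup>2 = ((h2 + h1)\<^sup>2 - (h2 - h1)\<^sup>2) / (h2 + h1)\<^sup>2"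
      unfolding power_divide using assms by (simp add: diff_divide_distrib)
    also have "\<dots> = 4 * h1 * h2 / (h2 + h1)\<^sup>2" by (simp add: power2_eq_square algebra_simps)
    finally have "1 - ((h2 - h1) / (h2 + h1))\<^sup>2 = 4 * h1 * h2 / (h2 + h1)\<^sup>2" .
    moreover have "1 / h1 + 1 / h2 = (h2 + h1) / (h1 * h2)" using assms by (simp add: field_simps)
    ultimately show ?thesis using assms by (simp add: power2_eq_square)
  qed
  also have "(cmod a)\<^sup>2 * ((1 - ((h2 - h1) / (h2 + h1))\<^sup>2) * (1 / h1 + 1 / h2)) + 4 * R + (h2 + h1) * (cmod C)\<^sup>2
    = (cmod (a + C * of_real h1))\<^sup>2 / h1 + (cmod (a + C * of_real h2))\<^sup>2 / h2
      - ((h2 - h1) / (h2 + h1))\<^sup>2 * (cmod a)\<^sup>2 * (1 / h1 + 1 / h2)"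
    unfolding exp using assms by (simp add: add_divide_distrib power2_eq_square) (simp add: algebra_simps)
  finally show ?thesis by simp
qed

context pencil_eigenbasis
begin

text \<open>\<open>diag_prec h * S\<close> multiplies the coordinate with index \<open>l\<close> by
  \<open>h l\<close>, so the compressed preconditioner is diagonal and its quality can be
  prescribed.\<close>

definition diag_prec :: "(nat \<Rightarrow> real) \<Rightarrow> complex mat" where
  "diag_prec h = X * mat_diag n (\<lambda>k. complex_of_real (h (Suc k))) * mat_adjoint X"

lemma diag_prec_hermitian: "hermitian_mat n (diag_prec h)"
  using hermitian_congruence[OF hermitian_mat_diag mat_adjoint_carrier[OF X_carrier], of "\<lambda>k. h (Suc k)"]
  by (simp add: diag_prec_def)

lemma diag_prec_apply:
  assumes q: "q \<in> carrier_vec n"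
  shows "diag_prec h *\<^sub>v (S *\<^sub>v q) = comb (\<lambda>l. of_real (h l) * coord q l)"
proof -
  let ?D = "mat_diag n (\<lambda>k. complex_of_real (h (Suc k)))"
  have Sq: "S *\<^sub>v q \<in> carrier_vec n" using Sc q by simp
  have aX: "mat_adjoint X *\<^sub>v (S *\<^sub>v q) \<in> carrier_vec n"
    by (rule mult_mat_vec_carrier[OF mat_adjoint_carrier[OF X_carrier] Sq])
  have "diag_prec h *\<^sub>v (S *\<^sub>v q) = X *\<^sub>v (?D *\<^sub>v (mat_adjoint X *\<^sub>v (S *\<^sub>v q)))"
    unfolding diag_prec_def
      assoc_mult_mat_vec[OF mult_carrier_mat[OF X_carrier mat_diag_dim] mat_adjoint_carrier[OF X_carrier] Sq]
    by (rule assoc_mult_mat_vec[OF X_carrier mat_diag_dim aX])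
  also have "mat_adjoint X *\<^sub>v (S *\<^sub>v q) = vec n (\<lambda>k. coord q (Suc k))"
    unfolding adjoint_X_vec[OF Sq] coord_def ..
  also have "?D *\<^sub>v vec n (\<lambda>k. coord q (Suc k)) = vec n (\<lambda>k. of_real (h (Suc k)) * coord q (Suc k))"
    by (subst mat_diag_mult_vec) (auto intro!: eq_vecI)
  finally show ?thesis unfolding comb_def .
qed

lemma compressed_diag_prec:
  assumes i: "1 \<le> i" "i \<le> n" and V: "V = mat_of_cols n (map u [i..<n+1])"
  shows "compressed_prec S V (diag_prec h) = mat_diag (n - i + 1) (\<lambda>a. complex_of_real (h (i + a)))"
proof -
  let ?m = "n - i + 1" and ?M = "compressed_prec S V (diag_prec h)"
  have len: "length (map u [i..<n+1]) = ?m" using i by simp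
  have dimV: "dim_col V = ?m" unfolding V by (simp only: mat_of_cols_carrier len)
  have M: "?M \<in> carrier_mat ?m ?m" unfolding compressed_prec_def by (intro carrier_matI) (simp_all add: dimV)
  show ?thesis
  proof (rule eq_matI)
    fix a b assume "a < dim_row (mat_diag ?m (\<lambda>a. complex_of_real (h (i + a))))"
      "b < dim_col (mat_diag ?m (\<lambda>a. complex_of_real (h (i + a))))"
    hence ab: "a < ?m" "b < ?m" by (simp_all add: mat_diag_def)
    hence ia: "i + a \<in> {1..n}" using i by auto
    define q where "q = comb (\<lambda>l. if l < i then 0 else unit_vec ?m b $ (l - i))"
    have "?M $$ (a, b) = (?M *\<^sub>v unit_vec ?m b) $ a" using M ab by (simp add: scalar_prod_right_unit)
    also have "\<dots> = coord (diag_prec h *\<^sub>v (S *\<^sub>v q)) (i + a)"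
    proof (rule coord_preconditioned[OF _ i V unit_vec_carrier _ _ ab(1), symmetric])
      show "diag_prec h \<in> carrier_mat n n" using diag_prec_hermitian by (auto simp: hermitian_mat_def)
      show "q \<in> carrier_vec n" by (simp add: q_def)
      show "coord q l = (if l < i then 0 else unit_vec ?m b $ (l - i))" if "l \<in> {1..n}" for l
        unfolding q_def by (rule coord_comb[OF that])
    qed
    also have "\<dots> = of_real (h (i + a)) * unit_vec ?m b $ a"
      unfolding diag_prec_apply[OF comb_carrier] q_def coord_comb[OF ia] by simp
    finally show "?M $$ (a, b) = mat_diag ?m (\<lambda>a. complex_of_real (h (i + a))) $$ (a, b)"
      using ab by (simp add: mat_diag_def)
  qed (use M in \<open>simp_all add: mat_diag_def\<close>)
qed

lemma effectively_pos_def_diag_prec: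
  assumes i: "1 \<le> i" "i \<le> n" and V: "V = mat_of_cols n (map u [i..<n+1])"
    and h: "\<And>l. l \<in> {i..n} \<Longrightarrow> 0 < h l"
  shows "effectively_pos_def S V (diag_prec h)"
proof -
  have len: "length (map u [i..<n+1]) = n - i + 1" using i by simp
  have dimV: "dim_col V = n - i + 1" unfolding V by (simp only: mat_of_cols_carrier len)
  show ?thesis
    unfolding effectively_pos_def_def compressed_diag_prec[OF i V] dimV
    by (rule pos_def_mat_diag) (use h i in auto)
qed

lemma quality_diag_prec:
  assumes i: "1 \<le> i" "i \<le> n" and V: "V = mat_of_cols n (map u [i..<n+1])"
    and \<Lambda>: "\<Lambda> = mat_diag (n - i + 1) (\<lambda>l. complex_of_real (lam (i + l)))"
    and k: "k1 \<in> {i..n}" "k2 \<in> {i..n}"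
      "\<And>l. l \<in> {i..n} \<Longrightarrow> h k1 * (lam k1 - \<nu>) \<le> h l * (lam l - \<nu>)"
      "\<And>l. l \<in> {i..n} \<Longrightarrow> h l * (lam l - \<nu>) \<le> h k2 * (lam k2 - \<nu>)"
  defines "\<alpha> \<equiv> h k1 * (lam k1 - \<nu>)" and "\<beta> \<equiv> h k2 * (lam k2 - \<nu>)"
  shows "quality S V \<Lambda> \<nu> (diag_prec h) = (\<beta> - \<alpha>) / (\<beta> + \<alpha>)"
proof -
  let ?m = "n - i + 1"
  let ?f = "\<lambda>a. h (i + a) * (lam (i + a) - \<nu>)"
  have "\<Lambda> - complex_of_real \<nu> \<cdot>\<^sub>m 1\<^sub>m (dim_row \<Lambda>) = mat_diag ?m (\<lambda>a. complex_of_real (lam (i + a) - \<nu>))"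
    unfolding \<Lambda> by (intro eq_matI) (auto simp: mat_diag_def)
  hence M: "compressed_prec S V (diag_prec h) * (\<Lambda> - complex_of_real \<nu> \<cdot>\<^sub>m 1\<^sub>m (dim_row \<Lambda>))
      = mat_diag ?m (\<lambda>a. complex_of_real (?f a))"
    unfolding compressed_diag_prec[OF i V] by simp
  have img: "?f ` {..<?m} = (\<lambda>l. h l * (lam l - \<nu>)) ` {i..n}"
  proof safe
    fix a assume "a < ?m"
    thus "?f a \<in> (\<lambda>l. h l * (lam l - \<nu>)) ` {i..n}" using i by (intro image_eqI[of _ _ "i + a"]) auto
  next
    fix l assume "l \<in> {i..n}"
    thus "h l * (lam l - \<nu>) \<in> ?f ` {..<?m}" using i by (intro image_eqI[of _ _ "l - i"]) auto
  qed
  have "min_eigenvalue (mat_diag ?m (\<lambda>a. complex_of_real (?f a))) = \<alpha>"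
    unfolding min_eigenvalue_def real_eigenvalues_mat_diag img \<alpha>_def using k by (intro Min_eqI) auto
  moreover have "max_eigenvalue (mat_diag ?m (\<lambda>a. complex_of_real (?f a))) = \<beta>"
    unfolding max_eigenvalue_def real_eigenvalues_mat_diag img \<beta>_def using k by (intro Max_eqI) auto
  ultimately show ?thesis unfolding quality_def Let_def M by simp
qed

text \<open>The preconditioner is extremal in opposite directions at \<open>\<lambda>\<^sub>j\<^sub>+\<^sub>1\<close> and \<open>\<lambda>\<^sub>n\<close>, and the weights of \<open>z\<close> at these
  two eigenvalues are those for which the Kantorovich inequality is an equality. Bounding every vector of
  \<open>span {z, p}\<close> avoids computing the Ritz values.\<close>

lemma sharp_step:
  fixes \<epsilon> \<rho> \<nu> :: real
  assumes mono: "\<And>l m. 1 \<le> l \<Longrightarrow> l \<le> m \<Longrightarrow> m \<le> n \<Longrightarrow> lam l \<le> lam m"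
    and i: "1 \<le> i" "i \<le> n"
    and U: "U = mat_of_cols n (map u [1..<i])" and V: "V = mat_of_cols n (map u [i..<n+1])"
    and \<nu>: "\<nu> < lam i" and j: "i \<le> j" "j + 1 < n"
    and \<epsilon>: "0 \<le> \<epsilon>" "\<epsilon> < 1" and \<rho>: "lam j < \<rho>" "\<rho> < lam (j+1)"
  defines "h \<equiv> \<lambda>l. (if l = j + 1 then 1 - \<epsilon> else if l = n then 1 + \<epsilon> else 1) / (lam l - \<nu>)"
  defines "h1 \<equiv> h (j+1) * (lam (j+1) - \<rho>) - h j * (lam j - \<rho>)"
    and "h2 \<equiv> h n * (lam n - \<rho>) - h j * (lam j - \<rho>)"
  shows "\<exists>z z'. z \<in> cspan n {u j, u (j+1), u n} \<and> psd_id_step n H S U V (diag_prec h) z z' \<and>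
    rayleigh H S z = \<rho> \<and>
    ((h2 - h1) / (h2 + h1))\<^sup>2 * ((lam (j+1) - \<rho>) / (lam (j+1) - lam j))
      \<le> ((rayleigh H S z' - lam j) / (lam (j+1) - rayleigh H S z')) / ((\<rho> - lam j) / (lam (j+1) - \<rho>))"
proof -
  have x_pos: "0 < lam l - \<nu>" if "l \<in> {i..n}" for l using mono[of i l] that i \<nu> by simp
  have jn: "j \<in> {1..n}" "j + 1 \<in> {1..n}" "n \<in> {1..n}" "j \<noteq> n" "j + 1 \<noteq> n" using i j by auto
  have lam_n: "lam (j+1) \<le> lam n" using mono[of "j+1" n] j by simp
  have hpos: "0 < h l" if "l \<in> {i..n}" for l using x_pos[OF that] \<epsilon> by (simp add: h_def)
  define cf where "cf l = h l * (lam l - \<rho>)" for l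
  have cj: "cf j < 0" and c1: "0 < cf (j+1)" and c2: "0 < cf n"
    using hpos[of j] hpos[of "j+1"] hpos[of n] i j \<rho> lam_n by (auto simp: cf_def mult_pos_neg)
  \<comment> \<open>A vector \<open>a \<cdot>\<^sub>v z + b \<cdot>\<^sub>v p\<close> has
    coordinates \<open>(a + b * cf l) * \<zeta> l\<close>. Expressed through the value at
    \<open>j\<close>, the other two multipliers involve only these differences of \<open>cf\<close>;
    they act as the two eigenvalues of the line search.\<close>
  have h1: "h1 = cf (j+1) - cf j" and h2: "h2 = cf n - cf j" by (simp_all add: h1_def h2_def cf_def)
  have h1p: "0 < h1" and h2p: "0 < h2" using cj c1 c2 by (simp_all add: h1 h2)
  define B1 B2 where "B1 = lam (j+1) - lam j" and "B2 = lam n - lam j"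
  have B1p: "0 < B1" and B2p: "0 < B2" using \<rho> lam_n by (simp_all add: B1_def B2_def)
  \<comment> \<open>\<open>T\<close> and \<open>t\<close> are found from two requirements:
    \<open>h1 * B1 * s1\<^sup>2\<close> and \<open>h2 * B2 * s2\<^sup>2\<close> have a common value
    \<open>t\<close>, which gives the Kantorovich weights, and \<open>z\<close> has Rayleigh
    quotient \<open>\<rho>\<close>, which fixes \<open>t\<close>.\<close>
  define T where "T = (lam (j+1) - \<rho>) / (h1 * B1) + (lam n - \<rho>) / (h2 * B2)"
  have Tp: "0 < T" unfolding T_def using \<rho> lam_n h1p h2p B1p B2p by (intro add_pos_pos) auto
  define t where "t = (\<rho> - lam j) / T"
  have tp: "0 < t" using Tp \<rho> by (simp add: t_def)
  define s1 s2 where "s1 = sqrt (t / (h1 * B1))" and "s2 = sqrt (t / (h2 * B2))"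
  have s1: "s1\<^sup>2 = t / (h1 * B1)" "0 < s1" and s2: "s2\<^sup>2 = t / (h2 * B2)" "0 < s2"
    using tp h1p h2p B1p B2p by (auto simp: s1_def s2_def)
  define \<zeta> :: "nat \<Rightarrow> real" where "\<zeta> l = (if l = j then 1 else if l = j + 1 then s1 else if l = n then s2 else 0)" for l
  have \<zeta>v: "\<zeta> j = 1" "\<zeta> (j+1) = s1" "\<zeta> (Suc j) = s1" "\<zeta> n = s2" using jn by (auto simp: \<zeta>_def)
  have sum3: "(\<Sum>l=1..n. f l) = f j + f (j+1) + f n" if "\<And>l. \<zeta> l = 0 \<Longrightarrow> f l = 0" for f :: "nat \<Rightarrow> real"
  proof -
    have "(\<Sum>l=1..n. f l) = (\<Sum>l\<in>{j, j+1, n}. f l)"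
      using jn that by (intro sum.mono_neutral_right) (auto simp: \<zeta>_def)
    thus ?thesis using jn by simp
  qed
  define z where "z = comb (\<lambda>l. of_real (\<zeta> l))"
  have z: "z \<in> carrier_vec n" by (simp add: z_def)
  have cz: "coord z l = of_real (\<zeta> l)" if "l \<in> {1..n}" for l unfolding z_def by (rule coord_comb[OF that])
  have zne: "z \<noteq> 0\<^sub>v n" using cz[OF jn(1)] coord_zero[OF jn(1)] \<zeta>v by auto
  have bal: "(lam j - \<rho>) + (lam (j+1) - \<rho>) * s1\<^sup>2 + (lam n - \<rho>) * s2\<^sup>2 = 0"
  proof -
    have "(lam (j+1) - \<rho>) * s1\<^sup>2 + (lam n - \<rho>) * s2\<^sup>2 = t * T"
      unfolding s1 s2 T_def by (simp add: algebra_simps)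
    also have "\<dots> = \<rho> - lam j" using Tp by (simp add: t_def)
    finally show ?thesis by simp
  qed
  have "(\<Sum>l=1..n. (lam l - \<rho>) * (cmod (coord z l))\<^sup>2) = (\<Sum>l=1..n. (lam l - \<rho>) * (\<zeta> l)\<^sup>2)"
    by (intro sum.cong) (simp_all add: cz)
  also have "\<dots> = 0" using bal by (subst sum3) (simp_all add: \<zeta>v)
  finally have ray: "rayleigh H S z = \<rho>"
    using shifted_sum[OF z zne, of \<rho>] coord_sum_pos[OF z zne] by simp
  define p where "p = diag_prec h *\<^sub>v (H *\<^sub>v z - complex_of_real (rayleigh H S z) \<cdot>\<^sub>v (S *\<^sub>v z))"
  have p_eq: "p = comb (\<lambda>l. of_real (h l) * coord (comb (\<lambda>l. of_real (lam l - \<rho>) * coord z l)) l)"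
    unfolding p_def ray coord_residual[OF z] by (rule diag_prec_apply[OF comb_carrier])
  have pc: "p \<in> carrier_vec n" by (simp add: p_eq)
  have cp: "coord p l = of_real (cf l * \<zeta> l)" if "l \<in> {1..n}" for l
    unfolding p_eq coord_comb[OF that] cz[OF that] by (simp add: cf_def)
  have cab: "coord (a \<cdot>\<^sub>v z + b \<cdot>\<^sub>v p) l = (a + b * of_real (cf l)) * of_real (\<zeta> l)" if "l \<in> {1..n}" for a b l
    using z pc that by (simp add: coord_add coord_smult cz cp algebra_simps)
  have "\<exists>a b. psd_id_step n H S U V (diag_prec h) z (a \<cdot>\<^sub>v z + b \<cdot>\<^sub>v p) \<and> a \<cdot>\<^sub>v z + b \<cdot>\<^sub>v p \<noteq> 0\<^sub>v n \<and>
    rayleigh H S (a \<cdot>\<^sub>v z + b \<cdot>\<^sub>v p) \<le> rayleigh H S z"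
  proof (rule psd_id_step_exists[OF mono i U V diag_prec_hermitian z p_def])
    fix l assume l: "1 \<le> l" "l < i"
    hence l': "l \<in> {1..n}" "\<zeta> l = 0" using i j by (auto simp: \<zeta>_def)
    show "coord z l = 0" "coord p l = 0" using cz[OF l'(1)] cp[OF l'(1)] l'(2) by auto
  next
    fix a b assume "a \<cdot>\<^sub>v z + b \<cdot>\<^sub>v p = 0\<^sub>v n"
    hence 0: "(a + b * of_real (cf l)) * of_real (\<zeta> l) = 0" if "l \<in> {1..n}" for l
      using cab[OF that, of a b] coord_zero[OF that] by simp
    have "a + b * of_real (cf j) = 0" "a + b * of_real (cf (j+1)) = 0"
      using 0[OF jn(1)] 0[OF jn(2)] s1(2) unfolding \<zeta>v by auto
    moreover have "b * of_real (cf (j+1) - cf j) = (a + b * of_real (cf (j+1))) - (a + b * of_real (cf j))"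
      by (simp add: algebra_simps)
    ultimately have "b * of_real h1 = 0" "a + b * of_real (cf j) = 0" unfolding h1 by simp_all
    thus "a = 0 \<and> b = 0" using h1p by auto
  qed
  then obtain a b where step: "psd_id_step n H S U V (diag_prec h) z (a \<cdot>\<^sub>v z + b \<cdot>\<^sub>v p)"
    and ne: "a \<cdot>\<^sub>v z + b \<cdot>\<^sub>v p \<noteq> 0\<^sub>v n" and le: "rayleigh H S (a \<cdot>\<^sub>v z + b \<cdot>\<^sub>v p) \<le> \<rho>"
    unfolding ray by blast
  define z' where "z' = a \<cdot>\<^sub>v z + b \<cdot>\<^sub>v p"
  define r' where "r' = rayleigh H S z'"
  define g where "g l = cmod (a + b * of_real (cf l))" for l
  have z': "z' \<in> carrier_vec n" using z pc by (simp add: z'_def)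
  have z'ne: "z' \<noteq> 0\<^sub>v n" using ne by (simp add: z'_def)
  define N where "N = (\<Sum>l=1..n. (cmod (coord z' l))\<^sup>2)"
  have Np: "0 < N" unfolding N_def by (rule coord_sum_pos[OF z' z'ne])
  have form: "(r' - \<theta>) * N = (lam j - \<theta>) * (g j)\<^sup>2 + (lam (j+1) - \<theta>) * ((g (j+1))\<^sup>2 * s1\<^sup>2) + (lam n - \<theta>) * ((g n)\<^sup>2 * s2\<^sup>2)" for \<theta>
  proof -
    have "(r' - \<theta>) * N = (\<Sum>l=1..n. (lam l - \<theta>) * (cmod (coord z' l))\<^sup>2)"
      unfolding r'_def N_def by (rule shifted_sum[OF z' z'ne, symmetric])
    also have "\<dots> = (\<Sum>l=1..n. (lam l - \<theta>) * ((g l)\<^sup>2 * (\<zeta> l)\<^sup>2))"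
      unfolding z'_def by (intro sum.cong) (simp_all add: cab g_def norm_mult power_mult_distrib)
    finally show ?thesis by (subst (asm) sum3) (simp_all add: \<zeta>v)
  qed
  define \<Phi> where "\<Phi> = ((h2 - h1) / (h2 + h1))\<^sup>2"
  have \<Phi>0: "0 \<le> \<Phi>" by (simp add: \<Phi>_def)
  \<comment> \<open>The numerator of the new ratio. The line search inequality, scaled by
    \<open>t\<close>, turns into the shifted form at \<open>z'\<close>; the old weights sum to
    \<open>\<rho> - lam j\<close> times \<open>1 + s1\<^sup>2 + s2\<^sup>2\<close>, where the
    squares are simply dropped.\<close>
  have low: "\<Phi> * (\<rho> - lam j) * (g j)\<^sup>2 \<le> (r' - lam j) * N"
  proof -
    have "\<rho> - lam j \<le> B1 * s1\<^sup>2 + B2 * s2\<^sup>2"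
    proof -
      have "B1 * s1\<^sup>2 + B2 * s2\<^sup>2 = (\<rho> - lam j) * (1 + s1\<^sup>2 + s2\<^sup>2)"
        using bal by (simp add: B1_def B2_def algebra_simps)
      also have "\<dots> \<ge> (\<rho> - lam j) * 1" using \<rho> by (intro mult_left_mono) auto
      finally show ?thesis by simp
    qed
    also have "B1 * s1\<^sup>2 + B2 * s2\<^sup>2 = t * (1 / h1 + 1 / h2)"
      unfolding s1 s2 using B1p B2p by (simp add: algebra_simps)
    finally have "\<Phi> * (g j)\<^sup>2 * (\<rho> - lam j) \<le> \<Phi> * (g j)\<^sup>2 * (t * (1 / h1 + 1 / h2))"
      using \<Phi>0 by (intro mult_left_mono) auto
    also have "\<dots> = t * (\<Phi> * (g j)\<^sup>2 * (1 / h1 + 1 / h2))" by simp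
    also have "\<dots> \<le> t * ((g (j+1))\<^sup>2 / h1 + (g n)\<^sup>2 / h2)"
    proof (rule mult_left_mono)
      have sh: "a + b * of_real (cf j) + b * of_real h1 = a + b * of_real (cf (j+1))"
        "a + b * of_real (cf j) + b * of_real h2 = a + b * of_real (cf n)"
        unfolding h1 h2 by (simp_all add: algebra_simps)
      show "\<Phi> * (g j)\<^sup>2 * (1 / h1 + 1 / h2) \<le> (g (j+1))\<^sup>2 / h1 + (g n)\<^sup>2 / h2"
        using line_search_lower_bound[OF h1p h2p, of "a + b * of_real (cf j)" b] unfolding \<Phi>_def g_def sh .
    qed (use tp in simp)
    also have "\<dots> = B1 * ((g (j+1))\<^sup>2 * s1\<^sup>2) + B2 * ((g n)\<^sup>2 * s2\<^sup>2)"
      unfolding s1 s2 using B1p B2p by (simp add: algebra_simps)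
    also have "\<dots> = (r' - lam j) * N" unfolding form by (simp add: B1_def B2_def)
    finally show ?thesis by (simp add: mult_ac)
  qed
  \<comment> \<open>The denominator of the new ratio, bounded by its contribution from
    \<open>j\<close> alone. The losses here and in \<open>low\<close> are the reason for the extra
    factor (\<lambda>_{j+1} - \<rho>)/(\<lambda>_{j+1} - \<lambda>_j), which tends to 1.\<close>
  have up: "(lam (j+1) - r') * N \<le> B1 * (g j)\<^sup>2"
  proof -
    have "(lam (j+1) - r') * N = - ((r' - lam (j+1)) * N)" by (simp add: algebra_simps)
    also have "\<dots> = B1 * (g j)\<^sup>2 - (lam n - lam (j+1)) * ((g n)\<^sup>2 * s2\<^sup>2)"
      unfolding form by (simp add: B1_def algebra_simps)
    also have "\<dots> \<le> B1 * (g j)\<^sup>2" using lam_n by simp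
    finally show ?thesis .
  qed
  have "\<Phi> * (\<rho> - lam j) * ((lam (j+1) - r') * N) \<le> \<Phi> * (\<rho> - lam j) * (B1 * (g j)\<^sup>2)"
    using \<Phi>0 \<rho> up by (intro mult_left_mono) auto
  also have "\<dots> \<le> B1 * ((r' - lam j) * N)"
    using mult_left_mono[OF low, of B1] B1p by (simp add: mult_ac)
  finally have "(\<Phi> * (\<rho> - lam j) * (lam (j+1) - r')) * N \<le> (B1 * (r' - lam j)) * N" by (simp add: mult_ac)
  hence key: "\<Phi> * (\<rho> - lam j) * (lam (j+1) - r') \<le> B1 * (r' - lam j)" using Np by simp
  have r'lt: "r' < lam (j+1)" using le \<rho> by (simp add: r'_def z'_def)
  have "\<Phi> * ((lam (j+1) - \<rho>) / B1) \<le> ((r' - lam j) / (lam (j+1) - r')) / ((\<rho> - lam j) / (lam (j+1) - \<rho>))"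
  proof -
    have "\<Phi> * (\<rho> - lam j) / B1 \<le> (r' - lam j) / (lam (j+1) - r')"
      using key r'lt B1p by (simp add: field_simps)
    hence "\<Phi> * (\<rho> - lam j) / B1 * ((lam (j+1) - \<rho>) / (\<rho> - lam j))
        \<le> (r' - lam j) / (lam (j+1) - r') * ((lam (j+1) - \<rho>) / (\<rho> - lam j))"
      using \<rho> by (intro mult_right_mono) auto
    thus ?thesis using \<rho> by (simp add: mult_ac)
  qed
  moreover have "z \<in> cspan n {u j, u (j+1), u n}"
  proof -
    have d: "distinct [j, j+1, n]" "set [j, j+1, n] \<subseteq> {1..n}" using jn by auto
    have "u ` set [j, j+1, n] = {u j, u (j+1), u n}" by simp
    moreover have "coord z l = 0" if "l \<in> {1..n} - set [j, j+1, n]" for l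
      using cz[of l] that by (auto simp: \<zeta>_def)
    ultimately show ?thesis using cspan_u[OF d, of z] z by (metis (no_types, lifting))
  qed
  ultimately show ?thesis using step ray unfolding \<Phi>_def B1_def r'_def z'_def by blast
qed

text \<open>The ratio of new to old is squeezed between the continuous function \<open>F\<close> of
  the Rayleigh quotient and the constant \<open>\<sigma>\<^sup>2\<close>, and \<open>F\<close> takes
  exactly this value at \<open>lam j\<close>. One preconditioner serves the whole sequence.\<close>

lemma psd_id_sharp:
  fixes \<epsilon> \<nu> :: real
  assumes mono: "\<And>l m. 1 \<le> l \<Longrightarrow> l \<le> m \<Longrightarrow> m \<le> n \<Longrightarrow> lam l \<le> lam m"
    and i: "1 \<le> i" "i \<le> n"
    and U: "U = mat_of_cols n (map u [1..<i])" and V: "V = mat_of_cols n (map u [i..<n+1])"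
    and \<Lambda>: "\<Lambda> = mat_diag (n - i + 1) (\<lambda>l. complex_of_real (lam (i + l)))"
    and \<nu>: "\<nu> < lam i" and j: "i \<le> j" "j + 1 < n" and gap: "lam j < lam (j+1)"
    and \<kappa>: "\<kappa> = (lam j - \<nu>) / (lam (j+1) - \<nu>) * ((lam n - lam (j+1)) / (lam n - lam j))"
    and \<epsilon>: "0 \<le> \<epsilon>" "\<epsilon> < 1"
  defines "\<sigma> \<equiv> (\<kappa> + \<epsilon> * (2 - \<kappa>)) / ((2 - \<kappa>) + \<epsilon> * \<kappa>)"
  shows "\<exists>z K z'. (\<forall>k::nat. z k \<in> cspan n {u j, u (j+1), u n} \<and>
        effectively_pos_def S V (K k) \<and> quality S V \<Lambda> \<nu> (K k) = \<epsilon> \<and>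
        psd_id_step n H S U V (K k) (z k) (z' k) \<and>
        rayleigh H S (z k) \<in> {lam j <..< lam (j+1)}) \<and>
      (\<lambda>k. rayleigh H S (z k)) \<longlonglongrightarrow> lam j \<and>
      (\<lambda>k. ((rayleigh H S (z' k) - lam j) / (lam (j+1) - rayleigh H S (z' k))) /
            ((rayleigh H S (z k) - lam j) / (lam (j+1) - rayleigh H S (z k)))) \<longlonglongrightarrow> \<sigma>\<^sup>2"
proof -
  define h where "h = (\<lambda>l. (if l = j + 1 then 1 - \<epsilon> else if l = n then 1 + \<epsilon> else 1) / (lam l - \<nu>))"
  define h1 h2 where "h1 r = h (j+1) * (lam (j+1) - r) - h j * (lam j - r)"
    and "h2 r = h n * (lam n - r) - h j * (lam j - r)" for r
  define F where "F r = ((h2 r - h1 r) / (h2 r + h1 r))\<^sup>2 * ((lam (j+1) - r) / (lam (j+1) - lam j))" for r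
  \<comment> \<open>The offset 2 keeps also the first value strictly below
    \<open>lam (j+1)\<close>.\<close>
  define \<rho> where "\<rho> k = lam j + (lam (j+1) - lam j) / real (k + 2)" for k
  have x_pos: "0 < lam l - \<nu>" if "l \<in> {i..n}" for l using mono[of i l] that i \<nu> by simp
  have lam_n: "lam (j+1) \<le> lam n" using mono[of "j+1" n] j by simp
  have \<rho>: "lam j < \<rho> k" "\<rho> k < lam (j+1)" for k
  proof -
    show "lam j < \<rho> k" using gap by (simp add: \<rho>_def)
    have "(lam (j+1) - lam j) / real (k + 2) < lam (j+1) - lam j" using gap by (simp add: divide_less_eq)
    thus "\<rho> k < lam (j+1)" by (simp add: \<rho>_def)
  qed
  have \<rho>_lim: "\<rho> \<longlonglongrightarrow> lam j"
  proof -
    have "(\<lambda>k. (lam (j+1) - lam j) / real (k + 2)) \<longlonglongrightarrow> 0"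
      by (rule LIMSEQ_ignore_initial_segment[OF lim_const_over_n])
    from tendsto_add[OF tendsto_const this, of "lam j"] show ?thesis unfolding \<rho>_def by simp
  qed
  have "\<exists>z z'. z \<in> cspan n {u j, u (j+1), u n} \<and> psd_id_step n H S U V (diag_prec h) z z' \<and>
    rayleigh H S z = \<rho> k \<and>
    F (\<rho> k) \<le> ((rayleigh H S z' - lam j) / (lam (j+1) - rayleigh H S z')) / ((\<rho> k - lam j) / (lam (j+1) - \<rho> k))" for k
    using sharp_step[OF mono i U V \<nu> j \<epsilon> \<rho>] unfolding F_def h1_def h2_def h_def by blast
  then obtain z z' where zz: "\<And>k. z k \<in> cspan n {u j, u (j+1), u n}"
    "\<And>k. psd_id_step n H S U V (diag_prec h) (z k) (z' k)" "\<And>k. rayleigh H S (z k) = \<rho> k"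
    "\<And>k. F (\<rho> k) \<le> ((rayleigh H S (z' k) - lam j) / (lam (j+1) - rayleigh H S (z' k))) / ((\<rho> k - lam j) / (lam (j+1) - \<rho> k))"
    by metis
  have eff: "effectively_pos_def S V (diag_prec h)"
    by (rule effectively_pos_def_diag_prec[OF i V]) (use x_pos \<epsilon> in \<open>auto simp: h_def\<close>)
  have hx: "h l * (lam l - \<nu>) = (if l = j + 1 then 1 - \<epsilon> else if l = n then 1 + \<epsilon> else 1)" if "l \<in> {i..n}" for l
    using x_pos[OF that] by (simp add: h_def)
  have qual: "quality S V \<Lambda> \<nu> (diag_prec h) = \<epsilon>"
  proof -
    have jn: "j + 1 \<in> {i..n}" "n \<in> {i..n}" using i j by auto
    have "quality S V \<Lambda> \<nu> (diag_prec h) = (h n * (lam n - \<nu>) - h (j+1) * (lam (j+1) - \<nu>))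
        / (h n * (lam n - \<nu>) + h (j+1) * (lam (j+1) - \<nu>))"
      by (rule quality_diag_prec[OF i V \<Lambda> jn]) (use hx jn \<epsilon> j in auto)
    thus ?thesis using hx[OF jn(1)] hx[OF jn(2)] j by simp
  qed
  have F_lim: "F (lam j) = \<sigma>\<^sup>2" and den: "h2 (lam j) + h1 (lam j) \<noteq> 0"
  proof -
    define \<mu> b c where "\<mu> = lam j - \<nu>" and "b = lam (j+1) - \<nu>" and "c = lam n - \<nu>"
    have pos: "0 < \<mu>" "\<mu> < b" "b \<le> c" using x_pos[of j] i j gap lam_n by (auto simp: \<mu>_def b_def c_def)
    \<comment> \<open>The common scale 1 - \<mu>/c. With it \<open>h1\<close> and \<open>h2\<close>
      at \<open>lam j\<close> become (1 - \<epsilon>)(1 - \<kappa>)G and (1 + \<epsilon>)G, whose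
      difference divided by their sum is \<open>\<sigma>\<close>.\<close>
    define G where "G = (c - \<mu>) / c"
    have G: "0 < G" using pos by (simp add: G_def)
    have \<kappa>': "\<kappa> = \<mu> / b * ((c - b) / (c - \<mu>))" unfolding \<kappa> by (simp add: \<mu>_def b_def c_def)
    have "b * (c - \<mu>) - \<mu> * (c - b) = (b - \<mu>) * c" by (simp add: algebra_simps)
    hence "1 - \<kappa> = (b - \<mu>) * c / (b * (c - \<mu>))" unfolding \<kappa>' using pos by (simp add: field_simps)
    hence \<kappa>G: "(1 - \<kappa>) * G = (b - \<mu>) / b" unfolding G_def using pos by simp
    have H1: "h1 (lam j) = (1 - \<epsilon>) * ((1 - \<kappa>) * G)"
      unfolding \<kappa>G using j by (simp add: h1_def h_def \<mu>_def b_def)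
    have H2: "h2 (lam j) = (1 + \<epsilon>) * G"
      using j by (simp add: h2_def h_def \<mu>_def c_def G_def)
    have s: "h2 (lam j) + h1 (lam j) = G * ((2 - \<kappa>) + \<epsilon> * \<kappa>)" "h2 (lam j) - h1 (lam j) = G * (\<kappa> + \<epsilon> * (2 - \<kappa>))"
      unfolding H1 H2 by (simp_all add: algebra_simps)
    have "0 < (1 - \<kappa>) * G" unfolding \<kappa>G using pos by simp
    hence "0 < h1 (lam j)" unfolding H1 using \<epsilon> by simp
    moreover have "0 < h2 (lam j)" unfolding H2 using G \<epsilon> by simp
    ultimately show "h2 (lam j) + h1 (lam j) \<noteq> 0" by simp
    show "F (lam j) = \<sigma>\<^sup>2" unfolding F_def s \<sigma>_def using G gap by simp
  qed
  have "(\<lambda>k. F (\<rho> k)) \<longlonglongrightarrow> F (lam j)"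
    unfolding F_def
  proof (intro tendsto_mult tendsto_power tendsto_divide tendsto_diff tendsto_add tendsto_const \<rho>_lim)
    show "(\<lambda>k. h1 (\<rho> k)) \<longlonglongrightarrow> h1 (lam j)" "(\<lambda>k. h2 (\<rho> k)) \<longlonglongrightarrow> h2 (lam j)"
      unfolding h1_def h2_def by (intro tendsto_intros \<rho>_lim)+
    thus "(\<lambda>k. h1 (\<rho> k)) \<longlonglongrightarrow> h1 (lam j)" "(\<lambda>k. h2 (\<rho> k)) \<longlonglongrightarrow> h2 (lam j)" .
  qed (use den gap in auto)
  hence low: "(\<lambda>k. F (\<rho> k)) \<longlonglongrightarrow> \<sigma>\<^sup>2" unfolding F_lim .
  have "(\<lambda>k. ((rayleigh H S (z' k) - lam j) / (lam (j+1) - rayleigh H S (z' k))) /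
            ((\<rho> k - lam j) / (lam (j+1) - \<rho> k))) \<longlonglongrightarrow> \<sigma>\<^sup>2"
  proof (rule tendsto_sandwich[OF _ _ low tendsto_const])
    show "\<forall>\<^sub>F k in sequentially. F (\<rho> k) \<le> ((rayleigh H S (z' k) - lam j) / (lam (j+1) - rayleigh H S (z' k))) /
            ((\<rho> k - lam j) / (lam (j+1) - \<rho> k))"
      using zz(4) by simp
    have "((rayleigh H S (z' k) - lam j) / (lam (j+1) - rayleigh H S (z' k))) /
            ((\<rho> k - lam j) / (lam (j+1) - \<rho> k)) \<le> \<sigma>\<^sup>2" for k
    proof -
      have jl: "j < n" using j by simp
      have "(rayleigh H S (z' k) - lam j) / (lam (j+1) - rayleigh H S (z' k)) \<le> \<sigma>\<^sup>2 * ((\<rho> k - lam j) / (lam (j+1) - \<rho> k))"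
        using psd_id_contraction[OF mono i U V \<Lambda> \<nu> j(1) jl \<kappa> eff zz(2), of k] \<rho>
        unfolding zz(3) qual \<sigma>_def by blast
      moreover have "0 < (\<rho> k - lam j) / (lam (j+1) - \<rho> k)" using \<rho> by simp
      ultimately show ?thesis by (simp only: pos_divide_le_eq)
    qed
    thus "\<forall>\<^sub>F k in sequentially. ((rayleigh H S (z' k) - lam j) / (lam (j+1) - rayleigh H S (z' k))) /
            ((\<rho> k - lam j) / (lam (j+1) - \<rho> k)) \<le> \<sigma>\<^sup>2" by simp
  qed
  thus ?thesis
    by (intro exI[of _ z] exI[of _ "\<lambda>_. diag_prec h"] exI[of _ z'])
      (use zz eff qual \<rho> \<rho>_lim in simp)
qed

end

text \<open>Attainability in the limit is expressed by sequences whose ratios converge to the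
  squared factor. The bound \<open>j + 1 < n\<close> there makes \<open>u j\<close>,
  \<open>u (j+1)\<close>, \<open>u n\<close> three different basis vectors, which span the invariant
  subspace.\<close>

theorem theorem3p1:
  fixes n i j :: nat and H S U V \<Lambda> :: "complex mat" and lam :: "nat \<Rightarrow> real"
    and u :: "nat \<Rightarrow> complex vec" and \<nu> \<kappa> :: real and \<sigma> :: "real \<Rightarrow> real"
  assumes H: "hermitian_mat n H" and S: "pos_def_mat n S"
    and lam: "pair_eigenvalues H S (map lam [1..<n+1])"
    and i: "1 \<le> i" "i \<le> n"
    and u_carrier: "\<And>l. l \<in> {1..n} \<Longrightarrow> u l \<in> carrier_vec n"
    and u_eigen: "\<And>l. l \<in> {1..n} \<Longrightarrow> H *\<^sub>v u l = complex_of_real (lam l) \<cdot>\<^sub>v (S *\<^sub>v u l)"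
    and u_orthonormal: "\<And>l m. l \<in> {1..n} \<Longrightarrow> m \<in> {1..n} \<Longrightarrow>
          conjugate (u l) \<bullet> (S *\<^sub>v u m) = (if l = m then 1 else 0)"
    and U: "U = mat_of_cols n (map u [1..<i])"
    and V: "V = mat_of_cols n (map u [i..<n+1])"
    and \<Lambda>: "\<Lambda> = mat_diag (n - i + 1) (\<lambda>l. complex_of_real (lam (i + l)))"
    and \<nu>: "\<nu> < lam i"
    and j: "i \<le> j" "j < n"
    and \<kappa>: "\<kappa> = (lam j - \<nu>) / (lam (j+1) - \<nu>) * ((lam n - lam (j+1)) / (lam n - lam j))"
    and \<sigma>: "\<And>\<epsilon>. \<sigma> \<epsilon> = (\<kappa> + \<epsilon> * (2 - \<kappa>)) / ((2 - \<kappa>) + \<epsilon> * \<kappa>)"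
  shows "(\<forall>K z z'. effectively_pos_def S V K \<and> psd_id_step n H S U V K z z' \<and>
            rayleigh H S z \<in> {lam j <..< lam (j+1)} \<longrightarrow>
            (rayleigh H S z' - lam j) / (lam (j+1) - rayleigh H S z')
              \<le> (\<sigma> (quality S V \<Lambda> \<nu> K))\<^sup>2 *
                 ((rayleigh H S z - lam j) / (lam (j+1) - rayleigh H S z)))
       \<and> (lam j < lam (j+1) \<and> j + 1 < n \<longrightarrow>
            (\<forall>\<epsilon>\<in>{0..<1}. \<exists>z K z'.
               (\<forall>k::nat. z k \<in> cspan n {u j, u (j+1), u n} \<and>
                  effectively_pos_def S V (K k) \<and> quality S V \<Lambda> \<nu> (K k) = \<epsilon> \<and>
                  psd_id_step n H S U V (K k) (z k) (z' k) \<and>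
                  rayleigh H S (z k) \<in> {lam j <..< lam (j+1)}) \<and>
               (\<lambda>k. rayleigh H S (z k)) \<longlonglongrightarrow> lam j \<and>
               (\<lambda>k. ((rayleigh H S (z' k) - lam j) / (lam (j+1) - rayleigh H S (z' k))) /
                     ((rayleigh H S (z k) - lam j) / (lam (j+1) - rayleigh H S (z k))))
                 \<longlonglongrightarrow> (\<sigma> \<epsilon>)\<^sup>2))"
proof -
  interpret pencil_eigenbasis n H S lam u
    by unfold_locales (fact H S u_carrier u_eigen u_orthonormal)+
  have mono: "lam l \<le> lam m" if "1 \<le> l" "l \<le> m" "m \<le> n" for l m
  proof -
    have "sorted (map lam [1..<n+1])" using lam by (simp add: pair_eigenvalues_def)
    from sorted_nth_mono[OF this, of "l - 1" "m - 1"] that show ?thesis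
      by (simp del: upt_Suc)
  qed
  show ?thesis
  proof (intro conjI allI impI ballI)
    fix K z z'
    assume "effectively_pos_def S V K \<and> psd_id_step n H S U V K z z' \<and> rayleigh H S z \<in> {lam j <..< lam (j+1)}"
    thus "(rayleigh H S z' - lam j) / (lam (j+1) - rayleigh H S z')
        \<le> (\<sigma> (quality S V \<Lambda> \<nu> K))\<^sup>2 * ((rayleigh H S z - lam j) / (lam (j+1) - rayleigh H S z))"
      using psd_id_contraction[OF mono i U V \<Lambda> \<nu> j \<kappa>] unfolding \<sigma> by simp
  next
    fix \<epsilon> :: real
    assume gap: "lam j < lam (j+1) \<and> j + 1 < n" and \<epsilon>: "\<epsilon> \<in> {0..<1}"
    show "\<exists>z K z'.
               (\<forall>k::nat. z k \<in> cspan n {u j, u (j+1), u n} \<and>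
                  effectively_pos_def S V (K k) \<and> quality S V \<Lambda> \<nu> (K k) = \<epsilon> \<and>
                  psd_id_step n H S U V (K k) (z k) (z' k) \<and>
                  rayleigh H S (z k) \<in> {lam j <..< lam (j+1)}) \<and>
               (\<lambda>k. rayleigh H S (z k)) \<longlonglongrightarrow> lam j \<and>
               (\<lambda>k. ((rayleigh H S (z' k) - lam j) / (lam (j+1) - rayleigh H S (z' k))) /
                     ((rayleigh H S (z k) - lam j) / (lam (j+1) - rayleigh H S (z k))))
                 \<longlonglongrightarrow> (\<sigma> \<epsilon>)\<^sup>2"
      unfolding \<sigma> using gap \<epsilon> by (intro psd_id_sharp[OF mono i U V \<Lambda> \<nu> j(1) _ _ \<kappa>]) auto
  qed
qed

end
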